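(* Let $n\ge2$ and $j\ge1$. Let $$F_{2j-1}(k)=-\frac{1}{2j-1}\oint y_{2j-1}(k)\,dx$$ on $C^\infty(S^1,\mathbb{R}^{n-1})$, and let $\hat F_{2j-1}=F_{2j-1}\circ\Gamma$ be the induced functional on $\mathcal{M}_n$. Then the Hamiltonian flow for $\hat F_{2j-1}$ on $\mathcal{M}_n$ with respect to the Poisson structure $\{\,,\}^\wedge$ is the $(2j-1)$-th Airy curve flow $$\gamma_t=y_{2j-3}(k)\,e_1+(e_2,\ldots,e_n)\,\eta_{2j-3}(k),$$ where $(e_1,\ldots,e_n)(\cdot,t)$ is a parallel frame along $\gamma(\cdot,t)$ and $k(\cdot,t)$ is the corresponding vector of principal curvatures.
   Context: Parallel frames. For $\gamma$ parametrized by arc-length $x$, a parallel frame is a smooth $SO(n)$-valued map $g=(e_1,\ldots,e_n)$ with $e_1=\gamma_x$ and $g^{-1}g_x=\begin{pmatrix}0&-k^t\\ k&0\end{pmatrix}$; $k=(k_1,\ldots,k_{n-1})^t$ is the vector of principal curvatures with respect to $g$. Another parallel frame is $g\,\mathrm{diag}(1,c)$ with constant $c\in SO(n-1)$ and has principal curvatures $c^{-1}k$. The coefficients $Q_i$. Write $(n+1)\times(n+1)$ matrices in blocks of sizes $1,1,n-1$. Let $a=e_{21}-e_{12}\in so(n+1)$ ($e_{ij}$ elementary matrices) and for $k$ with values in $\mathbb{R}^{n-1}$ let $u=\Psi(k)=\begin{pmatrix}0&0&0\\ 0&0&-k^t\\ 0&k&0\end{pmatrix}$. There is a unique formal series $Q(u,\lambda)=a\lambda+\sum_{i\ge0}Q_i(u)\lambda^{-i}$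 with $$Q_{2i-1}=\begin{pmatrix}0&-y_{2i-1}&-\eta_{2i-1}^t\\ y_{2i-1}&0&0\\ \eta_{2i-1}&0&0\end{pmatrix},\qquad Q_{2i}=\begin{pmatrix}0&0&0\\ 0&0&-z_{2i}^t\\ 0&z_{2i}&\xi_{2i}\end{pmatrix}$$ ($y$ scalar, $\eta,z\in\mathbb{R}^{n-1}$, $\xi\in so(n-1)$) such that $[\partial_x+a\lambda+u,Q(u,\lambda)]=0$ and $Q(u,\lambda)$ is conjugate to $a\lambda$; all entries are differential polynomials in $k$. Set $Q_{-1}=a$ (so $y_{-1}=1$, $\eta_{-1}=0$). For example $z_0=k$, $\xi_0=0$, $y_1=-\frac12\|k\|^2$, $\eta_1=-k_x$. Poisson structure. On $C^\infty(S^1,\mathbb{R}^{n-1})$ use the $L^2$ inner product $\langle z_1,z_2\rangle=\oint z_1^tz_2\,dx$ and define $\nabla F(k)$ by $dF_k(z)=\langle\nabla F(k),z\rangle$. Put $\Xi_k(z)=z_x-\xi k$, where $\xi$ is $so(n-1)$-valued with $\xi_x=kz^t-zk^t$, and $\{H_1,H_2\}(k)=\langle\Xi_k(\nabla H_1(k)),\nabla H_2(k)\rangle$. This is used for functionals invariant under the action $k\mapsto c^{-1}k$ of $SO(n-1)$ (then $\xi$ exists on $S^1$, and the bracket does not depend on the constant of integration in $\xi$); the functionals $F_{2j-1}$ are invariant. $\mathcal{M}_n$ is the space of smooth $\gamma:S^1\to\mathbb{R}^n$ with $\|\gamma_x\|\equiv1$ (with trivial normal holonomy, so that parallel frames are periodic).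 $\Gamma:\mathcal{M}_n\to C^\infty(S^1,\mathbb{R}^{n-1})/SO(n-1)$ sends $\gamma$ to the $SO(n-1)$-orbit of its principal curvature vector $k$ for any parallel frame. For an $SO(n-1)$-invariant functional $H$, $\hat H(\gamma)=H(\Gamma(\gamma))$, and $\{\hat H_1,\hat H_2\}^\wedge(\gamma)=\{H_1,H_2\}(k)$. The Hamiltonian flow of $\hat H$ is the flow $\gamma_t=X(\gamma)$ with $d\Gamma_\gamma(X(\gamma))$ equal to the class of $\Xi_k(\nabla H(k))$, so that $d\hat G_\gamma(X(\gamma))=\{\hat H,\hat G\}^\wedge(\gamma)$ for all $SO(n-1)$-invariant functionals $G$. *)

theory Defs
  imports
    "HOL-Analysis.Analysis"
    "HOL-Computational_Algebra.Formal_Laurent_Series"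
begin

text \<open>
  Conventions. The type \<open>'m\<close> indexes \<open>\<real>\<^sup>n\<^sup>-\<^sup>1\<close>, so \<open>n = CARD('m) + 1\<close> is an arbitrary number
  \<open>\<ge> 2\<close>. The space \<open>\<real>\<^sup>n\<close> is \<open>real ^ 'm option\<close>, where \<open>None\<close> is the first (tangential) index and
  \<open>Some i\<close> are the remaining \<open>n - 1\<close> ones; \<open>(n+1) \<times> (n+1)\<close> matrices are indexed by
  \<open>'m option option\<close>, with blocks \<open>None\<close>, \<open>Some None\<close>, \<open>Some (Some i)\<close> of sizes \<open>1, 1, n - 1\<close>.
  The circle is \<open>\<real>/L\<int>\<close> for a period \<open>L > 0\<close>, and functions on it are \<open>L\<close>-periodic functions
  on the line.
\<close>

section \<open>Smooth functions and families\<close>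

definition smooth :: "(real \<Rightarrow> 'a::real_normed_vector) \<Rightarrow> bool" where
  "smooth f \<longleftrightarrow> (\<exists>D :: nat \<Rightarrow> real \<Rightarrow> 'a. D 0 = f \<and>
     (\<forall>i x. (D i has_vector_derivative D (Suc i) x) (at x)))"

definition smooth_loop :: "real \<Rightarrow> (real \<Rightarrow> 'a::real_normed_vector) \<Rightarrow> bool" where
  "smooth_loop L f \<longleftrightarrow> smooth f \<and> (\<forall>x. f (x + L) = f x)"

text \<open>
  \<open>smooth_family L T f\<close>: the map \<open>(t, x) \<mapsto> f t x\<close> is jointly \<open>C\<^sup>\<infinity>\<close> on \<open>T \<times> \<real>/L\<int>\<close>, for an open
  parameter set \<open>T\<close>. Here \<open>D i j\<close> is the derivative of order \<open>i\<close> in \<open>t\<close> and \<open>j\<close> in \<open>x\<close>.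
\<close>
definition smooth_family :: "real \<Rightarrow> real set \<Rightarrow> (real \<Rightarrow> real \<Rightarrow> 'a::real_normed_vector) \<Rightarrow> bool" where
  "smooth_family L T f \<longleftrightarrow>
     (\<exists>D :: nat \<Rightarrow> nat \<Rightarrow> real \<Rightarrow> real \<Rightarrow> 'a. D 0 0 = f \<and>
        (\<forall>i j. continuous_on (T \<times> UNIV) (\<lambda>(t, x). D i j t x)) \<and>
        (\<forall>i j. \<forall>t\<in>T. \<forall>x. ((\<lambda>s. D i j s x) has_vector_derivative D (Suc i) j t x) (at t) \<and>
                         (D i j t has_vector_derivative D i (Suc j) t x) (at x))) \<and>
     (\<forall>t\<in>T. \<forall>x. f t (x + L) = f t x)"

definition velocity :: "(real \<Rightarrow> real \<Rightarrow> 'a::real_normed_vector) \<Rightarrow> real \<Rightarrow> real \<Rightarrow> 'a" where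
  "velocity f t x = vector_derivative (\<lambda>s. f s x) (at t)"

definition l2_inner :: "real \<Rightarrow> (real \<Rightarrow> real ^ 'm) \<Rightarrow> (real \<Rightarrow> real ^ 'm) \<Rightarrow> real" where
  "l2_inner L z w = integral {0..L} (\<lambda>x. z x \<bullet> w x)"

definition skew :: "real ^ 'm ^ 'm \<Rightarrow> bool" where
  "skew A \<longleftrightarrow> transpose A = - A"

definition outer :: "real ^ 'm \<Rightarrow> real ^ 'm \<Rightarrow> real ^ 'm ^ 'm" where
  "outer v w = (\<chi> i j. v $ i * w $ j)"


section \<open>The formal series \<open>Q(u, \<lambda>)\<close>\<close>

text \<open>Formal Laurent series are in the variable \<open>\<lambda>\<^sup>-\<^sup>1\<close>, i.e. \<open>fls_X\<close> stands for \<open>\<lambda>\<^sup>-\<^sup>1\<close>.\<close>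

abbreviation lam :: "real fls" where
  "lam \<equiv> fls_X_inv"

text \<open>The coefficient of \<open>\<lambda>\<^sup>-\<^sup>m\<close>.\<close>
definition mcoeff :: "int \<Rightarrow> real fls ^ 'p ^ 'p \<Rightarrow> real ^ 'p ^ 'p" where
  "mcoeff m A = (\<chi> p q. fls_nth (A $ p $ q) m)"

definition mconst :: "real ^ 'p ^ 'p \<Rightarrow> real fls ^ 'p ^ 'p" where
  "mconst A = (\<chi> p q. fls_const (A $ p $ q))"

definition mat_a :: "real ^ ('m::finite) option option ^ 'm option option" where
  "mat_a = (\<chi> p q. case (p, q) of
      (Some None, None) \<Rightarrow> 1
    | (None, Some None) \<Rightarrow> -1
    | _ \<Rightarrow> 0)"

definition odd_block :: "real \<Rightarrow> real ^ 'm \<Rightarrow> real ^ 'm option option ^ 'm option option" where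
  "odd_block y \<eta> = (\<chi> p q. case (p, q) of
      (None, Some None) \<Rightarrow> - y
    | (None, Some (Some i)) \<Rightarrow> - \<eta> $ i
    | (Some None, None) \<Rightarrow> y
    | (Some (Some i), None) \<Rightarrow> \<eta> $ i
    | _ \<Rightarrow> 0)"

definition even_block :: "real ^ 'm \<Rightarrow> real ^ 'm ^ 'm \<Rightarrow> real ^ 'm option option ^ 'm option option" where
  "even_block z \<xi> = (\<chi> p q. case (p, q) of
      (Some None, Some (Some i)) \<Rightarrow> - z $ i
    | (Some (Some i), Some None) \<Rightarrow> z $ i
    | (Some (Some i), Some (Some j)) \<Rightarrow> \<xi> $ i $ j
    | _ \<Rightarrow> 0)"

definition Psi :: "real ^ 'm \<Rightarrow> real ^ 'm option option ^ 'm option option" where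
  "Psi v = even_block v 0"

definition a_lam :: "real fls ^ ('m::finite) option option ^ 'm option option" where
  "a_lam = (\<chi> p q. lam * mconst mat_a $ p $ q)"

text \<open>
  The third-to-last clause is \<open>[\<partial>\<^sub>x + a\<lambda> + u, Q] = 0\<close>, written coefficientwise as
  \<open>Q\<^sub>x = Q (a\<lambda> + u) - (a\<lambda> + u) Q\<close>; conjugacy is over the field of formal Laurent series in
  \<open>\<lambda>\<^sup>-\<^sup>1\<close>, pointwise in \<open>x\<close>.
\<close>
definition is_Q_series ::
  "(real \<Rightarrow> real ^ 'm) \<Rightarrow> (real \<Rightarrow> real fls ^ 'm option option ^ 'm option option) \<Rightarrow> bool" where
  "is_Q_series k Q \<longleftrightarrow>
     (\<forall>x. \<forall>m < -1. mcoeff m (Q x) = 0) \<and>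
     (\<forall>x. mcoeff (-1) (Q x) = mat_a) \<and>
     (\<forall>x. \<forall>m \<ge> 0. odd m \<longrightarrow> (\<exists>y \<eta>. mcoeff m (Q x) = odd_block y \<eta>)) \<and>
     (\<forall>x. \<forall>m \<ge> 0. even m \<longrightarrow> (\<exists>z \<xi>. skew \<xi> \<and> mcoeff m (Q x) = even_block z \<xi>)) \<and>
     (\<forall>m x. ((\<lambda>x. mcoeff m (Q x)) has_vector_derivative
        mcoeff m (Q x ** (a_lam + mconst (Psi (k x))) - (a_lam + mconst (Psi (k x))) ** Q x)) (at x)) \<and>
     (\<forall>m. smooth (\<lambda>x. mcoeff m (Q x))) \<and>
     (\<forall>x. \<exists>P :: real fls ^ 'm option option ^ 'm option option. invertible P \<and> Q x = P ** a_lam ** matrix_inv P)"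

definition Q_series ::
  "(real \<Rightarrow> real ^ 'm) \<Rightarrow> real \<Rightarrow> real fls ^ 'm option option ^ 'm option option" where
  "Q_series k = (THE Q. is_Q_series k Q)"

text \<open>These are meant for odd \<open>m \<ge> -1\<close>; in particular \<open>y\<^sub>-\<^sub>1 = 1\<close> and \<open>\<eta>\<^sub>-\<^sub>1 = 0\<close> are read off from
  \<open>Q\<^sub>-\<^sub>1 = a\<close>.\<close>

definition y_coeff :: "int \<Rightarrow> (real \<Rightarrow> real ^ 'm) \<Rightarrow> real \<Rightarrow> real" where
  "y_coeff m k x = mcoeff m (Q_series k x) $ Some None $ None"

definition eta_coeff :: "int \<Rightarrow> (real \<Rightarrow> real ^ 'm) \<Rightarrow> real \<Rightarrow> real ^ 'm" where
  "eta_coeff m k x = (\<chi> i. mcoeff m (Q_series k x) $ Some (Some i) $ None)"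

text \<open>\<open>F_functional L j\<close> is \<open>F\<^bsub>2j-1\<^esub>\<close>.\<close>
definition F_functional :: "real \<Rightarrow> nat \<Rightarrow> (real \<Rightarrow> real ^ 'm) \<Rightarrow> real" where
  "F_functional L j k = - (1 / (2 * real j - 1)) * integral {0..L} (y_coeff (2 * int j - 1) k)"


section \<open>Gradients and the Poisson structure on \<open>C\<^sup>\<infinity>(S\<^sup>1, \<real>\<^sup>n\<^sup>-\<^sup>1)\<close>\<close>

text \<open>
  \<open>w = \<nabla>F(k)\<close>, with the differential \<open>dF\<^sub>k\<close> understood along all smooth curves through \<open>k\<close> (not only
  straight lines \<open>k + s z\<close>), so that the chain rule is available.
\<close>
definition has_gradient ::
  "real \<Rightarrow> ((real \<Rightarrow> real ^ 'm) \<Rightarrow> real) \<Rightarrow> (real \<Rightarrow> real ^ 'm) \<Rightarrow> (real \<Rightarrow> real ^ 'm) \<Rightarrow> bool" where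
  "has_gradient L F k w \<longleftrightarrow> smooth_loop L w \<and>
     (\<forall>T \<kappa> t. open T \<and> t \<in> T \<and> smooth_family L T \<kappa> \<and> \<kappa> t = k \<longrightarrow>
        ((\<lambda>s. F (\<kappa> s)) has_real_derivative l2_inner L w (velocity \<kappa> t)) (at t))"

definition grad ::
  "real \<Rightarrow> ((real \<Rightarrow> real ^ 'm) \<Rightarrow> real) \<Rightarrow> (real \<Rightarrow> real ^ 'm) \<Rightarrow> real \<Rightarrow> real ^ 'm" where
  "grad L F k = (THE w. has_gradient L F k w)"

definition invariant_functional :: "real \<Rightarrow> ((real \<Rightarrow> real ^ 'm) \<Rightarrow> real) \<Rightarrow> bool" where
  "invariant_functional L H \<longleftrightarrow>
     (\<forall>k. smooth_loop L k \<longrightarrow>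
        (\<exists>w. has_gradient L H k w) \<and>
        (\<forall>c. rotation_matrix c \<longrightarrow> H (\<lambda>x. matrix_inv c *v k x) = H k))"

definition is_xi ::
  "real \<Rightarrow> (real \<Rightarrow> real ^ 'm) \<Rightarrow> (real \<Rightarrow> real ^ 'm) \<Rightarrow> (real \<Rightarrow> real ^ 'm ^ 'm) \<Rightarrow> bool" where
  "is_xi L k z \<xi> \<longleftrightarrow> smooth_loop L \<xi> \<and>
     (\<forall>x. skew (\<xi> x) \<and> (\<xi> has_vector_derivative outer (k x) (z x) - outer (z x) (k x)) (at x))"

text \<open>The choice of \<open>\<xi>\<close> is the choice of the constant of integration.\<close>
definition Xi :: "real \<Rightarrow> (real \<Rightarrow> real ^ 'm) \<Rightarrow> (real \<Rightarrow> real ^ 'm) \<Rightarrow> real \<Rightarrow> real ^ 'm" where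
  "Xi L k z x = vector_derivative z (at x) - (SOME \<xi>. is_xi L k z \<xi>) x *v k x"

definition poisson ::
  "real \<Rightarrow> ((real \<Rightarrow> real ^ 'm) \<Rightarrow> real) \<Rightarrow> ((real \<Rightarrow> real ^ 'm) \<Rightarrow> real) \<Rightarrow> (real \<Rightarrow> real ^ 'm) \<Rightarrow> real" where
  "poisson L H\<^sub>1 H\<^sub>2 k = l2_inner L (Xi L k (grad L H\<^sub>1 k)) (grad L H\<^sub>2 k)"


section \<open>Curves, parallel frames and the map \<open>\<Gamma>\<close>\<close>

text \<open>The matrix with blocks \<open>0, -v\<^sup>t; v, 0\<close>.\<close>
definition curvature_matrix :: "real ^ 'm \<Rightarrow> real ^ 'm option ^ 'm option" where
  "curvature_matrix v = (\<chi> p q. case (p, q) of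
      (None, Some i) \<Rightarrow> - v $ i
    | (Some i, None) \<Rightarrow> v $ i
    | _ \<Rightarrow> 0)"

text \<open>The columns of \<open>g x\<close> are \<open>e\<^sub>1, \<dots>, e\<^sub>n\<close>. Frames are required to be periodic.\<close>
definition parallel_frame ::
  "real \<Rightarrow> (real \<Rightarrow> real ^ 'm option) \<Rightarrow> (real \<Rightarrow> real ^ 'm option ^ 'm option) \<Rightarrow> (real \<Rightarrow> real ^ 'm) \<Rightarrow> bool" where
  "parallel_frame L \<gamma> g k \<longleftrightarrow>
     smooth_loop L g \<and> smooth_loop L k \<and>
     (\<forall>x. rotation_matrix (g x) \<and>
          column None (g x) = vector_derivative \<gamma> (at x) \<and>
          matrix_inv (g x) ** vector_derivative g (at x) = curvature_matrix (k x))"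

text \<open>\<open>\<M>\<^sub>n\<close>; trivial normal holonomy is the existence of a periodic parallel frame.\<close>
definition curves :: "real \<Rightarrow> (real \<Rightarrow> real ^ ('m::finite) option) set" where
  "curves L = {\<gamma>. smooth_loop L \<gamma> \<and> (\<forall>x. norm (vector_derivative \<gamma> (at x)) = 1) \<and>
                  (\<exists>g k. parallel_frame L \<gamma> g k)}"

definition so_orbit :: "(real \<Rightarrow> real ^ 'm) \<Rightarrow> (real \<Rightarrow> real ^ 'm) set" where
  "so_orbit k = {\<lambda>x. matrix_inv c *v k x | c. rotation_matrix c}"

definition Gam :: "real \<Rightarrow> (real \<Rightarrow> real ^ 'm option) \<Rightarrow> (real \<Rightarrow> real ^ 'm) set" where
  "Gam L \<gamma> = so_orbit (SOME k. \<exists>g. parallel_frame L \<gamma> g k)"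

definition hat ::
  "real \<Rightarrow> ((real \<Rightarrow> real ^ 'm) \<Rightarrow> real) \<Rightarrow> (real \<Rightarrow> real ^ 'm option) \<Rightarrow> real" where
  "hat L H \<gamma> = H (SOME k. k \<in> Gam L \<gamma>)"

definition poisson_hat ::
  "real \<Rightarrow> ((real \<Rightarrow> real ^ 'm) \<Rightarrow> real) \<Rightarrow> ((real \<Rightarrow> real ^ 'm) \<Rightarrow> real) \<Rightarrow> (real \<Rightarrow> real ^ 'm option) \<Rightarrow> real" where
  "poisson_hat L H\<^sub>1 H\<^sub>2 = hat L (poisson L H\<^sub>1 H\<^sub>2)"


section \<open>The differential of \<open>\<Gamma>\<close>\<close>

text \<open>
  The tangent space of \<open>C\<^sup>\<infinity>(S\<^sup>1, \<real>\<^sup>n\<^sup>-\<^sup>1)/SO(n-1)\<close> at the orbit of \<open>k\<close> consists of the classes of \<open>v\<close> modulo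
  the tangent vectors \<open>\<theta> k\<close>, \<open>\<theta> \<in> so(n-1)\<close>, of the orbit.
\<close>
definition tangent_class :: "(real \<Rightarrow> real ^ 'm) \<Rightarrow> (real \<Rightarrow> real ^ 'm) \<Rightarrow> (real \<Rightarrow> real ^ 'm) set" where
  "tangent_class k v = {\<lambda>x. v x + \<theta> *v k x | \<theta>. skew \<theta>}"

text \<open>
  The pairs (curve, parallel frame), together with their principal curvatures, are cut out in the vector
  space of smooth periodic triples \<open>(\<gamma>, g, k)\<close> by the equations \<open>g\<^sup>t g = 1\<close>, \<open>g e\<^sub>1 = \<gamma>\<^sub>x\<close> and
  \<open>g\<^sub>x = g (0, -k\<^sup>t; k, 0)\<close> (and the open and closed condition \<open>det g = 1\<close>).
\<close>
definition frame_residual ::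
  "(real \<Rightarrow> real ^ 'm option) \<Rightarrow> (real \<Rightarrow> real ^ 'm option ^ 'm option) \<Rightarrow> (real \<Rightarrow> real ^ 'm) \<Rightarrow> real \<Rightarrow>
     (real ^ 'm option ^ 'm option) \<times> (real ^ 'm option) \<times> (real ^ 'm option ^ 'm option)" where
  "frame_residual \<gamma> g k x =
     (transpose (g x) ** g x - mat 1,
      column None (g x) - vector_derivative \<gamma> (at x),
      vector_derivative g (at x) - g x ** curvature_matrix (k x))"

text \<open>
  \<open>(X, W, v)\<close> is tangent at \<open>(\<gamma>, g, k)\<close>: the equations hold to first order along
  \<open>(\<gamma> + sX, g + sW, k + sv)\<close>.
\<close>
definition frame_tangent ::
  "real \<Rightarrow> (real \<Rightarrow> real ^ 'm option) \<Rightarrow> (real \<Rightarrow> real ^ 'm option ^ 'm option) \<Rightarrow> (real \<Rightarrow> real ^ 'm) \<Rightarrow>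
     (real \<Rightarrow> real ^ 'm option) \<Rightarrow> (real \<Rightarrow> real ^ 'm option ^ 'm option) \<Rightarrow> (real \<Rightarrow> real ^ 'm) \<Rightarrow> bool" where
  "frame_tangent L \<gamma> g k X W v \<longleftrightarrow>
     smooth_loop L X \<and> smooth_loop L W \<and> smooth_loop L v \<and>
     (\<forall>x. ((\<lambda>s. frame_residual (\<lambda>x. \<gamma> x + s *\<^sub>R X x) (\<lambda>x. g x + s *\<^sub>R W x) (\<lambda>x. k x + s *\<^sub>R v x) x)
              has_vector_derivative 0) (at 0))"

text \<open>
  \<open>d\<Gamma>\<^sub>\<gamma>(X)\<close> as a set of representatives at the point \<open>k\<close> of the orbit \<open>\<Gamma>(\<gamma>)\<close>. The set is empty
  exactly when \<open>X\<close> is not tangent to \<open>\<M>\<^sub>n\<close> at \<open>\<gamma>\<close>, i.e. when \<open>X\<close> does not preserve, to first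
  order, unit speed and the periodicity of parallel frames.
\<close>
definition dGam ::
  "real \<Rightarrow> (real \<Rightarrow> real ^ 'm option) \<Rightarrow> (real \<Rightarrow> real ^ 'm option ^ 'm option) \<Rightarrow> (real \<Rightarrow> real ^ 'm) \<Rightarrow>
     (real \<Rightarrow> real ^ 'm option) \<Rightarrow> (real \<Rightarrow> real ^ 'm) set" where
  "dGam L \<gamma> g k X = {v. \<exists>W. frame_tangent L \<gamma> g k X W v}"


section \<open>Hamiltonian flows and Airy curve flows\<close>

text \<open>
  \<open>X\<close> is the value at \<open>\<gamma>\<close> of the Hamiltonian vector field of \<open>hat H\<close>. In the last clause,
  \<open>l2_inner L (grad L G k) v\<close> with \<open>v \<in> d\<Gamma>\<^sub>\<gamma>(X)\<close> is the differential of \<open>hat G\<close> at \<open>\<gamma>\<close>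
  applied to \<open>X\<close>.
\<close>
definition hamiltonian_at ::
  "real \<Rightarrow> ((real \<Rightarrow> real ^ 'm) \<Rightarrow> real) \<Rightarrow> (real \<Rightarrow> real ^ 'm option) \<Rightarrow> (real \<Rightarrow> real ^ 'm option) \<Rightarrow> bool" where
  "hamiltonian_at L H \<gamma> X \<longleftrightarrow>
     (\<forall>g k. parallel_frame L \<gamma> g k \<longrightarrow>
        (\<exists>\<xi>. is_xi L k (grad L H k) \<xi>) \<and>
        dGam L \<gamma> g k X = tangent_class k (Xi L k (grad L H k)) \<and>
        (\<forall>G. invariant_functional L G \<longrightarrow>
           (\<forall>v \<in> dGam L \<gamma> g k X. l2_inner L (grad L G k) v = poisson_hat L H G \<gamma>)))"

definition hamiltonian_field ::
  "real \<Rightarrow> ((real \<Rightarrow> real ^ 'm) \<Rightarrow> real) \<Rightarrow>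
     ((real \<Rightarrow> real ^ 'm option) \<Rightarrow> (real \<Rightarrow> real ^ 'm option)) \<Rightarrow> bool" where
  "hamiltonian_field L H X \<longleftrightarrow> (\<forall>\<gamma> \<in> curves L. hamiltonian_at L H \<gamma> (X \<gamma>))"

text \<open>A smooth family of frames along \<open>\<gamma> t\<close>, \<open>t \<in> T\<close>, with its principal curvatures.\<close>
definition parallel_frame_family ::
  "real \<Rightarrow> real set \<Rightarrow> (real \<Rightarrow> real \<Rightarrow> real ^ 'm option) \<Rightarrow>
     (real \<Rightarrow> real \<Rightarrow> real ^ 'm option ^ 'm option) \<Rightarrow> (real \<Rightarrow> real \<Rightarrow> real ^ 'm) \<Rightarrow> bool" where
  "parallel_frame_family L T \<gamma> g k \<longleftrightarrow>
     smooth_family L T g \<and> smooth_family L T k \<and> (\<forall>t\<in>T. parallel_frame L (\<gamma> t) (g t) (k t))"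

text \<open>
  Besides the infinitesimal condition at each time, this includes the time derivatives of \<open>\<Gamma>(\<gamma>(t))\<close> and
  of the observables \<open>hat G (\<gamma>(t))\<close> along the flow.
\<close>
definition hamiltonian_flow ::
  "real \<Rightarrow> ((real \<Rightarrow> real ^ 'm) \<Rightarrow> real) \<Rightarrow> real set \<Rightarrow> (real \<Rightarrow> real \<Rightarrow> real ^ 'm option) \<Rightarrow> bool" where
  "hamiltonian_flow L H T \<gamma> \<longleftrightarrow>
     smooth_family L T \<gamma> \<and>
     (\<forall>t\<in>T. \<gamma> t \<in> curves L \<and>
        hamiltonian_at L H (\<gamma> t) (velocity \<gamma> t) \<and>
        (\<forall>g k. parallel_frame_family L T \<gamma> g k \<longrightarrow>
           velocity k t \<in> tangent_class (k t) (Xi L (k t) (grad L H (k t)))) \<and>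
        (\<forall>G. invariant_functional L G \<longrightarrow>
           ((\<lambda>s. hat L G (\<gamma> s)) has_real_derivative poisson_hat L H G (\<gamma> t)) (at t)))"

text \<open>The right-hand side of the \<open>(2j-1)\<close>-th Airy curve flow, computed with the frame \<open>g\<close>.\<close>
definition airy_field ::
  "nat \<Rightarrow> (real \<Rightarrow> real ^ 'm option ^ 'm option) \<Rightarrow> (real \<Rightarrow> real ^ 'm) \<Rightarrow> real \<Rightarrow> real ^ 'm option" where
  "airy_field j g k x =
     y_coeff (2 * int j - 3) k x *\<^sub>R column None (g x) +
     (\<Sum>i\<in>UNIV. eta_coeff (2 * int j - 3) k x $ i *\<^sub>R column (Some i) (g x))"

definition airy_curve_flow ::
  "real \<Rightarrow> nat \<Rightarrow> real set \<Rightarrow> (real \<Rightarrow> real \<Rightarrow> real ^ ('m::finite) option) \<Rightarrow> bool" where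
  "airy_curve_flow L j T \<gamma> \<longleftrightarrow>
     smooth_family L T \<gamma> \<and> (\<forall>t\<in>T. \<gamma> t \<in> curves L) \<and>
     (\<exists>g k. parallel_frame_family L T \<gamma> g k \<and>
        (\<forall>t\<in>T. \<forall>x. velocity \<gamma> t x = airy_field j (g t) (k t) x))"

end

theory Submission
  imports Defs
begin

unbundle no Formal_Power_Series.fps_syntax

text \<open>
  Proof idea. Put \<open>\<epsilon> = \<lambda>\<^sup>-\<^sup>1\<close> and \<open>R = \<epsilon>Q\<close>. Being conjugate to \<open>a\<close>, the skew matrix \<open>R\<close> has rank two, so it is determined by
  the quotients \<open>h, \<zeta>\<close> of its entries \<open>\<Sum> \<eta>\<^sub>2\<^sub>i\<^sub>-\<^sub>1 \<epsilon>\<^sup>2\<^sup>i\<close> and \<open>\<Sum> z\<^sub>2\<^sub>i \<epsilon>\<^sup>2\<^sup>i\<^sup>+\<^sup>1\<close> by \<open>Y = \<Sum> y\<^sub>2\<^sub>i\<^sub>-\<^sub>1 \<epsilon>\<^sup>2\<^sup>i\<close>. For \<open>h, \<zeta>\<close> the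
  Lax equation becomes a Riccati system that is a contraction in \<open>\<epsilon>\<close>; this yields existence of \<open>Q\<close>,
  its smooth dependence on \<open>k\<close>, and equivariance.

  For a variation \<open>k\<^sub>t\<close> the Kirillov form \<open>\<omega> = tr (R [R\<^sub>t, R\<^sub>\<epsilon>])\<close> satisfies
  \<open>\<epsilon>\<^sup>2 \<omega>\<^sub>x = - \<epsilon>\<^sup>2 tr (R\<^sub>\<epsilon> u\<^sub>t) - tr (R\<^sub>t a)\<close>. Integrated over the circle, the coefficients of this identity say that
  \<open>\<nabla>F\<^sub>2\<^sub>j\<^sub>-\<^sub>1 = z\<^sub>2\<^sub>j\<^sub>-\<^sub>2\<close>. On the other hand \<open>X = y\<^sub>2\<^sub>j\<^sub>-\<^sub>3 e\<^sub>1 + (e\<^sub>2, \<dots>, e\<^sub>n) \<eta>\<^sub>2\<^sub>j\<^sub>-\<^sub>3\<close> has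
  \<open>X\<^sub>x = (e\<^sub>2, \<dots>, e\<^sub>n) z\<^sub>2\<^sub>j\<^sub>-\<^sub>2\<close> by the Lax equation, and differentiating the frame equations along any field with
  \<open>X\<^sub>x = (e\<^sub>2, \<dots>, e\<^sub>n) z\<close> shows that \<open>d\<Gamma>(X)\<close> is the class of \<open>\<Xi>\<^sub>k(z)\<close>.
\<close>

text \<open>The Lax equation alone is not a recursion for Q: it yields only the x-derivatives of y
  and \<xi>, and their constants of integration are fixed by the conjugacy clause. The Riccati form
  avoids this integration. The image of R is a 2-plane, h and \<zeta> are its coordinates in an
  affine chart of the Grassmannian, and each iteration uses only products and x-derivatives. The
  lower right block is then the minor Y (\<zeta> h^t - h \<zeta>^t), and Y comes from a
  normalization. The Kirillov identity rests on (ad R)^2 = -1 on skew directions tangent to the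
  orbit, such as the t- and \<epsilon>-derivatives of R. The \<epsilon>-derivative creates the
  factor 2j-1 by which the definition of the functional divides. As gradients are tested along
  arbitrary smooth curves of curvatures, the series are built for families in (t, x) from the start.
  On the Hamiltonian side, the choices of \<xi>, of a frame and of an orbit representative must be
  shown to be immaterial. For the bracket this holds because the gradient of an invariant functional
  is orthogonal to the directions \<theta> k of the orbit.\<close>

subsection \<open>Smooth families\<close>

text \<open>In contrast to the definition, \<open>D 0 0\<close> need only agree with \<open>f\<close> for parameters in \<open>T\<close>.\<close>

lemma smooth_familyI:
  fixes f :: "real \<Rightarrow> real \<Rightarrow> 'a::real_normed_vector"
  assumes "open T" and eq: "\<And>t x. t \<in> T \<Longrightarrow> D 0 0 t x = f t x"
    and cont: "\<And>i j. continuous_on (T \<times> UNIV) (\<lambda>(t, x). D i j t x)"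
    and dt: "\<And>i j t x. t \<in> T \<Longrightarrow> ((\<lambda>s. D i j s x) has_vector_derivative D (Suc i) j t x) (at t)"
    and dx: "\<And>i j t x. t \<in> T \<Longrightarrow> (D i j t has_vector_derivative D i (Suc j) t x) (at x)"
    and per: "\<And>t x. t \<in> T \<Longrightarrow> f t (x + L) = f t x"
  shows "smooth_family L T f"
proof -
  define E where "E = (\<lambda>i j. if i = 0 \<and> j = 0 then f else D i j)"
  have E: "E i j t x = D i j t x" if "t \<in> T" for i j t x
    using eq[OF that] by (auto simp: E_def)
  have "continuous_on (T \<times> UNIV) (\<lambda>(t, x). E i j t x)" for i j
    by (rule continuous_on_eq[OF cont[of i j]]) (auto simp: E)
  moreover have "((\<lambda>s. E i j s x) has_vector_derivative E (Suc i) j t x) (at t)" if "t \<in> T" for i j t x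
    unfolding E[OF that]
    by (rule has_vector_derivative_transform_within_open[OF dt[OF that] assms(1) that]) (simp add: E)
  moreover have "(E i j t has_vector_derivative E i (Suc j) t x) (at x)" if "t \<in> T" for i j t x
  proof -
    have "E i j t = D i j t" "E i (Suc j) t = D i (Suc j) t" using E[OF that] by auto
    then show ?thesis using dx[OF that] by simp
  qed
  moreover have "E 0 0 = f" by (simp add: E_def)
  ultimately show ?thesis unfolding smooth_family_def using per by blast
qed

lemma smooth_familyE:
  assumes "smooth_family L T f"
  obtains D where "D 0 0 = f"
    "\<And>i j. continuous_on (T \<times> UNIV) (\<lambda>(t, x). D i j t x)"
    "\<And>i j t x. t \<in> T \<Longrightarrow> ((\<lambda>s. D i j s x) has_vector_derivative D (Suc i) j t x) (at t)"
    "\<And>i j t x. t \<in> T \<Longrightarrow> (D i j t has_vector_derivative D i (Suc j) t x) (at x)"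
    "\<And>t x. t \<in> T \<Longrightarrow> f t (x + L) = f t x"
  using assms unfolding smooth_family_def by blast

definition dx :: "(real \<Rightarrow> real \<Rightarrow> 'a::real_normed_vector) \<Rightarrow> real \<Rightarrow> real \<Rightarrow> 'a" where
  "dx f t x = vector_derivative (f t) (at x)"

lemma smooth_family_has_dx:
  "smooth_family L T f \<Longrightarrow> t \<in> T \<Longrightarrow> (f t has_vector_derivative dx f t x) (at x)"
  unfolding dx_def by (metis smooth_familyE vector_derivative_at)

lemma smooth_family_has_velocity:
  "smooth_family L T f \<Longrightarrow> t \<in> T \<Longrightarrow> ((\<lambda>s. f s x) has_vector_derivative velocity f t x) (at t)"
  unfolding velocity_def by (metis smooth_familyE vector_derivative_at)

lemma smooth_family_periodic:
  "smooth_family L T f \<Longrightarrow> t \<in> T \<Longrightarrow> f t (x + L) = f t x"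
  by (auto elim: smooth_familyE)

lemma periodic_derivative:
  fixes f :: "real \<Rightarrow> 'a::real_normed_vector"
  assumes per: "\<And>x. f (x + L) = f x" and d: "\<And>x. (f has_vector_derivative d x) (at x)"
  shows "d (x + L) = d x"
proof -
  have "((f \<circ> (\<lambda>x. x + L)) has_vector_derivative 1 *\<^sub>R d (x + L)) (at x)"
    by (rule vector_diff_chain_at) (auto intro!: derivative_eq_intros d)
  moreover have "f \<circ> (\<lambda>x. x + L) = f" using per by auto
  ultimately show ?thesis using d[of x] vector_derivative_unique_at by fastforce
qed

text \<open>All three parts shift indices in the array \<open>D\<close>. Schwarz's theorem is not
  involved in the last one: both orders of differentiation give the same entry
  \<open>D 1 1\<close>.\<close>

lemma smooth_family_shift:
  assumes "open T" "smooth_family L T f"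
  shows smooth_family_dx: "smooth_family L T (dx f)"
    and smooth_family_velocity: "smooth_family L T (velocity f)"
    and velocity_dx: "t \<in> T \<Longrightarrow> velocity (dx f) t x = dx (velocity f) t x"
proof -
  obtain D where D: "D 0 0 = f"
    "\<And>i j. continuous_on (T \<times> UNIV) (\<lambda>(t, x). D i j t x)"
    "\<And>i j t x. t \<in> T \<Longrightarrow> ((\<lambda>s. D i j s x) has_vector_derivative D (Suc i) j t x) (at t)"
    "\<And>i j t x. t \<in> T \<Longrightarrow> (D i j t has_vector_derivative D i (Suc j) t x) (at x)"
    "\<And>t x. t \<in> T \<Longrightarrow> f t (x + L) = f t x"
    using assms(2) by (rule smooth_familyE) (rule that)
  have 1: "D 0 (Suc 0) t x = dx f t x" if "t \<in> T" for t x
    using D(4)[of t 0 0 x] that D(1) by (auto simp: dx_def vector_derivative_at)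
  have 2: "D (Suc 0) 0 t x = velocity f t x" if "t \<in> T" for t x
    using D(3)[of t 0 0 x] that D(1) by (auto simp: velocity_def vector_derivative_at)
  show A: "smooth_family L T (dx f)"
  proof (rule smooth_familyI[where D="\<lambda>i j. D i (Suc j)"])
    show "dx f t (x + L) = dx f t x" if "t \<in> T" for t x
      using periodic_derivative[of "f t" L "dx f t"] D(5)[OF that] smooth_family_has_dx[OF assms(2) that] by auto
  qed (use assms D 1 in auto)
  show B: "smooth_family L T (velocity f)"
  proof (rule smooth_familyI[where D="\<lambda>i j. D (Suc i) j"])
    show "velocity f t (x + L) = velocity f t x" if "t \<in> T" for t x
    proof -
      have "((\<lambda>s. f s (x + L)) has_vector_derivative velocity f t x) (at t)"
        by (rule has_vector_derivative_transform_within_open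
            [OF smooth_family_has_velocity[OF assms(2) that] assms(1) that]) (simp add: D(5))
      then show ?thesis by (simp add: velocity_def vector_derivative_at)
    qed
  qed (use assms D 2 in auto)
  show "velocity (dx f) t x = dx (velocity f) t x" if t: "t \<in> T"
  proof -
    have "((\<lambda>s. dx f s x) has_vector_derivative D (Suc 0) (Suc 0) t x) (at t)"
      by (rule has_vector_derivative_transform_within_open[OF D(3)[OF t, of 0 "Suc 0"] assms(1) t]) (simp add: 1)
    moreover have "(velocity f t has_vector_derivative D (Suc 0) (Suc 0) t x) (at x)"
    proof -
      have "D (Suc 0) 0 t = velocity f t" using 2[OF t] by auto
      then show ?thesis using D(4)[OF t, of "Suc 0" 0 x] by simp
    qed
    ultimately show ?thesis by (simp add: velocity_def dx_def vector_derivative_at)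
  qed
qed

lemma smooth_family_bounded_linear:
  assumes "open T" "bounded_linear h" "smooth_family L T f"
  shows "smooth_family L T (\<lambda>t x. h (f t x))"
proof -
  interpret bounded_linear h by fact
  obtain D where D: "D 0 0 = f"
    "\<And>i j. continuous_on (T \<times> UNIV) (\<lambda>(t, x). D i j t x)"
    "\<And>i j t x. t \<in> T \<Longrightarrow> ((\<lambda>s. D i j s x) has_vector_derivative D (Suc i) j t x) (at t)"
    "\<And>i j t x. t \<in> T \<Longrightarrow> (D i j t has_vector_derivative D i (Suc j) t x) (at x)"
    "\<And>t x. t \<in> T \<Longrightarrow> f t (x + L) = f t x"
    using assms(3) by (rule smooth_familyE) (rule that)
  show ?thesis
  proof (rule smooth_familyI[OF assms(1), where D="\<lambda>i j t x. h (D i j t x)"])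
    show "continuous_on (T \<times> UNIV) (\<lambda>(t, x). h (D i j t x))" for i j
      using continuous_on[OF D(2)] by (simp add: case_prod_unfold)
  qed (use D in \<open>auto intro: has_vector_derivative\<close>)
qed

lemma smooth_family_add:
  assumes "open T" "smooth_family L T f" "smooth_family L T g"
  shows "smooth_family L T (\<lambda>t x. f t x + g t x)"
proof -
  obtain D where D: "D 0 0 = f"
    "\<And>i j. continuous_on (T \<times> UNIV) (\<lambda>(t, x). D i j t x)"
    "\<And>i j t x. t \<in> T \<Longrightarrow> ((\<lambda>s. D i j s x) has_vector_derivative D (Suc i) j t x) (at t)"
    "\<And>i j t x. t \<in> T \<Longrightarrow> (D i j t has_vector_derivative D i (Suc j) t x) (at x)"
    "\<And>t x. t \<in> T \<Longrightarrow> f t (x + L) = f t x"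
    using assms(2) by (rule smooth_familyE) (rule that)
  obtain E where E: "E 0 0 = g"
    "\<And>i j. continuous_on (T \<times> UNIV) (\<lambda>(t, x). E i j t x)"
    "\<And>i j t x. t \<in> T \<Longrightarrow> ((\<lambda>s. E i j s x) has_vector_derivative E (Suc i) j t x) (at t)"
    "\<And>i j t x. t \<in> T \<Longrightarrow> (E i j t has_vector_derivative E i (Suc j) t x) (at x)"
    "\<And>t x. t \<in> T \<Longrightarrow> g t (x + L) = g t x"
    using assms(3) by (rule smooth_familyE) (rule that)
  show ?thesis
  proof (rule smooth_familyI[OF assms(1), where D="\<lambda>i j t x. D i j t x + E i j t x"])
    show "continuous_on (T \<times> UNIV) (\<lambda>(t, x). D i j t x + E i j t x)" for i j
      using continuous_on_add[OF D(2) E(2)] by (simp add: case_prod_unfold)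
    show "((\<lambda>x. D i j t x + E i j t x) has_vector_derivative D i (Suc j) t x + E i (Suc j) t x) (at x)"
      if "t \<in> T" for i j t x
      by (rule has_vector_derivative_add[OF D(4)[OF that] E(4)[OF that]])
    show "((\<lambda>s. D i j s x + E i j s x) has_vector_derivative D (Suc i) j t x + E (Suc i) j t x) (at t)"
      if "t \<in> T" for i j t x
      by (rule has_vector_derivative_add[OF D(3)[OF that] E(3)[OF that]])
  qed (use D E in auto)
qed

lemma smooth_family_const: "open T \<Longrightarrow> smooth_family L T (\<lambda>t x. c)"
  by (rule smooth_familyI[where D="\<lambda>i j t x. if i = 0 \<and> j = 0 then c else 0"])
     (auto intro!: continuous_intros simp: case_prod_unfold)

lemma smooth_family_sum:
  "open T \<Longrightarrow> (\<And>i. i \<in> I \<Longrightarrow> smooth_family L T (f i)) \<Longrightarrow> smooth_family L T (\<lambda>t x. \<Sum>i\<in>I. f i t x)"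
  by (induction I rule: infinite_finite_induct) (auto intro: smooth_family_const smooth_family_add)

text \<open>Pascal's rule, arranged as the step from order i to order i + 1 in the Leibniz formula;
  \<open>smooth_family_mult\<close> applies it once in each variable.\<close>

lemma leibniz_sum:
  fixes P :: "nat \<Rightarrow> nat \<Rightarrow> 'c::real_vector"
  shows "(\<Sum>a\<le>Suc i. real (Suc i choose a) *\<^sub>R P a (Suc i - a)) =
    (\<Sum>a\<le>i. real (i choose a) *\<^sub>R (P (Suc a) (i - a) + P a (Suc (i - a))))"
proof -
  have "(\<Sum>a\<le>Suc i. real (Suc i choose a) *\<^sub>R P a (Suc i - a)) =
      P 0 (Suc i) + (\<Sum>a\<le>i. real (i choose Suc a) *\<^sub>R P (Suc a) (i - a)) + (\<Sum>a\<le>i. real (i choose a) *\<^sub>R P (Suc a) (i - a))"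
    by (subst sum.atMost_Suc_shift) (simp add: sum.distrib scaleR_left_distrib algebra_simps del: sum.atMost_Suc)
  also have "P 0 (Suc i) + (\<Sum>a\<le>i. real (i choose Suc a) *\<^sub>R P (Suc a) (i - a)) =
      (\<Sum>a\<le>Suc i. real (i choose a) *\<^sub>R P a (Suc i - a))"
    by (subst sum.atMost_Suc_shift) simp
  also have "\<dots> = (\<Sum>a\<le>i. real (i choose a) *\<^sub>R P a (Suc (i - a)))"
    by (auto simp: Suc_diff_le intro!: sum.cong)
  finally show ?thesis by (simp add: scaleR_right_distrib sum.distrib add.commute)
qed

lemma smooth_family_mult:
  fixes f g :: "real \<Rightarrow> real \<Rightarrow> real"
  assumes T: "open T" and "smooth_family L T f" "smooth_family L T g"
  shows "smooth_family L T (\<lambda>t x. f t x * g t x)"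
proof -
  obtain D where D: "D 0 0 = f"
    "\<And>i j. continuous_on (T \<times> UNIV) (\<lambda>(t, x). D i j t x)"
    "\<And>i j t x. t \<in> T \<Longrightarrow> ((\<lambda>s. D i j s x) has_vector_derivative D (Suc i) j t x) (at t)"
    "\<And>i j t x. t \<in> T \<Longrightarrow> (D i j t has_vector_derivative D i (Suc j) t x) (at x)"
    "\<And>t x. t \<in> T \<Longrightarrow> f t (x + L) = f t x"
    using assms(2) by (rule smooth_familyE) (rule that)
  obtain E where E: "E 0 0 = g"
    "\<And>i j. continuous_on (T \<times> UNIV) (\<lambda>(t, x). E i j t x)"
    "\<And>i j t x. t \<in> T \<Longrightarrow> ((\<lambda>s. E i j s x) has_vector_derivative E (Suc i) j t x) (at t)"
    "\<And>i j t x. t \<in> T \<Longrightarrow> (E i j t has_vector_derivative E i (Suc j) t x) (at x)"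
    "\<And>t x. t \<in> T \<Longrightarrow> g t (x + L) = g t x"
    using assms(3) by (rule smooth_familyE) (rule that)
  \<comment> \<open>The Leibniz formula for the derivative of order i in t and of order j in
    x.\<close>
  define G where "G = (\<lambda>i j t x. \<Sum>a\<le>i. real (i choose a) *\<^sub>R
      (\<Sum>b\<le>j. real (j choose b) *\<^sub>R (D a b t x * E (i - a) (j - b) t x)))"
  show ?thesis
  proof (rule smooth_familyI[OF T, where D=G])
    show "G 0 0 t x = f t x * g t x" for t x by (simp add: G_def D(1) E(1))
    show "continuous_on (T \<times> UNIV) (\<lambda>(t, x). G i j t x)" for i j
      using D(2) E(2) by (simp add: G_def case_prod_unfold continuous_on_sum continuous_on_scaleR continuous_on_mult)
    show "((\<lambda>s. G i j s x) has_vector_derivative G (Suc i) j t x) (at t)" if "t \<in> T" for i j t x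
    proof -
      have "((\<lambda>s. G i j s x) has_vector_derivative (\<Sum>a\<le>i. real (i choose a) *\<^sub>R
        (\<Sum>b\<le>j. real (j choose b) *\<^sub>R (D a b t x * E (Suc (i - a)) (j - b) t x + D (Suc a) b t x * E (i - a) (j - b) t x)))) (at t)"
        unfolding G_def
        by (intro has_vector_derivative_sum has_vector_derivative_mult D(3) E(3) that
            bounded_linear.has_vector_derivative[OF bounded_linear_scaleR_right])
      also have "(\<Sum>a\<le>i. real (i choose a) *\<^sub>R
        (\<Sum>b\<le>j. real (j choose b) *\<^sub>R (D a b t x * E (Suc (i - a)) (j - b) t x + D (Suc a) b t x * E (i - a) (j - b) t x)))
        = G (Suc i) j t x"
        unfolding G_def leibniz_sum[of i "\<lambda>a c. \<Sum>b\<le>j. real (j choose b) *\<^sub>R (D a b t x * E c (j - b) t x)"]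
        by (simp add: sum.distrib scaleR_right_distrib add.commute algebra_simps)
      finally show ?thesis .
    qed
    show "(G i j t has_vector_derivative G i (Suc j) t x) (at x)" if "t \<in> T" for i j t x
    proof -
      have "(G i j t has_vector_derivative (\<Sum>a\<le>i. real (i choose a) *\<^sub>R
        (\<Sum>b\<le>j. real (j choose b) *\<^sub>R (D a b t x * E (i - a) (Suc (j - b)) t x + D a (Suc b) t x * E (i - a) (j - b) t x)))) (at x)"
        unfolding G_def
        by (intro has_vector_derivative_sum has_vector_derivative_mult D(4) E(4) that
            bounded_linear.has_vector_derivative[OF bounded_linear_scaleR_right])
      also have "(\<Sum>a\<le>i. real (i choose a) *\<^sub>R
        (\<Sum>b\<le>j. real (j choose b) *\<^sub>R (D a b t x * E (i - a) (Suc (j - b)) t x + D a (Suc b) t x * E (i - a) (j - b) t x)))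
        = G i (Suc j) t x"
        unfolding G_def
        by (subst leibniz_sum[of j "\<lambda>b c. D a b t x * E (i - a) c t x" for a t x]) (simp add: add.commute)
      finally show ?thesis .
    qed
    show "f t (x + L) * g t (x + L) = f t x * g t x" if "t \<in> T" for t x
      using D(5) E(5) that by simp
  qed
qed

lemma smooth_family_cmult: "open T \<Longrightarrow> smooth_family L T f \<Longrightarrow> smooth_family L T (\<lambda>t x. c * f t x :: real)"
  by (rule smooth_family_bounded_linear[where h="\<lambda>y. c * y"]) (auto intro: bounded_linear_mult_right)

lemma smooth_family_uminus: "open T \<Longrightarrow> smooth_family L T f \<Longrightarrow> smooth_family L T (\<lambda>t x. - f t x)"
  by (rule smooth_family_bounded_linear[where h=uminus]) (auto intro: bounded_linear_minus bounded_linear_ident)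

lemma smooth_family_diff:
  "open T \<Longrightarrow> smooth_family L T f \<Longrightarrow> smooth_family L T g \<Longrightarrow> smooth_family L T (\<lambda>t x. f t x - g t x)"
  using smooth_family_add[of T L f "\<lambda>t x. - g t x"] by (simp add: smooth_family_uminus)

lemma bounded_linear_axis: "bounded_linear (axis i :: 'a::real_normed_vector \<Rightarrow> 'a ^ 'n)"
  by (rule bounded_linear_intro[where K=1])
     (auto simp: vec_eq_iff axis_def norm_axis_1 norm_vec_def L2_set_def if_distrib[of norm] if_distrib[of "\<lambda>x. x\<^sup>2"] cong: if_cong)

lemma vec_sum_axis: "(v :: 'a::real_normed_vector ^ 'n) = (\<Sum>i\<in>UNIV. axis i (v $ i))"
  by (simp add: vec_eq_iff axis_def if_distrib cong: if_cong)

lemma smooth_family_vec: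
  fixes f :: "real \<Rightarrow> real \<Rightarrow> 'a::real_normed_vector ^ 'n"
  assumes "open T"
  shows "smooth_family L T f \<longleftrightarrow> (\<forall>i. smooth_family L T (\<lambda>t x. f t x $ i))"
proof (intro iffI allI)
  show "smooth_family L T f \<Longrightarrow> smooth_family L T (\<lambda>t x. f t x $ i)" for i
    by (rule smooth_family_bounded_linear[where h="\<lambda>v. v $ i"]) (auto intro: assms bounded_linear_vec_nth)
  assume "\<forall>i. smooth_family L T (\<lambda>t x. f t x $ i)"
  then have "smooth_family L T (\<lambda>t x. \<Sum>i\<in>UNIV. axis i (f t x $ i))"
    by (intro smooth_family_sum smooth_family_bounded_linear[OF _ bounded_linear_axis] assms) auto
  then show "smooth_family L T f" by (simp flip: vec_sum_axis)
qed

lemma has_vector_derivative_vec: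
  fixes f :: "real \<Rightarrow> 'a::real_normed_vector ^ 'n"
  shows "(f has_vector_derivative d) F \<longleftrightarrow> (\<forall>i. ((\<lambda>x. f x $ i) has_vector_derivative d $ i) F)"
proof (intro iffI allI)
  show "(f has_vector_derivative d) F \<Longrightarrow> ((\<lambda>x. f x $ i) has_vector_derivative d $ i) F" for i
    by (rule bounded_linear.has_vector_derivative[OF bounded_linear_vec_nth])
  assume "\<forall>i. ((\<lambda>x. f x $ i) has_vector_derivative d $ i) F"
  then have "((\<lambda>x. \<Sum>i\<in>UNIV. axis i (f x $ i)) has_vector_derivative (\<Sum>i\<in>UNIV. axis i (d $ i))) F"
    by (intro has_vector_derivative_sum bounded_linear.has_vector_derivative[OF bounded_linear_axis]) auto
  then show "(f has_vector_derivative d) F" by (simp flip: vec_sum_axis)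
qed

lemma smooth_family_slice:
  fixes f :: "real \<Rightarrow> real \<Rightarrow> 'a::real_normed_vector"
  assumes "smooth_family L T f" and t: "t \<in> T"
  shows "smooth_loop L (f t)"
proof -
  obtain D where D: "D 0 0 = f"
    "\<And>i j. continuous_on (T \<times> UNIV) (\<lambda>(t, x). D i j t x)"
    "\<And>i j t x. t \<in> T \<Longrightarrow> ((\<lambda>s. D i j s x) has_vector_derivative D (Suc i) j t x) (at t)"
    "\<And>i j t x. t \<in> T \<Longrightarrow> (D i j t has_vector_derivative D i (Suc j) t x) (at x)"
    "\<And>t x. t \<in> T \<Longrightarrow> f t (x + L) = f t x"
    using assms(1) by (rule smooth_familyE) (rule that)
  show ?thesis
    unfolding smooth_loop_def smooth_def using D(1,4,5) t by (intro conjI exI[of _ "\<lambda>j. D 0 j t"]) auto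
qed

text \<open>Loops as families independent of t: the closure properties of loops are inherited from
  those of families through this equivalence.\<close>

lemma smooth_loop_iff_family: "smooth_loop L f \<longleftrightarrow> smooth_family L UNIV (\<lambda>t. f)"
proof
  assume "smooth_loop L f"
  then obtain D where D: "D 0 = f" "\<And>i x. (D i has_vector_derivative D (Suc i) x) (at x)"
    "\<And>x. f (x + L) = f x"
    by (auto simp: smooth_loop_def smooth_def)
  have "continuous_on UNIV (D i)" for i
    using D(2) by (intro continuous_at_imp_continuous_on ballI has_vector_derivative_continuous)
  then have c: "continuous_on UNIV (\<lambda>p::real \<times> real. D i (snd p))" for i
    by (rule continuous_on_compose2) (simp_all add: continuous_on_snd continuous_on_id)
  show "smooth_family L UNIV (\<lambda>t. f)"
  proof (rule smooth_familyI[where D="\<lambda>i j t x. if i = 0 then D j x else 0"])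
    show "continuous_on (UNIV \<times> UNIV) (\<lambda>(t::real, x). if i = 0 then D j x else 0)" for i j :: nat
      using c[of j] by (cases "i = 0") (simp_all add: case_prod_unfold)
    show "((\<lambda>s. if i = 0 then D j x else 0) has_vector_derivative (if Suc i = 0 then D j x else 0)) (at t)"
      for i j x t by simp
    show "((\<lambda>x. if i = 0 then D j x else 0) has_vector_derivative (if i = 0 then D (Suc j) x else 0)) (at x)"
      for i j :: nat and x using D(2) by simp
  qed (simp_all add: D)
next
  assume "smooth_family L UNIV (\<lambda>t. f)"
  then show "smooth_loop L f" by (rule smooth_family_slice) simp
qed

lemma smooth_family_subset:
  fixes f :: "real \<Rightarrow> real \<Rightarrow> 'a::real_normed_vector"
  assumes "open T" "T \<subseteq> S" "smooth_family L S f"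
  shows "smooth_family L T f"
proof -
  obtain D where D: "D 0 0 = f"
    "\<And>i j. continuous_on (S \<times> UNIV) (\<lambda>(t, x). D i j t x)"
    "\<And>i j t x. t \<in> S \<Longrightarrow> ((\<lambda>s. D i j s x) has_vector_derivative D (Suc i) j t x) (at t)"
    "\<And>i j t x. t \<in> S \<Longrightarrow> (D i j t has_vector_derivative D i (Suc j) t x) (at x)"
    "\<And>t x. t \<in> S \<Longrightarrow> f t (x + L) = f t x"
    using assms(3) by (rule smooth_familyE) (rule that)
  show ?thesis
  proof (rule smooth_familyI[OF assms(1), where D=D])
    show "continuous_on (T \<times> UNIV) (\<lambda>(t, x). D i j t x)" for i j
      using assms(2) by (intro continuous_on_subset[OF D(2)]) auto
  qed (use D assms(2) in \<open>simp_all add: subset_iff\<close>)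
qed

lemma smooth_family_time_const:
  "open T \<Longrightarrow> smooth_loop L f \<Longrightarrow> smooth_family L T (\<lambda>t. f)"
  unfolding smooth_loop_iff_family by (rule smooth_family_subset) auto

subsection \<open>Families of power series\<close>

text \<open>The formal variable is never evaluated, so differentiation in t or x acts on each
  coefficient separately and no topology on the series is involved.\<close>

definition has_fps_derivative :: "(real \<Rightarrow> real fps) \<Rightarrow> real fps \<Rightarrow> real \<Rightarrow> bool" where
  "has_fps_derivative f d y \<longleftrightarrow> (\<forall>n. ((\<lambda>x. fps_nth (f x) n) has_vector_derivative fps_nth d n) (at y))"

lemma has_fps_derivative_unique: "has_fps_derivative f d y \<Longrightarrow> has_fps_derivative f d' y \<Longrightarrow> d = d'"
  unfolding has_fps_derivative_def fps_eq_iff using vector_derivative_unique_at by blast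

lemma has_fps_derivative_const: "has_fps_derivative (\<lambda>x. c) 0 y"
  by (simp add: has_fps_derivative_def)

lemma has_fps_derivative_fps_const:
  "(f has_vector_derivative d) (at y) \<Longrightarrow> has_fps_derivative (\<lambda>x. fps_const (f x)) (fps_const d) y"
  by (simp add: has_fps_derivative_def)

lemma has_fps_derivative_add:
  "has_fps_derivative f d y \<Longrightarrow> has_fps_derivative g e y \<Longrightarrow> has_fps_derivative (\<lambda>x. f x + g x) (d + e) y"
  by (simp add: has_fps_derivative_def has_vector_derivative_add)

lemma has_fps_derivative_minus:
  "has_fps_derivative f d y \<Longrightarrow> has_fps_derivative (\<lambda>x. - f x) (- d) y"
  by (simp add: has_fps_derivative_def has_vector_derivative_minus)

lemma has_fps_derivative_diff:
  "has_fps_derivative f d y \<Longrightarrow> has_fps_derivative g e y \<Longrightarrow> has_fps_derivative (\<lambda>x. f x - g x) (d - e) y"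
  by (simp add: has_fps_derivative_def has_vector_derivative_diff)

lemma has_fps_derivative_sum:
  "(\<And>i. i \<in> I \<Longrightarrow> has_fps_derivative (f i) (d i) y) \<Longrightarrow> has_fps_derivative (\<lambda>x. \<Sum>i\<in>I. f i x) (\<Sum>i\<in>I. d i) y"
  by (simp add: has_fps_derivative_def fps_sum_nth has_vector_derivative_sum)

lemma has_fps_derivative_mult:
  assumes "has_fps_derivative f d y" "has_fps_derivative g e y"
  shows "has_fps_derivative (\<lambda>x. f x * g x) (d * g y + f y * e) y"
  unfolding has_fps_derivative_def
proof
  fix n
  have "((\<lambda>x. \<Sum>i=0..n. fps_nth (f x) i * fps_nth (g x) (n - i)) has_vector_derivative
      (\<Sum>i=0..n. fps_nth (f y) i * fps_nth e (n - i) + fps_nth d i * fps_nth (g y) (n - i))) (at y)"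
    using assms unfolding has_fps_derivative_def
    by (intro has_vector_derivative_sum has_vector_derivative_mult) auto
  then show "((\<lambda>x. fps_nth (f x * g x) n) has_vector_derivative fps_nth (d * g y + f y * e) n) (at y)"
    by (simp add: fps_mult_nth sum.distrib add.commute)
qed

lemma has_fps_derivative_fps_deriv:
  assumes "has_fps_derivative f d y"
  shows "has_fps_derivative (\<lambda>x. fps_deriv (f x)) (fps_deriv d) y"
proof -
  have "((\<lambda>x. real (Suc n) * fps_nth (f x) (Suc n)) has_vector_derivative real (Suc n) * fps_nth d (Suc n)) (at y)" for n
    using assms has_vector_derivative_mult_right unfolding has_fps_derivative_def by blast
  then show ?thesis by (simp add: has_fps_derivative_def)
qed

definition smooth_fps_family :: "real \<Rightarrow> real set \<Rightarrow> (real \<Rightarrow> real \<Rightarrow> real fps) \<Rightarrow> bool" where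
  "smooth_fps_family L T F \<longleftrightarrow> (\<forall>n. smooth_family L T (\<lambda>t x. fps_nth (F t x) n))"

definition fps_dx :: "(real \<Rightarrow> real \<Rightarrow> real fps) \<Rightarrow> real \<Rightarrow> real \<Rightarrow> real fps" where
  "fps_dx F t x = Abs_fps (\<lambda>n. dx (\<lambda>t x. fps_nth (F t x) n) t x)"

definition fps_dt :: "(real \<Rightarrow> real \<Rightarrow> real fps) \<Rightarrow> real \<Rightarrow> real \<Rightarrow> real fps" where
  "fps_dt F t x = Abs_fps (\<lambda>n. velocity (\<lambda>t x. fps_nth (F t x) n) t x)"

lemma has_fps_dx: "smooth_fps_family L T F \<Longrightarrow> t \<in> T \<Longrightarrow> has_fps_derivative (F t) (fps_dx F t x) x"
  unfolding smooth_fps_family_def has_fps_derivative_def fps_dx_def fps_nth_Abs_fps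
  using smooth_family_has_dx[where f="\<lambda>t x. fps_nth (F t x) n" for n] by blast

lemma has_fps_dt: "smooth_fps_family L T F \<Longrightarrow> t \<in> T \<Longrightarrow> has_fps_derivative (\<lambda>s. F s x) (fps_dt F t x) t"
  unfolding smooth_fps_family_def has_fps_derivative_def fps_dt_def fps_nth_Abs_fps
  using smooth_family_has_velocity[where f="\<lambda>t x. fps_nth (F t x) n" for n] by blast

lemma fps_dx_eqI: "has_fps_derivative (F t) d x \<Longrightarrow> fps_dx F t x = d"
  by (simp add: fps_eq_iff has_fps_derivative_def fps_dx_def dx_def vector_derivative_at)

context
  fixes L :: real and T :: "real set"
  assumes T: "open T"
begin

lemma smooth_fps_const: "smooth_fps_family L T (\<lambda>t x. c)"
  by (simp add: smooth_fps_family_def smooth_family_const T)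

lemma smooth_fps_fps_const: "smooth_family L T f \<Longrightarrow> smooth_fps_family L T (\<lambda>t x. fps_const (f t x))"
  unfolding smooth_fps_family_def
proof
  fix n assume "smooth_family L T f"
  then show "smooth_family L T (\<lambda>t x. fps_nth (fps_const (f t x)) n)"
    by (cases "n = 0") (simp_all add: smooth_family_const T)
qed

lemma smooth_fps_add:
  "smooth_fps_family L T F \<Longrightarrow> smooth_fps_family L T G \<Longrightarrow> smooth_fps_family L T (\<lambda>t x. F t x + G t x)"
  by (simp add: smooth_fps_family_def smooth_family_add T)

lemma smooth_fps_minus: "smooth_fps_family L T F \<Longrightarrow> smooth_fps_family L T (\<lambda>t x. - F t x)"
  by (simp add: smooth_fps_family_def smooth_family_uminus T)

lemma smooth_fps_diff:
  "smooth_fps_family L T F \<Longrightarrow> smooth_fps_family L T G \<Longrightarrow> smooth_fps_family L T (\<lambda>t x. F t x - G t x)"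
  by (simp add: smooth_fps_family_def smooth_family_diff T)

lemma smooth_fps_sum:
  "(\<And>i. i \<in> I \<Longrightarrow> smooth_fps_family L T (F i)) \<Longrightarrow> smooth_fps_family L T (\<lambda>t x. \<Sum>i\<in>I. F i t x)"
  by (simp add: smooth_fps_family_def fps_sum_nth smooth_family_sum T)

lemma smooth_fps_mult:
  "smooth_fps_family L T F \<Longrightarrow> smooth_fps_family L T G \<Longrightarrow> smooth_fps_family L T (\<lambda>t x. F t x * G t x)"
  by (simp add: smooth_fps_family_def fps_mult_nth smooth_family_sum smooth_family_mult T)

lemma smooth_fps_power: "smooth_fps_family L T F \<Longrightarrow> smooth_fps_family L T (\<lambda>t x. F t x ^ n)"
  by (induction n) (simp_all add: smooth_fps_const smooth_fps_mult)

lemma smooth_fps_compose: "smooth_fps_family L T F \<Longrightarrow> smooth_fps_family L T (\<lambda>t x. a oo F t x)"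
  using smooth_fps_power[of F]
  by (simp add: smooth_fps_family_def fps_compose_nth smooth_family_sum smooth_family_cmult T)

lemma smooth_fps_fps_deriv: "smooth_fps_family L T F \<Longrightarrow> smooth_fps_family L T (\<lambda>t x. fps_deriv (F t x))"
  unfolding smooth_fps_family_def fps_deriv_nth by (intro allI smooth_family_cmult T) auto

lemma smooth_fps_dx: "smooth_fps_family L T F \<Longrightarrow> smooth_fps_family L T (fps_dx F)"
  unfolding smooth_fps_family_def fps_dx_def fps_nth_Abs_fps using smooth_family_dx[OF T] by blast

lemma smooth_fps_dt: "smooth_fps_family L T F \<Longrightarrow> smooth_fps_family L T (fps_dt F)"
  unfolding smooth_fps_family_def fps_dt_def fps_nth_Abs_fps using smooth_family_velocity[OF T] by blast

lemma fps_dt_dx: "smooth_fps_family L T F \<Longrightarrow> t \<in> T \<Longrightarrow> fps_dt (fps_dx F) t x = fps_dx (fps_dt F) t x"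
  unfolding smooth_fps_family_def fps_dx_def fps_dt_def fps_nth_Abs_fps fps_eq_iff
  using velocity_dx[OF T] by blast

end

lemmas smooth_fps_intros = smooth_fps_const smooth_fps_add smooth_fps_minus smooth_fps_diff
  smooth_fps_sum smooth_fps_mult smooth_fps_fps_deriv smooth_fps_dx smooth_fps_dt

unbundle no fps_syntax

subsection \<open>The Riccati system\<close>

text \<open>
  From here on \<open>fps_X\<close> is \<open>\<lambda>\<^sup>-\<^sup>1\<close>. The system \<open>\<lambda>\<zeta> = k + h\<^sub>x + (k\<cdot>h) h\<close>, \<open>\<lambda>h = - \<zeta>\<^sub>x - (k\<cdot>\<zeta>) h\<close> follows from
  \<open>Y\<^sub>x = k\<cdot>H\<close>, \<open>H\<^sub>x = \<lambda>Z - Y k\<close>, \<open>Z\<^sub>x = Y (\<zeta> h\<^sup>t - h \<zeta>\<^sup>t) k - \<lambda>H\<close> with \<open>h = H/Y\<close>, \<open>\<zeta> = Z/Y\<close>.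
\<close>

definition curv :: "(real \<Rightarrow> real \<Rightarrow> real ^ 'm) \<Rightarrow> 'm \<Rightarrow> real \<Rightarrow> real \<Rightarrow> real fps" where
  "curv \<kappa> i t x = fps_const (\<kappa> t x $ i)"

definition dotf :: "('m \<Rightarrow> real \<Rightarrow> real \<Rightarrow> real fps) \<Rightarrow> ('m \<Rightarrow> real \<Rightarrow> real \<Rightarrow> real fps) \<Rightarrow> real \<Rightarrow> real \<Rightarrow> real fps" where
  "dotf f g t x = (\<Sum>i\<in>UNIV. f i t x * g i t x)"

definition step_h where
  "step_h \<kappa> h z i t x = - (fps_X * (fps_dx (z i) t x + h i t x * dotf (curv \<kappa>) z t x))"

definition step_z where
  "step_z \<kappa> h i t x = fps_X * (curv \<kappa> i t x + fps_dx (h i) t x + h i t x * dotf (curv \<kappa>) h t x)"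

primrec riccati_iter ::
  "(real \<Rightarrow> real \<Rightarrow> real ^ 'm) \<Rightarrow> nat \<Rightarrow> ('m \<Rightarrow> real \<Rightarrow> real \<Rightarrow> real fps) \<times> ('m \<Rightarrow> real \<Rightarrow> real \<Rightarrow> real fps)" where
  "riccati_iter \<kappa> 0 = (\<lambda>i t x. 0, \<lambda>i t x. 0)"
| "riccati_iter \<kappa> (Suc N) = (step_h \<kappa> (fst (riccati_iter \<kappa> N)) (snd (riccati_iter \<kappa> N)), step_z \<kappa> (fst (riccati_iter \<kappa> N)))"

text \<open>The \<epsilon>-adic limit of the iterates, read off along the diagonal: from the n-th
  iterate on, the coefficients up to index n no longer change
  (\<open>riccati_iter_stable\<close>).\<close>

definition h_ser :: "(real \<Rightarrow> real \<Rightarrow> real ^ 'm) \<Rightarrow> 'm \<Rightarrow> real \<Rightarrow> real \<Rightarrow> real fps" where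
  "h_ser \<kappa> i t x = Abs_fps (\<lambda>n. fps_nth (fst (riccati_iter \<kappa> n) i t x) n)"

definition z_ser :: "(real \<Rightarrow> real \<Rightarrow> real ^ 'm) \<Rightarrow> 'm \<Rightarrow> real \<Rightarrow> real \<Rightarrow> real fps" where
  "z_ser \<kappa> i t x = Abs_fps (\<lambda>n. fps_nth (snd (riccati_iter \<kappa> n) i t x) n)"

text \<open>Agreement is demanded at every t and x because only then does it pass to
  x-derivatives.\<close>

definition agree :: "nat \<Rightarrow> (real \<Rightarrow> real \<Rightarrow> real fps) \<Rightarrow> (real \<Rightarrow> real \<Rightarrow> real fps) \<Rightarrow> bool" where
  "agree n F G \<longleftrightarrow> (\<forall>m\<le>n. \<forall>t x. fps_nth (F t x) m = fps_nth (G t x) m)"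

lemma agree_refl: "agree n F F" by (simp add: agree_def)

lemma agree_add: "agree n F F' \<Longrightarrow> agree n G G' \<Longrightarrow> agree n (\<lambda>t x. F t x + G t x) (\<lambda>t x. F' t x + G' t x)"
  by (simp add: agree_def)

lemma agree_minus: "agree n F F' \<Longrightarrow> agree n (\<lambda>t x. - F t x) (\<lambda>t x. - F' t x)"
  by (simp add: agree_def)

lemma agree_mult: "agree n F F' \<Longrightarrow> agree n G G' \<Longrightarrow> agree n (\<lambda>t x. F t x * G t x) (\<lambda>t x. F' t x * G' t x)"
  by (auto simp: agree_def fps_mult_nth intro!: sum.cong)

lemma agree_dotf: "(\<And>i. agree n (f i) (f' i)) \<Longrightarrow> (\<And>i. agree n (g i) (g' i)) \<Longrightarrow> agree n (dotf f g) (dotf f' g')"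
  by (auto simp: agree_def dotf_def fps_sum_nth fps_mult_nth intro!: sum.cong)

lemma agree_fps_dx: "agree n F F' \<Longrightarrow> agree n (fps_dx F) (fps_dx F')"
  by (simp add: agree_def fps_dx_def)

lemma agree_X: "agree n F F' \<Longrightarrow> agree (Suc n) (\<lambda>t x. fps_X * F t x) (\<lambda>t x. fps_X * F' t x)"
  by (auto simp: agree_def)

text \<open>The contraction property: both right-hand sides carry an overall factor \<epsilon>, so
  each step gains one order of agreement.\<close>

lemma agree_step:
  assumes "\<And>i. agree n (h i) (h' i)" "\<And>i. agree n (z i) (z' i)"
  shows "agree (Suc n) (step_h \<kappa> h z i) (step_h \<kappa> h' z' i)" "agree (Suc n) (step_z \<kappa> h i) (step_z \<kappa> h' i)"
  unfolding step_h_def[abs_def] step_z_def[abs_def]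
  by (intro agree_minus agree_X agree_add agree_mult agree_fps_dx agree_dotf assms agree_refl)+

lemma riccati_iter_Suc:
  "agree n (fst (riccati_iter \<kappa> n) i) (fst (riccati_iter \<kappa> (Suc n)) i) \<and>
   agree n (snd (riccati_iter \<kappa> n) i) (snd (riccati_iter \<kappa> (Suc n)) i)"
proof (induction n arbitrary: i)
  case 0
  show ?case by (simp add: agree_def step_h_def step_z_def)
next
  case (Suc n)
  let ?a = "riccati_iter \<kappa> n" and ?b = "riccati_iter \<kappa> (Suc n)"
  have "agree (Suc n) (step_h \<kappa> (fst ?a) (snd ?a) i) (step_h \<kappa> (fst ?b) (snd ?b) i)"
    "agree (Suc n) (step_z \<kappa> (fst ?a) i) (step_z \<kappa> (fst ?b) i)"
    using Suc by (blast intro: agree_step)+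
  then show ?case by simp
qed

lemma riccati_iter_stable:
  assumes "m \<le> n"
  shows "fps_nth (fst (riccati_iter \<kappa> n) i t x) m = fps_nth (h_ser \<kappa> i t x) m"
    "fps_nth (snd (riccati_iter \<kappa> n) i t x) m = fps_nth (z_ser \<kappa> i t x) m"
  using assms
proof (induction rule: dec_induct)
  case base
  show "fps_nth (fst (riccati_iter \<kappa> m) i t x) m = fps_nth (h_ser \<kappa> i t x) m"
    "fps_nth (snd (riccati_iter \<kappa> m) i t x) m = fps_nth (z_ser \<kappa> i t x) m"
    by (simp_all add: h_ser_def z_ser_def)
next
  case (step n)
  then show "fps_nth (fst (riccati_iter \<kappa> (Suc n)) i t x) m = fps_nth (h_ser \<kappa> i t x) m"
    "fps_nth (snd (riccati_iter \<kappa> (Suc n)) i t x) m = fps_nth (z_ser \<kappa> i t x) m"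
    using riccati_iter_Suc[of n \<kappa> i] unfolding agree_def by auto
qed

lemma h_ser_agree: "agree n (h_ser \<kappa> i) (fst (riccati_iter \<kappa> n) i)"
  and z_ser_agree: "agree n (z_ser \<kappa> i) (snd (riccati_iter \<kappa> n) i)"
  by (simp_all add: agree_def riccati_iter_stable)

text \<open>The limit agrees with iterate m up to order m, hence after one step with iterate m + 1
  up to order m + 1; there the coefficient of that iterate is the coefficient of the limit by
  definition.\<close>

lemma riccati:
  "h_ser \<kappa> i t x = step_h \<kappa> (h_ser \<kappa>) (z_ser \<kappa>) i t x"
  "z_ser \<kappa> i t x = step_z \<kappa> (h_ser \<kappa>) i t x"
proof -
  have "fps_nth (h_ser \<kappa> i t x) n = fps_nth (step_h \<kappa> (h_ser \<kappa>) (z_ser \<kappa>) i t x) n \<and>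
    fps_nth (z_ser \<kappa> i t x) n = fps_nth (step_z \<kappa> (h_ser \<kappa>) i t x) n" for n
  proof (cases n)
    case 0
    then show ?thesis by (simp add: h_ser_def z_ser_def step_h_def step_z_def)
  next
    case (Suc m)
    then show ?thesis
      using agree_step[of m "h_ser \<kappa>" "fst (riccati_iter \<kappa> m)" "z_ser \<kappa>" "snd (riccati_iter \<kappa> m)" \<kappa> i,
          OF h_ser_agree z_ser_agree]
      by (simp add: agree_def h_ser_def[of \<kappa> i t x] z_ser_def[of \<kappa> i t x])
  qed
  then show "h_ser \<kappa> i t x = step_h \<kappa> (h_ser \<kappa>) (z_ser \<kappa>) i t x"
    "z_ser \<kappa> i t x = step_z \<kappa> (h_ser \<kappa>) i t x"
    by (simp_all add: fps_eq_iff)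
qed

text \<open>\<open>True\<close> stands for series in even powers, \<open>False\<close> for odd ones,
  so the parity of a product is \<open>b = c\<close>. This grading is the source of the alternation
  between \<open>odd_block\<close> and \<open>even_block\<close> in Q.\<close>

definition parity :: "bool \<Rightarrow> (real \<Rightarrow> real \<Rightarrow> real fps) \<Rightarrow> bool" where
  "parity b F \<longleftrightarrow> (\<forall>t x n. even n \<noteq> b \<longrightarrow> fps_nth (F t x) n = 0)"

lemma parity_const: "parity True (\<lambda>t x. fps_const (f t x))"
  by (auto simp: parity_def)

lemma parity_add: "parity b F \<Longrightarrow> parity b G \<Longrightarrow> parity b (\<lambda>t x. F t x + G t x)"
  by (simp add: parity_def)

lemma parity_minus: "parity b F \<Longrightarrow> parity b (\<lambda>t x. - F t x)"
  by (simp add: parity_def)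

lemma parity_diff: "parity b F \<Longrightarrow> parity b G \<Longrightarrow> parity b (\<lambda>t x. F t x - G t x)"
  by (simp add: parity_def)

lemma parity_sum: "(\<And>i. i \<in> I \<Longrightarrow> parity b (F i)) \<Longrightarrow> parity b (\<lambda>t x. \<Sum>i\<in>I. F i t x)"
  by (simp add: parity_def fps_sum_nth)

lemma parity_mult:
  assumes "parity b F" "parity c G"
  shows "parity (b = c) (\<lambda>t x. F t x * G t x)"
  unfolding parity_def
proof (intro allI impI)
  fix t x and n :: nat assume n: "even n \<noteq> (b = c)"
  have "fps_nth (F t x) i * fps_nth (G t x) (n - i) = 0" if "i \<le> n" for i
  proof (cases "even i = b")
    case True
    then have "even (n - i) \<noteq> c" using n that by auto
    then show ?thesis using assms by (simp add: parity_def)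
  next
    case False
    then show ?thesis using assms by (simp add: parity_def)
  qed
  then show "fps_nth (F t x * G t x) n = 0" unfolding fps_mult_nth by (intro sum.neutral) auto
qed

lemma parity_power: "parity True F \<Longrightarrow> parity True (\<lambda>t x. F t x ^ n)"
proof (induction n)
  case 0
  show ?case using parity_const[of "\<lambda>t x. 1"] by simp
next
  case (Suc n)
  then show ?case using parity_mult[of True F True "\<lambda>t x. F t x ^ n"] by simp
qed

lemma parity_compose: "parity True F \<Longrightarrow> parity True (\<lambda>t x. a oo F t x)"
  using parity_power[of F] by (simp add: parity_def fps_compose_nth)

lemma parity_fps_dx: "parity b F \<Longrightarrow> parity b (fps_dx F)"
  by (auto simp: parity_def fps_dx_def dx_def)

lemma parity_X: "parity (\<not> b) F \<Longrightarrow> parity b (\<lambda>t x. fps_X * F t x)"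
  by (auto simp: parity_def)

lemma parity_dotf: "(\<And>i. parity b (f i)) \<Longrightarrow> (\<And>i. parity c (g i)) \<Longrightarrow> parity (b = c) (dotf f g)"
  unfolding dotf_def[abs_def] by (intro parity_sum parity_mult)

lemma parity_riccati_iter:
  "parity True (fst (riccati_iter \<kappa> N) i) \<and> parity False (snd (riccati_iter \<kappa> N) i)"
proof (induction N arbitrary: i)
  case 0
  show ?case by (simp add: parity_def)
next
  case (Suc N)
  let ?h = "fst (riccati_iter \<kappa> N)" and ?z = "snd (riccati_iter \<kappa> N)"
  have k: "parity True (curv \<kappa> i)" for i unfolding curv_def[abs_def] by (rule parity_const)
  have h: "parity True (?h i)" and z: "parity False (?z i)" for i using Suc by auto
  have kz: "parity False (dotf (curv \<kappa>) ?z)" and kh: "parity True (dotf (curv \<kappa>) ?h)"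
    using parity_dotf[OF k z] parity_dotf[OF k h] by simp_all
  have "parity False (\<lambda>t x. ?h i t x * dotf (curv \<kappa>) ?z t x)" "parity True (\<lambda>t x. ?h i t x * dotf (curv \<kappa>) ?h t x)"
    using parity_mult[OF h kz] parity_mult[OF h kh] by simp_all
  then have "parity True (step_h \<kappa> ?h ?z i)" "parity False (step_z \<kappa> ?h i)"
    unfolding step_h_def[abs_def] step_z_def[abs_def]
    by (intro parity_minus parity_X parity_add parity_fps_dx; simp add: h z k)+
  then show ?case by simp
qed

lemma parity_h_ser: "parity True (h_ser \<kappa> i)" and parity_z_ser: "parity False (z_ser \<kappa> i)"
  using parity_riccati_iter[of \<kappa> _ i] by (simp_all add: parity_def h_ser_def z_ser_def)

text \<open>Determined by the normalization \<open>tr (R\<^sup>2) = -2\<close>.\<close>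

definition Y_ser :: "(real \<Rightarrow> real \<Rightarrow> real ^ 'm) \<Rightarrow> real \<Rightarrow> real \<Rightarrow> real fps" where
  "Y_ser \<kappa> t x = fps_binomial (-1/2) oo
     ((1 + dotf (h_ser \<kappa>) (h_ser \<kappa>) t x) * (1 + dotf (z_ser \<kappa>) (z_ser \<kappa>) t x) -
      dotf (h_ser \<kappa>) (z_ser \<kappa>) t x * dotf (h_ser \<kappa>) (z_ser \<kappa>) t x - 1)"

lemma h_ser_nth_0 [simp]: "fps_nth (h_ser \<kappa> i t x) 0 = 0" and z_ser_nth_0 [simp]: "fps_nth (z_ser \<kappa> i t x) 0 = 0"
  by (simp_all add: h_ser_def z_ser_def)

text \<open>The bracket N is the Gram determinant of the two vectors that span the image of R, and Y
  is N to the power -1/2. The binomial series may be composed with N - 1 because h and \<zeta> have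
  no constant term.\<close>

lemma Y_ser_square:
  "Y_ser \<kappa> t x * Y_ser \<kappa> t x * ((1 + dotf (h_ser \<kappa>) (h_ser \<kappa>) t x) * (1 + dotf (z_ser \<kappa>) (z_ser \<kappa>) t x) -
      dotf (h_ser \<kappa>) (z_ser \<kappa>) t x * dotf (h_ser \<kappa>) (z_ser \<kappa>) t x) = 1" (is "_ * ?N = 1")
proof -
  have c: "fps_nth (?N - 1) 0 = 0" by (simp add: dotf_def fps_sum_nth fps_mult_nth)
  have "Y_ser \<kappa> t x * Y_ser \<kappa> t x * ((1 + fps_X) oo (?N - 1)) =
      (fps_binomial (-1/2) * fps_binomial (-1/2) * (1 + fps_X)) oo (?N - 1)"
    unfolding Y_ser_def by (simp only: fps_compose_mult_distrib[OF c])
  also have "fps_binomial (-1/2) * fps_binomial (-1/2) * (1 + fps_X) = (1 :: real fps)"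
    by (simp flip: fps_binomial_add_mult fps_binomial_1)
  also have "(1 + fps_X) oo (?N - 1) = ?N"
    by (simp add: fps_compose_add_distrib fps_X_fps_compose_startby0[OF c])
  finally show ?thesis by simp
qed

lemma Y_ser_nth_0: "fps_nth (Y_ser \<kappa> t x) 0 = 1"
  by (simp add: Y_ser_def)

lemma parity_Y_ser: "parity True (Y_ser \<kappa>)"
proof -
  have "parity True (dotf (h_ser \<kappa>) (h_ser \<kappa>))" "parity True (dotf (z_ser \<kappa>) (z_ser \<kappa>))"
    "parity False (dotf (h_ser \<kappa>) (z_ser \<kappa>))"
    using parity_dotf[OF parity_h_ser parity_h_ser] parity_dotf[OF parity_z_ser parity_z_ser]
      parity_dotf[OF parity_h_ser parity_z_ser] by simp_all
  moreover have "parity True (\<lambda>t x. 1)" using parity_const[of "\<lambda>t x. 1"] by simp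
  ultimately show ?thesis
    unfolding Y_ser_def[abs_def]
    using parity_mult[of True "\<lambda>t x. 1 + dotf (h_ser \<kappa>) (h_ser \<kappa>) t x" True "\<lambda>t x. 1 + dotf (z_ser \<kappa>) (z_ser \<kappa>) t x"]
      parity_mult[of False "dotf (h_ser \<kappa>) (z_ser \<kappa>)" False "dotf (h_ser \<kappa>) (z_ser \<kappa>)"]
    by (intro parity_compose parity_diff) (simp_all add: parity_add)
qed

section \<open>Dot products and x-derivatives under a constant orthogonal matrix\<close>

lemma rotated_dot:
  fixes M :: "real ^ 'm ^ 'm" and a b :: "'m \<Rightarrow> real fps"
  assumes "transpose M ** M = mat 1"
  shows "(\<Sum>i\<in>UNIV. (\<Sum>l\<in>UNIV. fps_const (M $ i $ l) * a l) * (\<Sum>p\<in>UNIV. fps_const (M $ i $ p) * b p)) =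
    (\<Sum>l\<in>UNIV. a l * b l)"
proof -
  have M: "(\<Sum>i\<in>UNIV. fps_const (M $ i $ l) * fps_const (M $ i $ p)) = (if l = p then 1 else 0)" for l p
  proof -
    have "(\<Sum>i\<in>UNIV. M $ i $ l * M $ i $ p) = (mat 1 :: real ^ 'm ^ 'm) $ l $ p"
      unfolding assms[symmetric] by (simp add: matrix_matrix_mult_def transpose_def)
    then have "fps_const (\<Sum>i\<in>UNIV. M $ i $ l * M $ i $ p) = (if l = p then 1 else 0)"
      by (simp add: mat_def)
    moreover have "(\<Sum>i\<in>UNIV. fps_const (M $ i $ l) * fps_const (M $ i $ p)) = fps_const (\<Sum>i\<in>UNIV. M $ i $ l * M $ i $ p)"
      by (auto simp: fps_eq_iff fps_sum_nth)
    ultimately show ?thesis by simp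
  qed
  have "(\<Sum>i\<in>UNIV. (\<Sum>l\<in>UNIV. fps_const (M $ i $ l) * a l) * (\<Sum>p\<in>UNIV. fps_const (M $ i $ p) * b p)) =
     (\<Sum>i\<in>UNIV. \<Sum>l\<in>UNIV. \<Sum>p\<in>UNIV. (a l * b p) * (fps_const (M $ i $ l) * fps_const (M $ i $ p)))"
    unfolding sum_product by (intro sum.cong refl) (rule mult.assoc[symmetric, THEN trans], simp only: ac_simps)
  also have "\<dots> = (\<Sum>l\<in>UNIV. \<Sum>p\<in>UNIV. \<Sum>i\<in>UNIV. (a l * b p) * (fps_const (M $ i $ l) * fps_const (M $ i $ p)))"
    by (subst sum.swap) (intro sum.cong refl sum.swap)
  also have "\<dots> = (\<Sum>l\<in>UNIV. \<Sum>p\<in>UNIV. (a l * b p) * (if l = p then 1 else 0))"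
    unfolding M[symmetric] sum_distrib_left ..
  also have "\<dots> = (\<Sum>l\<in>UNIV. a l * b l)"
    by (simp add: if_distrib cong: if_cong)
  finally show ?thesis .
qed

lemma dotf_rotated:
  fixes M :: "real ^ 'm ^ 'm"
  assumes "transpose M ** M = mat 1"
    and "\<And>i. f' i t x = (\<Sum>l\<in>UNIV. fps_const (M $ i $ l) * f l t x)"
    and "\<And>i. g' i t x = (\<Sum>l\<in>UNIV. fps_const (M $ i $ l) * g l t x)"
  shows "dotf f' g' t x = dotf f g t x"
  unfolding dotf_def assms(2,3) by (rule rotated_dot[OF assms(1)])

lemma fps_dx_rotated:
  assumes "\<And>x. f' t x = (\<Sum>l\<in>UNIV. fps_const (c l) * f l t x)"
    and "\<And>l. smooth_fps_family L T (f l)" "t \<in> T"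
  shows "fps_dx f' t x = (\<Sum>l\<in>UNIV. fps_const (c l) * fps_dx (f l) t x)"
proof (rule fps_dx_eqI)
  have "has_fps_derivative (\<lambda>x. \<Sum>l\<in>UNIV. fps_const (c l) * f l t x)
      (\<Sum>l\<in>UNIV. 0 * f l t x + fps_const (c l) * fps_dx (f l) t x) x"
    by (intro has_fps_derivative_sum has_fps_derivative_mult has_fps_derivative_const has_fps_dx[OF assms(2,3)])
  moreover have "f' t = (\<lambda>x. \<Sum>l\<in>UNIV. fps_const (c l) * f l t x)" using assms(1) by auto
  ultimately show "has_fps_derivative (f' t) (\<Sum>l\<in>UNIV. fps_const (c l) * fps_dx (f l) t x) x" by simp
qed

locale curvature_family =
  fixes L :: real and T :: "real set" and \<kappa> :: "real \<Rightarrow> real \<Rightarrow> real ^ 'm"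
  assumes T: "open T" and \<kappa>: "smooth_family L T \<kappa>"
begin

lemma smooth_curv: "smooth_fps_family L T (curv \<kappa> i)"
  unfolding curv_def[abs_def] using \<kappa> by (intro smooth_fps_fps_const T) (simp add: smooth_family_vec[OF T])

lemma smooth_dotf:
  "(\<And>i. smooth_fps_family L T (f i)) \<Longrightarrow> (\<And>i. smooth_fps_family L T (g i)) \<Longrightarrow> smooth_fps_family L T (dotf f g)"
  unfolding dotf_def[abs_def] by (intro smooth_fps_sum smooth_fps_mult T)

lemma smooth_riccati_iter:
  "smooth_fps_family L T (fst (riccati_iter \<kappa> N) i) \<and> smooth_fps_family L T (snd (riccati_iter \<kappa> N) i)"
proof (induction N arbitrary: i)
  case 0
  show ?case by (simp add: smooth_fps_const T)
next
  case (Suc N)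
  then show ?case
    by (simp add: step_h_def[abs_def] step_z_def[abs_def] smooth_fps_intros T smooth_dotf smooth_curv)
qed

lemma smooth_h_ser: "smooth_fps_family L T (h_ser \<kappa> i)" and smooth_z_ser: "smooth_fps_family L T (z_ser \<kappa> i)"
  using smooth_riccati_iter[of _ i] by (simp_all add: smooth_fps_family_def h_ser_def z_ser_def)

lemma smooth_Y_ser: "smooth_fps_family L T (Y_ser \<kappa>)"
  unfolding Y_ser_def[abs_def]
  by (intro smooth_fps_compose smooth_fps_diff smooth_fps_mult smooth_fps_add smooth_fps_const smooth_dotf
      smooth_h_ser smooth_z_ser T)

context
  fixes t x :: real
  assumes t: "t \<in> T"
begin

lemma X_dx_h: "fps_X * fps_dx (h_ser \<kappa> i) t x =
    z_ser \<kappa> i t x - fps_X * curv \<kappa> i t x - fps_X * h_ser \<kappa> i t x * dotf (curv \<kappa>) (h_ser \<kappa>) t x"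
  using riccati(2)[of \<kappa> i t x] unfolding step_z_def by algebra

lemma X_dx_z: "fps_X * fps_dx (z_ser \<kappa> i) t x =
    - h_ser \<kappa> i t x - fps_X * h_ser \<kappa> i t x * dotf (curv \<kappa>) (z_ser \<kappa>) t x"
  using riccati(1)[of \<kappa> i t x] unfolding step_h_def by algebra

lemma dx_dotf:
  assumes "\<And>i. smooth_fps_family L T (f i)" "\<And>i. smooth_fps_family L T (g i)"
  shows "fps_dx (dotf f g) t x = dotf (\<lambda>i. fps_dx (f i)) g t x + dotf f (\<lambda>i. fps_dx (g i)) t x"
  by (rule fps_dx_eqI)
    (auto simp: dotf_def[abs_def] sum.distrib[symmetric] intro!: has_fps_derivative_sum has_fps_derivative_mult has_fps_dx assms t)

text \<open>The Riccati system gives N_x = -2 (k.h) N for the Gram determinant N, and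
  differentiating Y^2 N = 1 yields the claim. The derivatives of h and \<zeta> are known only after
  multiplication by \<epsilon>, which is cancelled at the end because power series form an integral
  domain.\<close>

lemma dx_Y: "fps_dx (Y_ser \<kappa>) t x = Y_ser \<kappa> t x * dotf (curv \<kappa>) (h_ser \<kappa>) t x"
proof -
  define h where "h = (\<lambda>i. h_ser \<kappa> i t x)"
  define z where "z = (\<lambda>i. z_ser \<kappa> i t x)"
  define k where "k = (\<lambda>i. curv \<kappa> i t x)"
  define hh where "hh = dotf (h_ser \<kappa>) (h_ser \<kappa>) t x"
  define zz where "zz = dotf (z_ser \<kappa>) (z_ser \<kappa>) t x"
  define hz where "hz = dotf (h_ser \<kappa>) (z_ser \<kappa>) t x"
  define kh where "kh = dotf (curv \<kappa>) (h_ser \<kappa>) t x"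
  define kz where "kz = dotf (curv \<kappa>) (z_ser \<kappa>) t x"
  note dots = hh_def zz_def hz_def kh_def kz_def
  define N where "N = (\<lambda>t x. (1 + dotf (h_ser \<kappa>) (h_ser \<kappa>) t x) * (1 + dotf (z_ser \<kappa>) (z_ser \<kappa>) t x) -
      dotf (h_ser \<kappa>) (z_ser \<kappa>) t x * dotf (h_ser \<kappa>) (z_ser \<kappa>) t x)"
  have comp: "hh = (\<Sum>i\<in>UNIV. h i * h i)" "zz = (\<Sum>i\<in>UNIV. z i * z i)" "hz = (\<Sum>i\<in>UNIV. h i * z i)"
    "kh = (\<Sum>i\<in>UNIV. k i * h i)" "kz = (\<Sum>i\<in>UNIV. k i * z i)"
    by (simp_all add: dots dotf_def h_def z_def k_def)
  let ?h' = "\<lambda>i. fps_dx (h_ser \<kappa> i)" and ?z' = "\<lambda>i. fps_dx (z_ser \<kappa> i)"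
  have "fps_X * dotf ?h' (h_ser \<kappa>) t x = (\<Sum>i\<in>UNIV. (fps_X * ?h' i t x) * h i)"
    by (simp add: dotf_def sum_distrib_left mult.assoc h_def)
  also have "\<dots> = (\<Sum>i\<in>UNIV. h i * z i) - fps_X * (\<Sum>i\<in>UNIV. k i * h i) - fps_X * kh * (\<Sum>i\<in>UNIV. h i * h i)"
    unfolding X_dx_h by (simp add: sum_distrib_left sum_subtractf sum.distrib algebra_simps h_def z_def k_def kh_def)
  finally have h1: "fps_X * dotf ?h' (h_ser \<kappa>) t x = hz - fps_X * kh - fps_X * kh * hh" by (simp add: comp)
  have "fps_X * dotf ?h' (z_ser \<kappa>) t x = (\<Sum>i\<in>UNIV. (fps_X * ?h' i t x) * z i)"
    by (simp add: dotf_def sum_distrib_left mult.assoc z_def)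
  also have "\<dots> = (\<Sum>i\<in>UNIV. z i * z i) - fps_X * (\<Sum>i\<in>UNIV. k i * z i) - fps_X * kh * (\<Sum>i\<in>UNIV. h i * z i)"
    unfolding X_dx_h by (simp add: sum_distrib_left sum_subtractf sum.distrib algebra_simps h_def z_def k_def kh_def)
  finally have h2: "fps_X * dotf ?h' (z_ser \<kappa>) t x = zz - fps_X * kz - fps_X * kh * hz" by (simp add: comp)
  have "fps_X * dotf ?z' (h_ser \<kappa>) t x = (\<Sum>i\<in>UNIV. (fps_X * ?z' i t x) * h i)"
    by (simp add: dotf_def sum_distrib_left mult.assoc h_def)
  also have "\<dots> = - (\<Sum>i\<in>UNIV. h i * h i) - fps_X * kz * (\<Sum>i\<in>UNIV. h i * h i)"
    unfolding X_dx_z by (simp add: sum_distrib_left sum_subtractf sum.distrib sum_negf algebra_simps h_def kz_def)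
  finally have z1: "fps_X * dotf ?z' (h_ser \<kappa>) t x = - hh - fps_X * kz * hh" by (simp add: comp)
  have "fps_X * dotf ?z' (z_ser \<kappa>) t x = (\<Sum>i\<in>UNIV. (fps_X * ?z' i t x) * z i)"
    by (simp add: dotf_def sum_distrib_left mult.assoc z_def)
  also have "\<dots> = - (\<Sum>i\<in>UNIV. h i * z i) - fps_X * kz * (\<Sum>i\<in>UNIV. h i * z i)"
    unfolding X_dx_z by (simp add: sum_distrib_left sum_subtractf sum.distrib sum_negf algebra_simps h_def z_def kz_def)
  finally have z2: "fps_X * dotf ?z' (z_ser \<kappa>) t x = - hz - fps_X * kz * hz" by (simp add: comp)
  have comm: "dotf f g t x = dotf g f t x" for f g :: "'m \<Rightarrow> _" by (simp add: dotf_def mult.commute)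
  have d: "fps_X * fps_dx (dotf (h_ser \<kappa>) (h_ser \<kappa>)) t x = 2 * (hz - fps_X * kh - fps_X * kh * hh)"
    "fps_X * fps_dx (dotf (z_ser \<kappa>) (z_ser \<kappa>)) t x = 2 * (- hz - fps_X * kz * hz)"
    "fps_X * fps_dx (dotf (h_ser \<kappa>) (z_ser \<kappa>)) t x =
       (zz - fps_X * kz - fps_X * kh * hz) + (- hh - fps_X * kz * hh)"
    using h1 h2 z1 z2 unfolding dx_dotf[OF smooth_h_ser smooth_h_ser] dx_dotf[OF smooth_z_ser smooth_z_ser]
      dx_dotf[OF smooth_h_ser smooth_z_ser] comm[of _ "\<lambda>i. fps_dx (h_ser \<kappa> i)"] comm[of _ "\<lambda>i. fps_dx (z_ser \<kappa> i)"]
    by algebra+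
  have "has_fps_derivative (N t)
     (((0 + fps_dx (dotf (h_ser \<kappa>) (h_ser \<kappa>)) t x) * (1 + zz) + (1 + hh) * (0 + fps_dx (dotf (z_ser \<kappa>) (z_ser \<kappa>)) t x)) -
      (fps_dx (dotf (h_ser \<kappa>) (z_ser \<kappa>)) t x * hz + hz * fps_dx (dotf (h_ser \<kappa>) (z_ser \<kappa>)) t x)) x" (is "has_fps_derivative _ ?dN _")
    unfolding N_def dots
    by (intro has_fps_derivative_diff has_fps_derivative_mult has_fps_derivative_add has_fps_derivative_const
        has_fps_dx[OF smooth_dotf t] smooth_h_ser smooth_z_ser)
  then have A: "has_fps_derivative (\<lambda>x. Y_ser \<kappa> t x * Y_ser \<kappa> t x * N t x)
      ((fps_dx (Y_ser \<kappa>) t x * Y_ser \<kappa> t x + Y_ser \<kappa> t x * fps_dx (Y_ser \<kappa>) t x) * N t x + Y_ser \<kappa> t x * Y_ser \<kappa> t x * ?dN) x"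
    by (intro has_fps_derivative_mult has_fps_dx[OF smooth_Y_ser t])
  have B: "(\<lambda>x. Y_ser \<kappa> t x * Y_ser \<kappa> t x * N t x) = (\<lambda>x. 1)"
    unfolding N_def by (rule ext) (rule Y_ser_square)
  have 0: "(fps_dx (Y_ser \<kappa>) t x * Y_ser \<kappa> t x + Y_ser \<kappa> t x * fps_dx (Y_ser \<kappa>) t x) * N t x + Y_ser \<kappa> t x * Y_ser \<kappa> t x * ?dN = 0"
    using A[unfolded B] has_fps_derivative_const by (rule has_fps_derivative_unique)
  have N: "N t x = (1 + hh) * (1 + zz) - hz * hz" by (simp add: N_def dots)
  have "fps_X * ?dN = (fps_X * fps_dx (dotf (h_ser \<kappa>) (h_ser \<kappa>)) t x) * (1 + zz) + (1 + hh) * (fps_X * fps_dx (dotf (z_ser \<kappa>) (z_ser \<kappa>)) t x)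
      - 2 * hz * (fps_X * fps_dx (dotf (h_ser \<kappa>) (z_ser \<kappa>)) t x)"
    by (simp add: algebra_simps)
  also have "\<dots> = fps_X * (- 2 * kh * N t x)"
    unfolding d N by (simp add: algebra_simps)
  finally have "?dN = - 2 * kh * N t x" by (simp only: mult_cancel_left fps_X_neq_zero simp_thms)
  from 0[unfolded this] have "2 * Y_ser \<kappa> t x * N t x * (fps_dx (Y_ser \<kappa>) t x - Y_ser \<kappa> t x * kh) = 0"
    by (simp add: algebra_simps)
  moreover have "Y_ser \<kappa> t x * N t x \<noteq> 0" using Y_ser_square[of \<kappa> t x] unfolding N_def by force
  ultimately show ?thesis by (simp add: kh_def)
qed

end

context
  fixes M :: "real ^ 'm ^ 'm"
  assumes M: "transpose M ** M = mat 1"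
begin

lemma curv_rotated: "curv (\<lambda>t x. M *v \<kappa> t x) i t x = (\<Sum>l\<in>UNIV. fps_const (M $ i $ l) * curv \<kappa> l t x)"
  by (simp add: curv_def fps_eq_iff fps_sum_nth matrix_vector_mult_def)

text \<open>Both steps are assembled from invariant dot products, multiples of vectors and
  x-derivatives, so a constant orthogonal M commutes with every iteration and hence with the
  limit.\<close>

lemma riccati_iter_rotated:
  assumes "t \<in> T"
  shows "fst (riccati_iter (\<lambda>t x. M *v \<kappa> t x) N) i t x = (\<Sum>l\<in>UNIV. fps_const (M $ i $ l) * fst (riccati_iter \<kappa> N) l t x) \<and>
     snd (riccati_iter (\<lambda>t x. M *v \<kappa> t x) N) i t x = (\<Sum>l\<in>UNIV. fps_const (M $ i $ l) * snd (riccati_iter \<kappa> N) l t x)"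
proof (induction N arbitrary: i x)
  case 0
  show ?case by simp
next
  case (Suc N)
  let ?h = "fst (riccati_iter \<kappa> N)" and ?z = "snd (riccati_iter \<kappa> N)"
  let ?h' = "fst (riccati_iter (\<lambda>t x. M *v \<kappa> t x) N)" and ?z' = "snd (riccati_iter (\<lambda>t x. M *v \<kappa> t x) N)"
  have h: "?h' i t x = (\<Sum>l\<in>UNIV. fps_const (M $ i $ l) * ?h l t x)"
    and z: "?z' i t x = (\<Sum>l\<in>UNIV. fps_const (M $ i $ l) * ?z l t x)" for i x
    using Suc by auto
  have dh: "fps_dx (?h' i) t x = (\<Sum>l\<in>UNIV. fps_const (M $ i $ l) * fps_dx (?h l) t x)"
    and dz: "fps_dx (?z' i) t x = (\<Sum>l\<in>UNIV. fps_const (M $ i $ l) * fps_dx (?z l) t x)" for i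
    by (rule fps_dx_rotated; (rule h z assms conjunct1[OF smooth_riccati_iter] conjunct2[OF smooth_riccati_iter]))+
  have kh: "dotf (curv (\<lambda>t x. M *v \<kappa> t x)) ?h' t x = dotf (curv \<kappa>) ?h t x"
    and kz: "dotf (curv (\<lambda>t x. M *v \<kappa> t x)) ?z' t x = dotf (curv \<kappa>) ?z t x"
    by (rule dotf_rotated[OF M]; rule curv_rotated h z)+
  have "step_h (\<lambda>t x. M *v \<kappa> t x) ?h' ?z' i t x = (\<Sum>l\<in>UNIV. fps_const (M $ i $ l) * step_h \<kappa> ?h ?z l t x)"
    unfolding step_h_def kz dz h
    by (simp add: sum_distrib_left sum_distrib_right sum.distrib sum_negf sum_subtractf algebra_simps)
  moreover have "step_z (\<lambda>t x. M *v \<kappa> t x) ?h' i t x = (\<Sum>l\<in>UNIV. fps_const (M $ i $ l) * step_z \<kappa> ?h l t x)"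
    unfolding step_z_def kh dh h curv_rotated
    by (simp add: sum_distrib_left sum_distrib_right sum.distrib algebra_simps)
  ultimately show ?case by simp
qed

lemma h_ser_rotated: "t \<in> T \<Longrightarrow> h_ser (\<lambda>t x. M *v \<kappa> t x) i t x = (\<Sum>l\<in>UNIV. fps_const (M $ i $ l) * h_ser \<kappa> l t x)"
  and z_ser_rotated: "t \<in> T \<Longrightarrow> z_ser (\<lambda>t x. M *v \<kappa> t x) i t x = (\<Sum>l\<in>UNIV. fps_const (M $ i $ l) * z_ser \<kappa> l t x)"
  using riccati_iter_rotated by (simp_all add: fps_eq_iff h_ser_def z_ser_def fps_sum_nth)

lemma Y_ser_rotated:
  assumes "t \<in> T"
  shows "Y_ser (\<lambda>t x. M *v \<kappa> t x) t x = Y_ser \<kappa> t x"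
proof -
  note h = h_ser_rotated[OF assms] and z = z_ser_rotated[OF assms]
  let ?h = "h_ser (\<lambda>t x. M *v \<kappa> t x)" and ?z = "z_ser (\<lambda>t x. M *v \<kappa> t x)"
  have "dotf ?h ?h t x = dotf (h_ser \<kappa>) (h_ser \<kappa>) t x" "dotf ?z ?z t x = dotf (z_ser \<kappa>) (z_ser \<kappa>) t x"
    "dotf ?h ?z t x = dotf (h_ser \<kappa>) (z_ser \<kappa>) t x"
    by (rule dotf_rotated[OF M]; rule h z)+
  then show ?thesis unfolding Y_ser_def by simp
qed

end

end

subsection \<open>Rank two skew matrices\<close>

definition mscale :: "'a::comm_ring_1 \<Rightarrow> 'a ^ 'p ^ 'p \<Rightarrow> 'a ^ 'p ^ 'p" where
  "mscale c A = (\<chi> p q. c * A $ p $ q)"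

definition mcomm :: "'a::comm_ring_1 ^ 'p ^ 'p \<Rightarrow> 'a ^ 'p ^ 'p \<Rightarrow> 'a ^ 'p ^ 'p" where
  "mcomm A B = A ** B - B ** A"

lemma mscale_simps:
  "mscale c (A + B) = mscale c A + mscale c B" "mscale c (A - B) = mscale c A - mscale c B"
  "mscale c (- A) = - mscale c A"
  "mscale c A ** B = mscale c (A ** B)" "A ** mscale c B = mscale c (A ** B)"
  "trace (mscale c A) = c * trace A" "mscale c (mscale d A) = mscale (c * d) A"
  by (simp_all add: mscale_def vec_eq_iff matrix_matrix_mult_def trace_def sum_distrib_left algebra_simps)

lemma matrix_diff_distrib:
  fixes A B C :: "'a::comm_ring_1 ^ 'p ^ 'p"
  shows "A ** (B - C) = A ** B - A ** C" "(B - C) ** A = B ** A - C ** A"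
  "A ** (- B) = - (A ** B)" "(- A) ** B = - (A ** B)" "(B + C) ** A = B ** A + C ** A"
  by (simp_all add: vec_eq_iff matrix_matrix_mult_def sum_subtractf sum_negf sum.distrib algebra_simps)

lemmas matrix_ring = matrix_diff_distrib matrix_add_ldistrib matrix_mul_assoc

lemma trace_minus: "trace (- A :: 'a::comm_ring_1 ^ 'p ^ 'p) = - trace A"
  by (simp add: trace_def sum_negf)

lemma trace_mcomm: "trace (mcomm A B ** C) = trace (A ** mcomm B C)"
proof -
  have "trace (B ** A ** C) = trace (A ** C ** B)"
    using trace_mul_sym[of B "A ** C"] by (simp add: matrix_mul_assoc)
  then show ?thesis by (simp add: mcomm_def matrix_ring trace_sub)
qed

lemma mcomm_mcomm: "mcomm A (mcomm A B) = A ** A ** B - A ** B ** A - A ** B ** A + B ** A ** A"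
  by (simp add: mcomm_def matrix_ring)

lemma mcomm_jacobi: "mcomm (mcomm S V) E + mcomm S (mcomm E V) = mcomm (mcomm S E) V"
  by (simp add: mcomm_def matrix_ring)

lemma mcomm_linear:
  "mcomm (A + B) C = mcomm A C + mcomm B C" "mcomm A (B + C) = mcomm A B + mcomm A C"
  "mcomm (A - B) C = mcomm A C - mcomm B C" "mcomm A (B - C) = mcomm A B - mcomm A C"
  "mcomm (mscale c A) B = mscale c (mcomm A B)" "mcomm A (mscale c B) = mscale c (mcomm A B)"
  "mcomm (- A) B = - mcomm A B" "mcomm A (- B) = - mcomm A B"
  by (simp_all add: mcomm_def matrix_ring mscale_simps)

text \<open>\<open>trace (R [S, E])\<close> is the Kirillov form of the adjoint orbit of \<open>R\<close>, evaluated on two tangent vectors.\<close>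

lemma trace_kirillov_derivative:
  fixes R S E :: "'a::comm_ring_1 ^ 'p ^ 'p"
  assumes R: "mscale e R' = mcomm R V"
    and S: "mscale e S' = mcomm S V + mscale e (mcomm R U')"
    and E: "mscale e E' + R' = mcomm E V + mcomm R U"
    and V: "V = a + mscale e U"
    and adS: "mcomm R (mcomm R S) = - S" and adE: "mcomm R (mcomm R E) = - E"
  shows "e * e * (trace (R' ** mcomm S E) + trace (R ** (mcomm S' E + mcomm S E'))) =
    - (e * e * trace (E ** U')) - trace (S ** a)"
proof -
  have E': "mscale e E' = mcomm E V + mcomm R U - R'" using E by (simp add: algebra_simps)
  have "e * (trace (R' ** mcomm S E) + trace (R ** (mcomm S' E + mcomm S E'))) =
    trace (mscale e R' ** mcomm S E) + trace (R ** (mcomm (mscale e S') E + mcomm S (mscale e E')))"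
    by (simp add: mcomm_linear mscale_simps matrix_ring trace_add distrib_left)
  also have "\<dots> = trace (mcomm R V ** mcomm S E) + trace (R ** (mcomm (mcomm S V) E + mcomm S (mcomm E V)))
      + e * trace (R ** mcomm (mcomm R U') E) + trace (R ** mcomm S (mcomm R U - R'))"
    unfolding R S E' by (simp add: mcomm_linear mscale_simps matrix_ring trace_add trace_sub)
  \<comment> \<open>Up to the factor \<open>e\<close>, bracketing with \<open>V\<close> moves R, S
    and E by one common infinitesimal conjugation, under which the form is invariant; this is the
    Jacobi identity.\<close>
  also have "trace (mcomm R V ** mcomm S E) + trace (R ** (mcomm (mcomm S V) E + mcomm S (mcomm E V))) = 0"
  proof -
    have "mcomm V (mcomm S E) = - mcomm (mcomm S E) V" by (simp add: mcomm_def)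
    then show ?thesis unfolding mcomm_jacobi trace_mcomm by (simp add: matrix_ring trace_minus)
  qed
  \<comment> \<open>Invariance of the trace moves both brackets with R onto E, where (ad R)^2 acts
    as -1.\<close>
  also have "trace (R ** mcomm (mcomm R U') E) = - trace (E ** U')"
  proof -
    have "trace (R ** mcomm (mcomm R U') E) = trace (mcomm R (mcomm R U') ** E)"
      by (rule trace_mcomm[symmetric])
    also have "\<dots> = trace (E ** mcomm R (mcomm R U'))" by (rule trace_mul_sym)
    also have "\<dots> = trace (mcomm (mcomm E R) R ** U')" by (simp only: trace_mcomm)
    also have "mcomm (mcomm E R) R = mcomm R (mcomm R E)" by (simp add: mcomm_def matrix_ring)
    finally show ?thesis by (simp add: adE matrix_ring trace_minus)
  qed
  finally have 1: "e * (trace (R' ** mcomm S E) + trace (R ** (mcomm S' E + mcomm S E'))) =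
    - (e * trace (E ** U')) + trace (R ** mcomm S (mcomm R U - R'))" by simp
  \<comment> \<open>Here the inhomogeneity of the \<epsilon>-derivative enters. A second factor
    \<open>e\<close> converts \<open>R'\<close> into \<open>mcomm R V\<close>, and of this only
    -[R, a] survives; hence the \<open>e * e\<close> in the statement.\<close>
  have "e * trace (R ** mcomm S (mcomm R U - R')) = trace (R ** mcomm S (mcomm R (mscale e U) - mscale e R'))"
    by (simp add: mcomm_linear mscale_simps matrix_ring trace_sub algebra_simps)
  also have "mcomm R (mscale e U) - mscale e R' = - mcomm R a"
    by (simp add: R V mcomm_linear)
  also have "trace (R ** mcomm S (- mcomm R a)) = - trace (S ** a)"
  proof -
    have "trace (R ** mcomm S (mcomm R a)) = trace (mcomm (mcomm R S) R ** a)" by (simp only: trace_mcomm)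
    also have "mcomm (mcomm R S) R = - mcomm R (mcomm R S)" by (simp add: mcomm_def)
    finally show ?thesis by (simp add: mcomm_linear matrix_ring trace_minus adS)
  qed
  finally have 2: "e * trace (R ** mcomm S (mcomm R U - R')) = - trace (S ** a)" .
  show ?thesis unfolding mult.assoc[of e e] 1 by (simp add: right_diff_distrib 2)
qed

section \<open>Skew matrices of rank two as wedge products\<close>

definition bilin :: "'a::comm_ring_1 ^ 'p \<Rightarrow> 'a ^ 'p ^ 'p \<Rightarrow> 'a ^ 'p \<Rightarrow> 'a" where
  "bilin b S c = (\<Sum>p\<in>UNIV. \<Sum>q\<in>UNIV. b $ p * S $ p $ q * c $ q)"

definition wedge :: "'a::comm_ring_1 \<Rightarrow> 'a ^ 'p \<Rightarrow> 'a ^ 'p \<Rightarrow> 'a ^ 'p ^ 'p" where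
  "wedge Y b c = (\<chi> p q. Y * (c $ p * b $ q - b $ p * c $ q))"

lemma wedge_skew: "wedge Y b c $ p $ q = - (wedge Y b c $ q $ p)"
  by (simp add: wedge_def algebra_simps)

lemma mult_wedge: "(M ** wedge Y b c) $ p $ q = Y * ((M *v c) $ p * b $ q - (M *v b) $ p * c $ q)"
  by (simp add: wedge_def matrix_matrix_mult_def matrix_vector_mult_def sum_distrib_left sum_distrib_right
      sum_subtractf[symmetric] algebra_simps)

lemma wedge_mult: "(wedge Y b c ** M) $ p $ q = Y * (c $ p * (b v* M) $ q - b $ p * (c v* M) $ q)"
  by (simp add: wedge_def matrix_matrix_mult_def vector_matrix_mult_def sum_distrib_left sum_distrib_right
      sum_subtractf[symmetric] algebra_simps)

lemma bilin_swap:
  assumes "\<And>p q. S $ p $ q = - (S $ q $ p)"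
  shows "bilin b S c = - bilin c S b"
proof -
  have "b $ p * S $ p $ q * c $ q = - (c $ q * S $ q $ p * b $ p)" for p q
    unfolding assms[of p q] by (simp add: mult.commute mult.left_commute)
  then have "bilin b S c = (\<Sum>p\<in>UNIV. \<Sum>q\<in>UNIV. - (c $ q * S $ q $ p * b $ p))"
    by (simp only: bilin_def)
  also have "\<dots> = - bilin c S b"
    unfolding bilin_def sum_negf by (subst sum.swap) (rule refl)
  finally show ?thesis .
qed

lemma bilin_altdef: "bilin b S v = (\<Sum>q\<in>UNIV. (b v* S) $ q * v $ q)"
proof -
  have "(b v* S) $ q * v $ q = (\<Sum>p\<in>UNIV. b $ p * S $ p $ q * v $ q)" for q
    by (simp add: vector_matrix_mult_def sum_distrib_right)
  then show ?thesis unfolding bilin_def by (subst sum.swap) simp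
qed

lemma wedge_mult_vec: "(wedge Y b c ** S *v v) $ p = Y * (bilin b S v * c $ p - bilin c S v * b $ p)"
proof -
  have "(wedge Y b c ** S *v v) $ p = (\<Sum>q\<in>UNIV. (wedge Y b c ** S) $ p $ q * v $ q)"
    by (simp add: matrix_vector_mult_def)
  also have "\<dots> = (\<Sum>q\<in>UNIV. Y * c $ p * ((b v* S) $ q * v $ q) - Y * b $ p * ((c v* S) $ q * v $ q))"
    by (intro sum.cong refl) (simp only: wedge_mult, simp add: algebra_simps)
  also have "\<dots> = Y * c $ p * bilin b S v - Y * b $ p * bilin c S v"
    unfolding bilin_altdef sum_subtractf by (simp only: sum_distrib_left)
  finally show ?thesis by (simp add: algebra_simps)
qed

lemma trace_wedge_mult: "trace (wedge Y b c ** S) = Y * (bilin b S c - bilin c S b)"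
proof -
  have "trace (wedge Y b c ** S) = (\<Sum>p\<in>UNIV. Y * ((b v* S) $ p * c $ p) - Y * ((c v* S) $ p * b $ p))"
    unfolding trace_def by (intro sum.cong refl) (simp only: wedge_mult, simp add: algebra_simps)
  also have "\<dots> = Y * bilin b S c - Y * bilin c S b"
    unfolding bilin_altdef sum_subtractf by (simp only: sum_distrib_left)
  finally show ?thesis by (simp add: algebra_simps)
qed

text \<open>Both expressions see only the restriction of S to the plane of b and c, and a skew form
  on a plane is the single number \<open>bilin b S c\<close>. Together they say that R S R is half
  of tr (R S) times R.\<close>

lemma wedge_sandwich:
  fixes b c :: "'a::{idom,semiring_char_0} ^ 'p"
  assumes skew: "\<And>p q. S $ p $ q = - (S $ q $ p)"
  shows "wedge Y b c ** S ** wedge Y b c = mscale (Y * bilin b S c) (wedge Y b c)"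
    "trace (wedge Y b c ** S) = 2 * (Y * bilin b S c)"
proof -
  have 0: "bilin v S v = 0" for v :: "'a ^ 'p"
    
  proof -
    have "2 * bilin v S v = 0" using bilin_swap[OF skew, of v v] by (simp only: mult_2 eq_neg_iff_add_eq_0)
    then show ?thesis by simp
  qed
  have 1: "bilin c S b = - bilin b S c" by (rule bilin_swap) (rule skew)
  show "wedge Y b c ** S ** wedge Y b c = mscale (Y * bilin b S c) (wedge Y b c)"
    by (simp add: vec_eq_iff mult_wedge wedge_mult_vec 0 1 mscale_def) (simp add: wedge_def algebra_simps)
  have "trace (wedge Y b c ** S) = Y * (bilin b S c - bilin c S b)" by (rule trace_wedge_mult)
  then show "trace (wedge Y b c ** S) = 2 * (Y * bilin b S c)" by (simp add: 1)
qed

text \<open>The case S = R of \<open>wedge_sandwich\<close>. The hypothesis says that Y^2 times the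
  Gram determinant of b and c is 1, which makes the scalar factor -1.\<close>

lemma wedge_cube:
  fixes Y :: "'a::{idom,semiring_char_0}" and b c :: "'a ^ 'p"
  assumes "Y * Y * ((\<Sum>p\<in>UNIV. b $ p * b $ p) * (\<Sum>p\<in>UNIV. c $ p * c $ p) - (\<Sum>p\<in>UNIV. b $ p * c $ p) * (\<Sum>p\<in>UNIV. b $ p * c $ p)) = 1"
  shows "wedge Y b c ** wedge Y b c ** wedge Y b c = - wedge Y b c"
proof -
  have "bilin b (wedge Y b c) c = Y * ((\<Sum>p\<in>UNIV. b $ p * c $ p) * (\<Sum>p\<in>UNIV. b $ p * c $ p) -
      (\<Sum>p\<in>UNIV. b $ p * b $ p) * (\<Sum>p\<in>UNIV. c $ p * c $ p))"
    unfolding sum_product bilin_def wedge_def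
    by (simp add: sum_distrib_left sum_subtractf algebra_simps)
  then have "Y * bilin b (wedge Y b c) c = -1" using assms by algebra
  then show ?thesis
    unfolding wedge_sandwich(1)[OF wedge_skew] by (simp add: mscale_def vec_eq_iff)
qed

text \<open>Multiplying the linearized cubic equation by R and taking traces gives 3 tr (R S) = tr
  (R S), so tr (R S) = 0 and R S R = 0 by \<open>wedge_sandwich\<close>. What remains is [R, [R, S]]
  = R R S + S R R = -S. For general matrices ad R would also have the eigenvalues 2i and -2i; they
  are excluded since S is skew and R has rank two.\<close>

lemma wedge_orbit_tangent:
  fixes Y :: "'a::{idom,semiring_char_0}" and b c :: "'a ^ 'p"
  defines "R \<equiv> wedge Y b c"
  assumes skew: "\<And>p q. S $ p $ q = - (S $ q $ p)"
    and R: "R ** R ** R = - R"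
    and S: "S ** R ** R + R ** S ** R + R ** R ** S = - S"
  shows "mcomm R (mcomm R S) = - S"
proof -
  have "trace (R ** (S ** R ** R + R ** S ** R + R ** R ** S)) =
      trace (R ** S ** (R ** R)) + trace (R ** R ** S ** R) + trace (R ** R ** R ** S)"
    by (simp add: matrix_ring trace_add)
  also have "trace (R ** S ** (R ** R)) = trace (R ** R ** R ** S)"
    by (subst trace_mul_sym) (simp add: matrix_mul_assoc)
  also have "trace (R ** R ** S ** R) = trace (R ** R ** R ** S)"
    by (subst trace_mul_sym) (simp add: matrix_mul_assoc)
  finally have "3 * trace (R ** S) = trace (R ** S)"
    unfolding S by (simp add: R matrix_ring trace_minus)
  then have "trace (R ** S) = 0" by simp
  then have "Y * bilin b S c = 0"
    using wedge_sandwich(2)[OF skew, of Y b c] by (simp add: R_def)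
  then have 0: "R ** S ** R = 0"
    using wedge_sandwich(1)[OF skew, of Y b c] by (simp add: R_def mscale_def vec_eq_iff)
  with S show ?thesis by (simp add: mcomm_mcomm add.commute)
qed

lemma sum_option: "(\<Sum>p\<in>UNIV. f p) = f None + (\<Sum>i\<in>UNIV. f (Some i))" for f :: "'a::finite option \<Rightarrow> 'b::comm_monoid_add"
  unfolding UNIV_option_conv by (simp add: sum.reindex)

subsection \<open>The matrix \<open>R\<close> and its variation\<close>

definition fmat :: "real ^ 'p ^ 'p \<Rightarrow> real fps ^ 'p ^ 'p" where
  "fmat A = (\<chi> p q. fps_const (A $ p $ q))"

text \<open>\<open>rho0\<close> and \<open>rho1\<close> span the image of R; their first two
  coordinates are normalized to (0, 1) and (-1, 0). The sign makes Y itself, not its negative, the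
  entry at row 2, column 1.\<close>

definition rho0 :: "(real \<Rightarrow> real \<Rightarrow> real ^ 'm) \<Rightarrow> real \<Rightarrow> real \<Rightarrow> real fps ^ 'm option option" where
  "rho0 \<kappa> t x = (\<chi> p. case p of None \<Rightarrow> 0 | Some None \<Rightarrow> 1 | Some (Some i) \<Rightarrow> h_ser \<kappa> i t x)"

definition rho1 :: "(real \<Rightarrow> real \<Rightarrow> real ^ 'm) \<Rightarrow> real \<Rightarrow> real \<Rightarrow> real fps ^ 'm option option" where
  "rho1 \<kappa> t x = (\<chi> p. case p of None \<Rightarrow> -1 | Some None \<Rightarrow> 0 | Some (Some i) \<Rightarrow> z_ser \<kappa> i t x)"

definition R_mat :: "(real \<Rightarrow> real \<Rightarrow> real ^ 'm) \<Rightarrow> real \<Rightarrow> real \<Rightarrow> real fps ^ 'm option option ^ 'm option option" where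
  "R_mat \<kappa> t x = wedge (Y_ser \<kappa> t x) (rho0 \<kappa> t x) (rho1 \<kappa> t x)"

lemma rho_simps [simp]:
  "rho0 \<kappa> t x $ None = 0" "rho0 \<kappa> t x $ Some None = 1" "rho0 \<kappa> t x $ Some (Some i) = h_ser \<kappa> i t x"
  "rho1 \<kappa> t x $ None = -1" "rho1 \<kappa> t x $ Some None = 0" "rho1 \<kappa> t x $ Some (Some i) = z_ser \<kappa> i t x"
  by (simp_all add: rho0_def rho1_def)

lemma R_mat_simps [simp]:
  "R_mat \<kappa> t x $ None $ None = 0" "R_mat \<kappa> t x $ Some None $ Some None = 0"
  "R_mat \<kappa> t x $ Some None $ None = Y_ser \<kappa> t x" "R_mat \<kappa> t x $ None $ Some None = - Y_ser \<kappa> t x"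
  "R_mat \<kappa> t x $ Some (Some i) $ None = Y_ser \<kappa> t x * h_ser \<kappa> i t x"
  "R_mat \<kappa> t x $ None $ Some (Some i) = - (Y_ser \<kappa> t x * h_ser \<kappa> i t x)"
  "R_mat \<kappa> t x $ Some (Some i) $ Some None = Y_ser \<kappa> t x * z_ser \<kappa> i t x"
  "R_mat \<kappa> t x $ Some None $ Some (Some i) = - (Y_ser \<kappa> t x * z_ser \<kappa> i t x)"
  "R_mat \<kappa> t x $ Some (Some i) $ Some (Some l) =
     Y_ser \<kappa> t x * (z_ser \<kappa> i t x * h_ser \<kappa> l t x - h_ser \<kappa> i t x * z_ser \<kappa> l t x)"
  by (simp_all add: R_mat_def wedge_def)

lemma R_mat_skew: "R_mat \<kappa> t x $ p $ q = - (R_mat \<kappa> t x $ q $ p)"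
  unfolding R_mat_def by (rule wedge_skew)

lemma R_mat_cube: "R_mat \<kappa> t x ** R_mat \<kappa> t x ** R_mat \<kappa> t x = - R_mat \<kappa> t x"
  unfolding R_mat_def
  by (rule wedge_cube) (use Y_ser_square[of \<kappa> t x] in \<open>simp add: sum_option dotf_def mult.commute\<close>)

section \<open>Derivatives of matrices of power series\<close>

definition has_mat_derivative ::
  "(real \<Rightarrow> real fps ^ 'p ^ 'p) \<Rightarrow> real fps ^ 'p ^ 'p \<Rightarrow> real \<Rightarrow> bool" where
  "has_mat_derivative F D y \<longleftrightarrow> (\<forall>p q. has_fps_derivative (\<lambda>x. F x $ p $ q) (D $ p $ q) y)"

lemma has_mat_derivative_unique: "has_mat_derivative F D y \<Longrightarrow> has_mat_derivative F E y \<Longrightarrow> D = E"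
  unfolding has_mat_derivative_def vec_eq_iff by (blast intro: has_fps_derivative_unique)

lemma has_mat_derivative_const: "has_mat_derivative (\<lambda>x. A) 0 y"
  by (simp add: has_mat_derivative_def has_fps_derivative_const)

lemma has_mat_derivative_add:
  "has_mat_derivative F D y \<Longrightarrow> has_mat_derivative G E y \<Longrightarrow> has_mat_derivative (\<lambda>x. F x + G x) (D + E) y"
  by (simp add: has_mat_derivative_def has_fps_derivative_add)

lemma has_mat_derivative_diff:
  "has_mat_derivative F D y \<Longrightarrow> has_mat_derivative G E y \<Longrightarrow> has_mat_derivative (\<lambda>x. F x - G x) (D - E) y"
  by (simp add: has_mat_derivative_def has_fps_derivative_diff)

lemma has_mat_derivative_minus: "has_mat_derivative F D y \<Longrightarrow> has_mat_derivative (\<lambda>x. - F x) (- D) y"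
  by (simp add: has_mat_derivative_def has_fps_derivative_minus)

lemma has_mat_derivative_mult:
  assumes "has_mat_derivative F D y" "has_mat_derivative G E y"
  shows "has_mat_derivative (\<lambda>x. F x ** G x) (D ** G y + F y ** E) y"
  unfolding has_mat_derivative_def
proof (intro allI)
  fix p q
  have "has_fps_derivative (\<lambda>x. \<Sum>r\<in>UNIV. F x $ p $ r * G x $ r $ q)
      (\<Sum>r\<in>UNIV. D $ p $ r * G y $ r $ q + F y $ p $ r * E $ r $ q) y"
    using assms unfolding has_mat_derivative_def
    by (intro has_fps_derivative_sum has_fps_derivative_mult) auto
  then show "has_fps_derivative (\<lambda>x. (F x ** G x) $ p $ q) ((D ** G y + F y ** E) $ p $ q) y"
    by (simp add: matrix_matrix_mult_def sum.distrib)
qed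

lemma has_mat_derivative_mscale: "has_mat_derivative F D y \<Longrightarrow> has_mat_derivative (\<lambda>x. mscale c (F x)) (mscale c D) y"
  using has_fps_derivative_mult[OF has_fps_derivative_const] by (simp add: has_mat_derivative_def mscale_def)

lemma has_mat_derivative_mcomm:
  assumes "has_mat_derivative F D y" "has_mat_derivative G E y"
  shows "has_mat_derivative (\<lambda>x. mcomm (F x) (G x)) (mcomm D (G y) + mcomm (F y) E) y"
  using has_mat_derivative_diff[OF has_mat_derivative_mult[OF assms] has_mat_derivative_mult[OF assms(2,1)]]
  by (simp add: mcomm_def algebra_simps)

lemma has_mat_derivative_trace:
  "has_mat_derivative F D y \<Longrightarrow> has_fps_derivative (\<lambda>x. trace (F x)) (trace D) y"
  unfolding trace_def by (intro has_fps_derivative_sum) (simp add: has_mat_derivative_def)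

lemma has_mat_derivative_fmat:
  "(f has_vector_derivative d) (at y) \<Longrightarrow> has_mat_derivative (\<lambda>x. fmat (f x)) (fmat d) y"
  by (simp add: has_mat_derivative_def fmat_def has_fps_derivative_fps_const has_vector_derivative_vec)

lemma has_mat_derivative_transform:
  assumes "has_mat_derivative F D y" "open T" "y \<in> T" "\<And>s. s \<in> T \<Longrightarrow> F s = G s"
  shows "has_mat_derivative G D y"
  unfolding has_mat_derivative_def has_fps_derivative_def
proof (intro allI)
  fix p q n
  have "((\<lambda>x. fps_nth (F x $ p $ q) n) has_vector_derivative fps_nth (D $ p $ q) n) (at y)"
    using assms(1) by (simp add: has_mat_derivative_def has_fps_derivative_def)
  then show "((\<lambda>x. fps_nth (G x $ p $ q) n) has_vector_derivative fps_nth (D $ p $ q) n) (at y)"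
    by (rule has_vector_derivative_transform_within_open[OF _ assms(2,3)]) (simp add: assms(4))
qed

text \<open>The derivative in the formal variable \<epsilon>, as opposed to \<open>mat_dx\<close>
  and \<open>mat_dt\<close>.\<close>

definition mderiv :: "real fps ^ 'p ^ 'p \<Rightarrow> real fps ^ 'p ^ 'p" where
  "mderiv A = (\<chi> p q. fps_deriv (A $ p $ q))"

lemma has_mat_derivative_mderiv: "has_mat_derivative F D y \<Longrightarrow> has_mat_derivative (\<lambda>x. mderiv (F x)) (mderiv D) y"
  by (simp add: has_mat_derivative_def mderiv_def has_fps_derivative_fps_deriv)

lemma mderiv_simps:
  "mderiv (A + B) = mderiv A + mderiv B" "mderiv (A - B) = mderiv A - mderiv B" "mderiv (- A) = - mderiv A"
  "mderiv (A ** B) = mderiv A ** B + A ** mderiv B"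
  "mderiv (mscale fps_X A) = A + mscale fps_X (mderiv A)" "mderiv (fmat C) = 0"
  by (simp_all add: mderiv_def mscale_def fmat_def vec_eq_iff matrix_matrix_mult_def fps_deriv_sum sum.distrib algebra_simps)

lemma mderiv_mcomm: "mderiv (mcomm A B) = mcomm (mderiv A) B + mcomm A (mderiv B)"
  by (simp add: mcomm_def mderiv_simps algebra_simps)

definition mat_dx where
  "mat_dx F t x = (\<chi> p q. fps_dx (\<lambda>t x. F t x $ p $ q) t x)"

definition mat_dt where
  "mat_dt F t x = (\<chi> p q. fps_dt (\<lambda>t x. F t x $ p $ q) t x)"

definition V_mat :: "(real \<Rightarrow> real \<Rightarrow> real ^ 'm) \<Rightarrow> real \<Rightarrow> real \<Rightarrow> real fps ^ 'm option option ^ 'm option option" where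
  "V_mat \<kappa> t x = fmat mat_a + mscale fps_X (fmat (Psi (\<kappa> t x)))"

lemma mat_a_simps [simp]:
  "mat_a $ None $ None = 0" "mat_a $ Some None $ Some None = 0"
  "mat_a $ Some None $ None = 1" "mat_a $ None $ Some None = -1"
  "mat_a $ Some (Some i) $ q = 0" "mat_a $ p $ Some (Some i) = 0"
  by (auto simp: mat_a_def split: option.split)

lemma even_block_simps [simp]:
  "even_block z \<xi> $ None $ q = 0" "even_block z \<xi> $ p $ None = 0" "even_block z \<xi> $ Some None $ Some None = 0"
  "even_block z \<xi> $ Some None $ Some (Some i) = - (z $ i)" "even_block z \<xi> $ Some (Some i) $ Some None = z $ i"
  "even_block z \<xi> $ Some (Some i) $ Some (Some l) = \<xi> $ i $ l"
  by (auto simp: even_block_def split: option.split)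

lemma odd_block_simps [simp]:
  "odd_block y \<eta> $ None $ None = 0" "odd_block y \<eta> $ Some p $ Some q = 0"
  "odd_block y \<eta> $ None $ Some None = - y" "odd_block y \<eta> $ Some None $ None = y"
  "odd_block y \<eta> $ None $ Some (Some i) = - (\<eta> $ i)" "odd_block y \<eta> $ Some (Some i) $ None = \<eta> $ i"
  by (auto simp: odd_block_def split: option.split)

lemma V_mat_skew: "V_mat \<kappa> t x $ p $ q = - (V_mat \<kappa> t x $ q $ p)"
  by (cases p rule: option.exhaust; cases q rule: option.exhaust; (simp; fail)?;
      cases "the p"; cases "the q"; simp add: V_mat_def fmat_def mscale_def Psi_def flip: fps_const_neg)

lemma V_mat_vec:
  "(V_mat \<kappa> t x *v v) $ None = - (v $ Some None)"
  "(V_mat \<kappa> t x *v v) $ Some None = v $ None - fps_X * (\<Sum>i\<in>UNIV. curv \<kappa> i t x * v $ Some (Some i))"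
  "(V_mat \<kappa> t x *v v) $ Some (Some i) = fps_X * (curv \<kappa> i t x * v $ Some None)"
  by (simp_all add: matrix_vector_mult_def sum_option V_mat_def fmat_def mscale_def Psi_def curv_def
      sum_distrib_left sum_negf mult.assoc flip: fps_const_neg)

context curvature_family begin

lemma smooth_R_mat: "smooth_fps_family L T (\<lambda>t x. R_mat \<kappa> t x $ p $ q)"
proof -
  have "smooth_fps_family L T (\<lambda>t x. rho0 \<kappa> t x $ p)" "smooth_fps_family L T (\<lambda>t x. rho1 \<kappa> t x $ p)" for p
    by (cases p rule: option.exhaust; (simp add: smooth_fps_const T; fail)?; cases "the p";
        simp add: smooth_fps_const T smooth_h_ser smooth_z_ser)+
  then show ?thesis
    unfolding R_mat_def wedge_def by (simp add: smooth_fps_mult smooth_fps_diff T smooth_Y_ser)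
qed

end

lemma skew_vector_mult:
  fixes M :: "'a::comm_ring_1 ^ 'p ^ 'p"
  assumes "\<And>p q. M $ p $ q = - (M $ q $ p)"
  shows "(b v* M) $ q = - ((M *v b) $ q)"
proof -
  have "b $ i * M $ i $ q = - (M $ q $ i * b $ i)" for i
    unfolding assms[of i q] by (simp add: mult.commute)
  then show ?thesis by (simp add: vector_matrix_mult_def matrix_vector_mult_def sum_negf)
qed

lemma linear_Psi: "linear Psi"
proof (rule linearI)
  show "Psi (v + w) = Psi v + Psi w" for v w :: "real ^ 'm"
    by (auto simp: Psi_def even_block_def vec_eq_iff split: option.split)
  show "Psi (r *\<^sub>R v) = r *\<^sub>R Psi v" for r and v :: "real ^ 'm"
    by (auto simp: Psi_def even_block_def vec_eq_iff split: option.split)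
qed

lemma has_vector_derivative_Psi:
  "(f has_vector_derivative d) F \<Longrightarrow> ((\<lambda>x. Psi (f x)) has_vector_derivative Psi d) F"
  by (rule bounded_linear.has_vector_derivative[OF linear_conv_bounded_linear[THEN iffD1, OF linear_Psi]])

lemma mscale_0 [simp]: "mscale c 0 = 0"
  by (simp add: mscale_def vec_eq_iff)

lemma trace_mult_a:
  assumes "\<And>p q. A $ p $ q = - (A $ q $ p)"
  shows "trace (A ** fmat mat_a) = - 2 * (A $ Some None $ None)"
  using assms[of None "Some None"]
  by (simp add: trace_def matrix_matrix_mult_def sum_option fmat_def flip: fps_const_neg)

lemma trace_mult_Psi:
  assumes "\<And>p q. A $ p $ q = - (A $ q $ p)"
  shows "trace (A ** fmat (Psi v)) = - 2 * (\<Sum>i\<in>UNIV. A $ Some (Some i) $ Some None * fps_const (v $ i))"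
proof -
  have "trace (A ** fmat (Psi v)) = (\<Sum>i\<in>UNIV. A $ Some None $ Some (Some i) * fps_const (v $ i)) -
     (\<Sum>i\<in>UNIV. A $ Some (Some i) $ Some None * fps_const (v $ i))"
    by (simp add: trace_def matrix_matrix_mult_def sum_option fmat_def Psi_def sum_negf flip: fps_const_neg)
  also have "(\<Sum>i\<in>UNIV. A $ Some None $ Some (Some i) * fps_const (v $ i)) =
     - (\<Sum>i\<in>UNIV. A $ Some (Some i) $ Some None * fps_const (v $ i))"
    by (subst assms) (simp add: sum_negf)
  finally show ?thesis by simp
qed

definition kirillov :: "(real \<Rightarrow> real \<Rightarrow> real ^ 'm) \<Rightarrow> real \<Rightarrow> real \<Rightarrow> real fps" where
  "kirillov \<kappa> t x = trace (R_mat \<kappa> t x ** mcomm (mat_dt (R_mat \<kappa>) t x) (mderiv (R_mat \<kappa> t x)))"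

context curvature_family begin

lemma has_mat_dx:
  assumes "t \<in> T"
  shows "has_mat_derivative (\<lambda>x. R_mat \<kappa> t x) (mat_dx (R_mat \<kappa>) t x) x"
  using has_fps_dx[OF smooth_R_mat assms] by (simp add: has_mat_derivative_def mat_dx_def)

lemma has_mat_dt:
  assumes "t \<in> T"
  shows "has_mat_derivative (\<lambda>s. R_mat \<kappa> s x) (mat_dt (R_mat \<kappa>) t x) t"
  using has_fps_dt[OF smooth_R_mat assms] by (simp add: has_mat_derivative_def mat_dt_def)

text \<open>The Riccati system is the linear equation \<epsilon> b_x = - V b for a moving plane,
  written in normalized spanning vectors. The corrections by multiples of \<open>rho0\<close> and
  \<open>rho1\<close> restore the normalization of the first two coordinates.\<close>

lemma X_dx_rho:
  assumes t: "t \<in> T"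
  shows "\<exists>d. has_fps_derivative (\<lambda>x. rho0 \<kappa> t x $ p) d x \<and> fps_X * d = rho1 \<kappa> t x $ p - (V_mat \<kappa> t x *v rho0 \<kappa> t x) $ p -
      fps_X * dotf (curv \<kappa>) (h_ser \<kappa>) t x * rho0 \<kappa> t x $ p" (is "\<exists>d. ?P d p")
    "\<exists>d. has_fps_derivative (\<lambda>x. rho1 \<kappa> t x $ p) d x \<and> fps_X * d = - (V_mat \<kappa> t x *v rho1 \<kappa> t x) $ p -
      (1 + fps_X * dotf (curv \<kappa>) (z_ser \<kappa>) t x) * rho0 \<kappa> t x $ p" (is "\<exists>d. ?Q d p")
proof -
  have N: "?P 0 None" "?Q 0 None" "?P 0 (Some None)" "?Q 0 (Some None)"
    by (simp_all add: V_mat_vec has_fps_derivative_const dotf_def algebra_simps)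
  have S: "?P (fps_dx (h_ser \<kappa> i) t x) (Some (Some i))" "?Q (fps_dx (z_ser \<kappa> i) t x) (Some (Some i))" for i
    by (simp_all add: V_mat_vec has_fps_dx[OF smooth_h_ser t] has_fps_dx[OF smooth_z_ser t] X_dx_h[OF t] X_dx_z[OF t]
        algebra_simps)
  consider "p = None" | "p = Some None" | i where "p = Some (Some i)" by (metis option.exhaust)
  then show "\<exists>d. ?P d p" "\<exists>d. ?Q d p" using N S by (cases; blast)+
qed

text \<open>In the wedge of \<open>rho0\<close> and \<open>rho1\<close>, a change of one vector by a
  multiple of the other has no effect. The only remaining correction, the rescaling of
  \<open>rho0\<close> by -(k.h), is cancelled by \<open>dx_Y\<close>; skewness of V then turns the
  transposed terms into right multiplication by V.\<close>

lemma R_mat_lax: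
  assumes t: "t \<in> T"
  shows "mscale fps_X (mat_dx (R_mat \<kappa>) t x) = mcomm (R_mat \<kappa> t x) (V_mat \<kappa> t x)"
proof -
  define Y b c V where "Y = Y_ser \<kappa> t x" and "b = rho0 \<kappa> t x" and "c = rho1 \<kappa> t x" and "V = V_mat \<kappa> t x"
  define kh kz where "kh = dotf (curv \<kappa>) (h_ser \<kappa>) t x" and "kz = dotf (curv \<kappa>) (z_ser \<kappa>) t x"
  obtain db where db: "\<And>p. has_fps_derivative (\<lambda>x. rho0 \<kappa> t x $ p) (db p) x"
      "\<And>p. fps_X * db p = c $ p - (V *v b) $ p - fps_X * kh * b $ p"
    using X_dx_rho(1)[OF t, of _ x] unfolding b_def c_def V_def kh_def by metis
  obtain dc where dc: "\<And>p. has_fps_derivative (\<lambda>x. rho1 \<kappa> t x $ p) (dc p) x"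
      "\<And>p. fps_X * dc p = - (V *v c) $ p - (1 + fps_X * kz) * b $ p"
    using X_dx_rho(2)[OF t, of _ x] unfolding b_def c_def V_def kz_def by metis
  have e: "mat_dx (R_mat \<kappa>) t x $ p $ q = Y * kh * (c $ p * b $ q - b $ p * c $ q) +
      Y * ((dc p * b $ q + c $ p * db q) - (db p * c $ q + b $ p * dc q))" for p q
  proof -
    have "has_fps_derivative (\<lambda>x. Y_ser \<kappa> t x * (rho1 \<kappa> t x $ p * rho0 \<kappa> t x $ q - rho0 \<kappa> t x $ p * rho1 \<kappa> t x $ q))
      (fps_dx (Y_ser \<kappa>) t x * (c $ p * b $ q - b $ p * c $ q) +
      Y * ((dc p * b $ q + c $ p * db q) - (db p * c $ q + b $ p * dc q))) x"
      unfolding Y_def b_def c_def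
      by (intro has_fps_derivative_mult has_fps_derivative_diff has_fps_dx[OF smooth_Y_ser t]
          db(1)[unfolded b_def] dc(1)[unfolded c_def])
    then show ?thesis
      unfolding mat_dx_def dx_Y[OF t] by (simp add: fps_dx_eqI R_mat_def wedge_def Y_def kh_def)
  qed
  have "fps_X * mat_dx (R_mat \<kappa>) t x $ p $ q = fps_X * kh * Y * (c $ p * b $ q - b $ p * c $ q) +
      Y * (((fps_X * dc p) * b $ q + c $ p * (fps_X * db q)) - ((fps_X * db p) * c $ q + b $ p * (fps_X * dc q)))" for p q
    unfolding e by (simp add: algebra_simps)
  then have 1: "fps_X * mat_dx (R_mat \<kappa>) t x $ p $ q =
      Y * (- (c $ p * (V *v b) $ q) + b $ p * (V *v c) $ q) - Y * ((V *v c) $ p * b $ q - (V *v b) $ p * c $ q)" for p q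
    unfolding db(2) dc(2) by (simp add: algebra_simps)
  have "mcomm (R_mat \<kappa> t x) V $ p $ q = Y * (- (c $ p * (V *v b) $ q) + b $ p * (V *v c) $ q) -
      Y * ((V *v c) $ p * b $ q - (V *v b) $ p * c $ q)" for p q
    using skew_vector_mult[OF V_mat_skew, of _ \<kappa> t x]
    by (simp add: mcomm_def R_mat_def wedge_mult mult_wedge Y_def b_def c_def V_def)
  then show ?thesis by (simp add: vec_eq_iff mscale_def 1 V_def)
qed

lemma R_mat_dt_lax:
  assumes t: "t \<in> T"
  shows "mscale fps_X (mat_dx (mat_dt (R_mat \<kappa>)) t x) =
    mcomm (mat_dt (R_mat \<kappa>) t x) (V_mat \<kappa> t x) + mscale fps_X (mcomm (R_mat \<kappa> t x) (fmat (Psi (velocity \<kappa> t x))))"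
proof -
  have "has_mat_derivative (\<lambda>s. mat_dx (R_mat \<kappa>) s x) (mat_dt (mat_dx (R_mat \<kappa>)) t x) t"
    using has_fps_dt[OF smooth_fps_dx[OF T smooth_R_mat] t] by (simp add: has_mat_derivative_def mat_dt_def mat_dx_def)
  also have "mat_dt (mat_dx (R_mat \<kappa>)) t x = mat_dx (mat_dt (R_mat \<kappa>)) t x"
    using fps_dt_dx[OF T smooth_R_mat t] by (simp add: mat_dt_def mat_dx_def vec_eq_iff)
  finally have "has_mat_derivative (\<lambda>s. mscale fps_X (mat_dx (R_mat \<kappa>) s x)) (mscale fps_X (mat_dx (mat_dt (R_mat \<kappa>)) t x)) t"
    by (rule has_mat_derivative_mscale)
  then have 1: "has_mat_derivative (\<lambda>s. mcomm (R_mat \<kappa> s x) (V_mat \<kappa> s x)) (mscale fps_X (mat_dx (mat_dt (R_mat \<kappa>)) t x)) t"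
    by (rule has_mat_derivative_transform[OF _ T t]) (rule R_mat_lax)
  have "has_mat_derivative (\<lambda>s. V_mat \<kappa> s x) (0 + mscale fps_X (fmat (Psi (velocity \<kappa> t x)))) t"
    unfolding V_mat_def
    by (intro has_mat_derivative_add has_mat_derivative_const has_mat_derivative_mscale has_mat_derivative_fmat
        has_vector_derivative_Psi smooth_family_has_velocity[OF \<kappa> t])
  from has_mat_derivative_mcomm[OF has_mat_dt[OF t] this]
  show ?thesis using has_mat_derivative_unique[OF 1] by (simp add: mcomm_linear)
qed

text \<open>The variable \<epsilon> occurs explicitly in the Lax equation, in front of R_x and of u.
  Differentiating these two factors gives the inhomogeneous terms R_x and [R, u].\<close>

lemma R_mat_deriv_lax:
  assumes t: "t \<in> T"
  shows "mscale fps_X (mderiv (mat_dx (R_mat \<kappa>) t x)) + mat_dx (R_mat \<kappa>) t x =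
    mcomm (mderiv (R_mat \<kappa> t x)) (V_mat \<kappa> t x) + mcomm (R_mat \<kappa> t x) (fmat (Psi (\<kappa> t x)))"
  using arg_cong[OF R_mat_lax[OF t, of x], of mderiv]
  by (simp add: mderiv_simps mderiv_mcomm V_mat_def add.commute)

lemma mat_dt_R_mat_skew:
  assumes t: "t \<in> T"
  shows "mat_dt (R_mat \<kappa>) t x $ p $ q = - (mat_dt (R_mat \<kappa>) t x $ q $ p)"
proof -
  have "has_fps_derivative (\<lambda>s. - (R_mat \<kappa> s x $ q $ p)) (- (mat_dt (R_mat \<kappa>) t x $ q $ p)) t"
    using has_mat_dt[OF t] by (simp add: has_mat_derivative_def has_fps_derivative_minus)
  moreover have "(\<lambda>s. - (R_mat \<kappa> s x $ q $ p)) = (\<lambda>s. R_mat \<kappa> s x $ p $ q)"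
    by (intro ext) (rule R_mat_skew[symmetric])
  ultimately show ?thesis
    using has_mat_dt[OF t] unfolding has_mat_derivative_def by (metis has_fps_derivative_unique)
qed

text \<open>The equation R^3 = -R has constant coefficients, so any derivation applied to R gives a
  solution of the linearized equation; the \<epsilon>-derivative is handled in the same way in
  \<open>mderiv_R_mat_orbit\<close>.\<close>

lemma mat_dt_R_mat_orbit:
  fixes x :: real
  assumes t: "t \<in> T"
  defines "R \<equiv> R_mat \<kappa> t x"
  shows "mcomm R (mcomm R (mat_dt (R_mat \<kappa>) t x)) = - mat_dt (R_mat \<kappa>) t x"
proof -
  let ?D = "mat_dt (R_mat \<kappa>) t x"
  have "has_mat_derivative (\<lambda>s. R_mat \<kappa> s x ** R_mat \<kappa> s x ** R_mat \<kappa> s x)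
      ((?D ** R + R ** ?D) ** R + (R ** R) ** ?D) t"
    unfolding R_def by (intro has_mat_derivative_mult has_mat_dt t)
  then have "has_mat_derivative (\<lambda>s. - R_mat \<kappa> s x) ((?D ** R + R ** ?D) ** R + (R ** R) ** ?D) t"
    by (simp only: R_mat_cube)
  then have "(?D ** R + R ** ?D) ** R + (R ** R) ** ?D = - ?D"
    by (rule has_mat_derivative_unique) (rule has_mat_derivative_minus[OF has_mat_dt[OF t]])
  then have D: "?D ** R ** R + R ** ?D ** R + R ** R ** ?D = - ?D" by (simp only: matrix_ring)
  show ?thesis
    unfolding R_def R_mat_def[of \<kappa> t x]
    by (rule wedge_orbit_tangent)
      (rule mat_dt_R_mat_skew[OF t], rule R_mat_cube[unfolded R_mat_def], rule D[unfolded R_def R_mat_def[of \<kappa> t x]])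
qed

end

lemma mderiv_R_mat_skew: "mderiv (R_mat \<kappa> t x) $ p $ q = - (mderiv (R_mat \<kappa> t x) $ q $ p)"
  using arg_cong[OF R_mat_skew[of \<kappa> t x p q], of fps_deriv] by (simp add: mderiv_def)

lemma mderiv_R_mat_orbit:
  "mcomm (R_mat \<kappa> t x) (mcomm (R_mat \<kappa> t x) (mderiv (R_mat \<kappa> t x))) = - mderiv (R_mat \<kappa> t x)"
proof -
  let ?R = "R_mat \<kappa> t x" and ?D = "mderiv (R_mat \<kappa> t x)"
  have D: "?D ** ?R ** ?R + ?R ** ?D ** ?R + ?R ** ?R ** ?D = - ?D"
    using arg_cong[OF R_mat_cube[of \<kappa> t x], of mderiv] by (simp only: mderiv_simps matrix_ring)
  show ?thesis
    unfolding R_mat_def[of \<kappa> t x]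
    by (rule wedge_orbit_tangent)
      (rule mderiv_R_mat_skew[unfolded R_mat_def], rule R_mat_cube[unfolded R_mat_def], rule D[unfolded R_mat_def[of \<kappa> t x]])
qed

context curvature_family begin

lemma smooth_mat_mult:
  assumes "\<And>p q. smooth_fps_family L T (\<lambda>t x. F t x $ p $ q)" "\<And>p q. smooth_fps_family L T (\<lambda>t x. G t x $ p $ q)"
  shows "smooth_fps_family L T (\<lambda>t x. (F t x ** G t x) $ p $ q)"
  unfolding matrix_matrix_mult_def by (simp add: smooth_fps_sum smooth_fps_mult T assms)

lemma smooth_kirillov: "smooth_fps_family L T (kirillov \<kappa>)"
proof -
  have "smooth_fps_family L T (\<lambda>t x. mat_dt (R_mat \<kappa>) t x $ p $ q)" for p q
    using smooth_fps_dt[OF T smooth_R_mat] by (simp add: mat_dt_def)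
  moreover have "smooth_fps_family L T (\<lambda>t x. mderiv (R_mat \<kappa> t x) $ p $ q)" for p q
    using smooth_fps_fps_deriv[OF T smooth_R_mat] by (simp add: mderiv_def)
  ultimately have "smooth_fps_family L T (\<lambda>t x. (mcomm (mat_dt (R_mat \<kappa>) t x) (mderiv (R_mat \<kappa> t x))) $ p $ q)" for p q
    unfolding mcomm_def vector_minus_component by (intro smooth_fps_diff smooth_mat_mult T)
  then show ?thesis
    unfolding kirillov_def[abs_def] trace_def by (intro smooth_fps_sum smooth_mat_mult smooth_R_mat T)
qed

lemma kirillov_dx:
  assumes t: "t \<in> T"
  shows "fps_X * fps_X * fps_dx (kirillov \<kappa>) t x =
    2 * (fps_X * fps_X * (\<Sum>i\<in>UNIV. fps_deriv (Y_ser \<kappa> t x * z_ser \<kappa> i t x) * fps_const (velocity \<kappa> t x $ i)))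
      + 2 * fps_dt (Y_ser \<kappa>) t x"
proof -
  let ?R = "R_mat \<kappa> t x" and ?S = "mat_dt (R_mat \<kappa>) t x" and ?E = "mderiv (R_mat \<kappa> t x)"
  have S': "has_mat_derivative (\<lambda>x. mat_dt (R_mat \<kappa>) t x) (mat_dx (mat_dt (R_mat \<kappa>)) t x) x"
    using has_fps_dx[OF smooth_fps_dt[OF T smooth_R_mat] t] by (simp add: has_mat_derivative_def mat_dx_def mat_dt_def)
  have "has_fps_derivative (kirillov \<kappa> t)
      (trace (mat_dx (R_mat \<kappa>) t x ** mcomm ?S ?E + ?R ** (mcomm (mat_dx (mat_dt (R_mat \<kappa>)) t x) ?E + mcomm ?S (mderiv (mat_dx (R_mat \<kappa>) t x))))) x"
    unfolding kirillov_def[abs_def]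
    by (intro has_mat_derivative_trace has_mat_derivative_mult has_mat_derivative_mcomm has_mat_dx t S' has_mat_derivative_mderiv)
  then have *: "fps_dx (kirillov \<kappa>) t x = trace (mat_dx (R_mat \<kappa>) t x ** mcomm ?S ?E) +
      trace (?R ** (mcomm (mat_dx (mat_dt (R_mat \<kappa>)) t x) ?E + mcomm ?S (mderiv (mat_dx (R_mat \<kappa>) t x))))"
    unfolding trace_add[symmetric] by (rule fps_dx_eqI)
  have "fps_X * fps_X * fps_dx (kirillov \<kappa>) t x =
      - (fps_X * fps_X * trace (?E ** fmat (Psi (velocity \<kappa> t x)))) - trace (?S ** fmat mat_a)"
    unfolding * by (rule trace_kirillov_derivative[OF R_mat_lax[OF t] R_mat_dt_lax[OF t] R_mat_deriv_lax[OF t]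
        V_mat_def mat_dt_R_mat_orbit[OF t] mderiv_R_mat_orbit])
  also have "trace (?S ** fmat mat_a) = - 2 * fps_dt (Y_ser \<kappa>) t x"
    unfolding trace_mult_a[OF mat_dt_R_mat_skew[OF t]] by (simp add: mat_dt_def)
  also have "trace (?E ** fmat (Psi (velocity \<kappa> t x))) =
      - 2 * (\<Sum>i\<in>UNIV. fps_deriv (Y_ser \<kappa> t x * z_ser \<kappa> i t x) * fps_const (velocity \<kappa> t x $ i))"
    unfolding trace_mult_Psi[OF mderiv_R_mat_skew] by (simp add: mderiv_def)
  finally show ?thesis by (simp add: algebra_simps)
qed

text \<open>The coefficient of index n + 2 in \<open>kirillov_dx\<close>. The index n + 2 of Y
  belongs to y at index n + 1, the index n + 1 of Y \<zeta> to z at index n; the factor n + 1 is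
  created by the \<epsilon>-derivative. Up to an exact x-derivative this is already the gradient
  formula.\<close>

lemma velocity_Y_coeff:
  assumes t: "t \<in> T"
  shows "velocity (\<lambda>t x. fps_nth (Y_ser \<kappa> t x) (n + 2)) t x = (1/2) * dx (\<lambda>t x. fps_nth (kirillov \<kappa> t x) n) t x -
    real (n + 1) * (\<Sum>i\<in>UNIV. fps_nth (Y_ser \<kappa> t x * z_ser \<kappa> i t x) (n + 1) * velocity \<kappa> t x $ i)"
proof -
  have nth2: "fps_nth (fps_X * fps_X * F) (n + 2) = fps_nth F n" for F :: "real fps"
    unfolding mult.assoc fps_X_mult_nth by simp
  have two: "fps_nth (2 * F) m = 2 * fps_nth F m" for F :: "real fps" and m
    unfolding mult_2 by simp
  have W: "fps_nth (\<Sum>i\<in>UNIV. fps_deriv (Y_ser \<kappa> t x * z_ser \<kappa> i t x) * fps_const (velocity \<kappa> t x $ i)) n =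
      real (n + 1) * (\<Sum>i\<in>UNIV. fps_nth (Y_ser \<kappa> t x * z_ser \<kappa> i t x) (n + 1) * velocity \<kappa> t x $ i)"
    unfolding fps_sum_nth fps_mult_right_const_nth fps_deriv_nth sum_distrib_left
    by (simp only: mult.assoc of_nat_add of_nat_1 of_nat_Suc)
  have "dx (\<lambda>t x. fps_nth (kirillov \<kappa> t x) n) t x =
      2 * (real (n + 1) * (\<Sum>i\<in>UNIV. fps_nth (Y_ser \<kappa> t x * z_ser \<kappa> i t x) (n + 1) * velocity \<kappa> t x $ i))
      + 2 * velocity (\<lambda>t x. fps_nth (Y_ser \<kappa> t x) (n + 2)) t x"
    using arg_cong[OF kirillov_dx[OF t], of "\<lambda>F. fps_nth F (n + 2)" x]
    unfolding fps_add_nth two nth2 W fps_dx_def fps_dt_def fps_nth_Abs_fps .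
  then show ?thesis by linarith
qed

lemma integral_periodic_derivative:
  assumes "L > 0" "t \<in> T" "smooth_family L T f"
  shows "(dx f t has_integral (0 :: real)) {0..L}"
proof -
  have "(dx f t has_integral f t L - f t 0) {0..L}"
    by (rule fundamental_theorem_of_calculus)
      (use assms in \<open>auto intro: has_vector_derivative_at_within smooth_family_has_dx\<close>)
  also have "f t L = f t 0" using smooth_family_periodic[OF assms(3,2), of 0] by simp
  finally show ?thesis by simp
qed

end

lemma smooth_family_continuous_slice:
  fixes f :: "real \<Rightarrow> real \<Rightarrow> 'a::real_normed_vector"
  assumes "smooth_family L T f" "t \<in> T"
  shows "continuous_on S (f t)"
  by (intro continuous_at_imp_continuous_on ballI has_vector_derivative_continuous[OF smooth_family_has_dx[OF assms]])

lemma smooth_family_continuous: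
  fixes f :: "real \<Rightarrow> real \<Rightarrow> 'a::real_normed_vector"
  assumes "smooth_family L T f"
  shows "continuous_on (T \<times> UNIV) (\<lambda>(t, x). f t x)"
  using assms unfolding smooth_family_def by blast

lemma smooth_family_integral_derivative:
  fixes f :: "real \<Rightarrow> real \<Rightarrow> real"
  assumes T: "open T" and f: "smooth_family L T f" and t: "t \<in> T"
  shows "((\<lambda>s. integral {0..L} (f s)) has_real_derivative integral {0..L} (velocity f t)) (at t)"
proof -
  \<comment> \<open>Differentiation under the integral is available over a convex parameter set,
    whereas T is merely open.\<close>
  obtain e where e: "e > 0" "ball t e \<subseteq> T" using T t openE by blast
  have "((\<lambda>s. integral (cbox 0 L) (f s)) has_field_derivative integral (cbox 0 L) (velocity f t)) (at t within ball t e)"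
  proof (rule leibniz_rule_field_derivative)
    show "((\<lambda>s. f s x) has_field_derivative velocity f s x) (at s within ball t e)" if "s \<in> ball t e" for s x
    proof -
      have "s \<in> T" using that e by blast
      then show ?thesis
        unfolding has_real_derivative_iff_has_vector_derivative
        by (intro has_vector_derivative_at_within[OF smooth_family_has_velocity[OF f]])
    qed
    show "f s integrable_on cbox 0 L" if "s \<in> ball t e" for s
    proof -
      have "s \<in> T" using that e by blast
      then show ?thesis by (intro integrable_continuous smooth_family_continuous_slice[OF f])
    qed
    show "continuous_on (ball t e \<times> cbox 0 L) (\<lambda>(s, x). velocity f s x)"
      by (rule continuous_on_subset[OF smooth_family_continuous[OF smooth_family_velocity[OF T f]]])
        (use e in blast)
    show "t \<in> ball t e" "convex (ball t e)" using e by simp_all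
  qed
  moreover have "at t within ball t e = at t" using e by (intro at_within_open) simp_all
  ultimately show ?thesis by simp
qed

lemma (in curvature_family) integral_Y_derivative:
  assumes L: "L > 0" and t: "t \<in> T"
  shows "((\<lambda>s. integral {0..L} (\<lambda>x. fps_nth (Y_ser \<kappa> s x) (n + 2))) has_real_derivative
    - real (n + 1) * integral {0..L} (\<lambda>x. \<Sum>i\<in>UNIV. fps_nth (Y_ser \<kappa> t x * z_ser \<kappa> i t x) (n + 1) * velocity \<kappa> t x $ i)) (at t)"
proof -
  let ?Y = "\<lambda>s x. fps_nth (Y_ser \<kappa> s x) (n + 2)"
  let ?w = "\<lambda>x. \<Sum>i\<in>UNIV. fps_nth (Y_ser \<kappa> t x * z_ser \<kappa> i t x) (n + 1) * velocity \<kappa> t x $ i"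
  have Y: "smooth_family L T ?Y" using smooth_Y_ser by (simp only: smooth_fps_family_def)
  have K: "smooth_family L T (\<lambda>t x. fps_nth (kirillov \<kappa> t x) n)" using smooth_kirillov by (simp only: smooth_fps_family_def)
  have "smooth_family L T (\<lambda>t x. fps_nth (Y_ser \<kappa> t x * z_ser \<kappa> i t x) (n + 1) * velocity \<kappa> t x $ i)" for i
    using smooth_fps_mult[OF T smooth_Y_ser smooth_z_ser] smooth_family_velocity[OF T \<kappa>]
    by (intro smooth_family_mult T) (simp_all only: smooth_fps_family_def smooth_family_vec[OF T])
  then have w: "smooth_family L T (\<lambda>t x. \<Sum>i\<in>UNIV. fps_nth (Y_ser \<kappa> t x * z_ser \<kappa> i t x) (n + 1) * velocity \<kappa> t x $ i)"
    by (intro smooth_family_sum T)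
  have "?w integrable_on {0..L}"
    using smooth_family_continuous_slice[OF w t] by (rule integrable_continuous_real)
  then have "((\<lambda>x. (1/2) * dx (\<lambda>t x. fps_nth (kirillov \<kappa> t x) n) t x - real (n + 1) * ?w x) has_integral
      (1/2) * 0 - real (n + 1) * integral {0..L} ?w) {0..L}"
    by (intro has_integral_diff has_integral_mult_right integral_periodic_derivative L t K integrable_integral)
  then have "(velocity ?Y t has_integral (1/2) * 0 - real (n + 1) * integral {0..L} ?w) {0..L}"
    by (subst (asm) velocity_Y_coeff[OF t, symmetric])
  then have "integral {0..L} (velocity ?Y t) = - real (n + 1) * integral {0..L} ?w"
    by (simp only: integral_unique mult_zero_right diff_0 mult_minus_left)
  then show ?thesis using smooth_family_integral_derivative[OF T Y t] by simp
qed

subsection \<open>Existence and uniqueness of \<open>Q\<close>\<close>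

lemma mcoeff_linear:
  "mcoeff m (A + B) = mcoeff m A + mcoeff m B" "mcoeff m (A - B) = mcoeff m A - mcoeff m B"
  "mcoeff m (- A) = - mcoeff m A"
  by (simp_all add: mcoeff_def vec_eq_iff)

lemma fls_nth_sum: "fls_nth (\<Sum>i\<in>I. f i) n = (\<Sum>i\<in>I. fls_nth (f i) n)"
  by (induction I rule: infinite_finite_induct) auto

lemma mcoeff_mult_mconst:
  "mcoeff m (A ** mconst B) = mcoeff m A ** B" "mcoeff m (mconst B ** A) = B ** mcoeff m A"
  by (simp_all add: mcoeff_def mconst_def vec_eq_iff matrix_matrix_mult_def fls_nth_sum)

lemma a_lam_altdef: "a_lam = mscale fls_X_inv (mconst mat_a)"
  by (simp add: a_lam_def mscale_def)

lemma mcoeff_mscale_lam: "mcoeff m (mscale fls_X_inv A) = mcoeff (m + 1) A"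
  by (simp add: mcoeff_def mscale_def vec_eq_iff fls_X_inv_times_conv_shift)

lemma mcoeff_lax:
  "mcoeff m (Q ** (a_lam + mconst U) - (a_lam + mconst U) ** Q) =
    mcomm (mcoeff (m + 1) Q) mat_a + mcomm (mcoeff m Q) U"
  by (simp add: a_lam_altdef matrix_ring mscale_simps mcoeff_linear mcoeff_mult_mconst mcoeff_mscale_lam mcomm_def)

text \<open>Shifting p and q to index 0 makes both factors power series, whose constant coefficients
  multiply.\<close>

lemma fls_times_nth_lowest:
  fixes f g :: "'a::{comm_semiring_0} fls"
  assumes f: "\<And>i. i < p \<Longrightarrow> fls_nth f i = 0" and g: "\<And>i. i < q \<Longrightarrow> fls_nth g i = 0"
  shows "fls_nth (f * g) (p + q) = fls_nth f p * fls_nth g q" "n < p + q \<Longrightarrow> fls_nth (f * g) n = 0"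
proof -
  define F G where "F = fls_regpart (fls_shift p f)" and "G = fls_regpart (fls_shift q g)"
  have "fls_shift p f = fps_to_fls F" "fls_shift q g = fps_to_fls G"
    using f g by (auto simp: F_def G_def fls_eq_iff)
  then have *: "fls_shift (p + q) (f * g) = fps_to_fls (F * G)"
    by (simp add: fls_times_fps_to_fls flip: fls_times_both_shifted_simp)
  have "fls_nth (f * g) n = fls_nth (fls_shift (p + q) (f * g)) (n - (p + q))" for n by simp
  note e = this[unfolded *]
  show "fls_nth (f * g) (p + q) = fls_nth f p * fls_nth g q"
    unfolding e by (simp add: F_def G_def)
  show "fls_nth (f * g) n = 0" if "n < p + q" for n
    unfolding e using that by simp
qed

lemma mcoeff_mult_lowest:
  fixes A B :: "real fls ^ 'p ^ 'p"
  assumes A: "\<And>i. i < p \<Longrightarrow> mcoeff i A = 0" and B: "\<And>i. i < q \<Longrightarrow> mcoeff i B = 0"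
  shows "mcoeff (p + q) (A ** B) = mcoeff p A ** mcoeff q B" "n < p + q \<Longrightarrow> mcoeff n (A ** B) = 0"
proof -
  have A': "fls_nth (A $ u $ v) i = 0" if "i < p" for i u v
    using arg_cong[OF A[OF that], of "\<lambda>M. M $ u $ v"] by (simp add: mcoeff_def)
  have B': "fls_nth (B $ u $ v) i = 0" if "i < q" for i u v
    using arg_cong[OF B[OF that], of "\<lambda>M. M $ u $ v"] by (simp add: mcoeff_def)
  note * = fls_times_nth_lowest[of p "A $ _ $ _" q "B $ _ $ _", OF A' B']
  show "mcoeff (p + q) (A ** B) = mcoeff p A ** mcoeff q B"
    by (simp add: mcoeff_def vec_eq_iff matrix_matrix_mult_def fls_nth_sum *)
  show "n < p + q \<Longrightarrow> mcoeff n (A ** B) = 0"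
    by (simp add: mcoeff_def vec_eq_iff matrix_matrix_mult_def fls_nth_sum *)
qed

lemma mat_a_cube: "mat_a ** mat_a ** mat_a = - (mat_a :: real ^ ('m::finite) option option ^ 'm option option)"
proof -
  have "(mat_a ** mat_a ** mat_a) $ p $ q = - (mat_a $ p $ q)" for p q :: "'m option option"
    by (cases p; cases q; (cases "the p")?; (cases "the q")?) (simp_all add: matrix_matrix_mult_def sum_option)
  then show ?thesis by (simp add: vec_eq_iff)
qed

lemma mconst_mult: "mconst A ** mconst B = mconst (A ** B)"
  and mconst_minus: "mconst (- A) = - mconst A"
  by (simp_all add: mconst_def vec_eq_iff matrix_matrix_mult_def fls_eq_iff fls_nth_sum)

lemma matrix_inv_inverse:
  "invertible P \<Longrightarrow> P ** matrix_inv P = mat 1 \<and> matrix_inv P ** P = mat 1"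
  unfolding invertible_def matrix_inv_def by (rule someI_ex)

text \<open>The polynomial trace of conjugacy: a^3 = -a becomes Q^3 = -\<lambda>^2 Q. In this form
  the conjugacy clause enters the uniqueness of Q.\<close>

lemma conjugate_cube:
  fixes P Q :: "real fls ^ ('m::finite) option option ^ 'm option option"
  assumes "invertible P" and Q: "Q = P ** a_lam ** matrix_inv P"
  shows "Q ** Q ** Q = - mscale (fls_X_inv * fls_X_inv) Q"
proof -
  have P: "matrix_inv P ** P = mat 1" using assms(1) by (simp add: matrix_inv_inverse)
  have c: "Y ** matrix_inv P ** P = Y" for Y by (simp add: P flip: matrix_mul_assoc)
  have "Q ** Q ** Q = P ** (a_lam ** a_lam ** a_lam) ** matrix_inv P"
    unfolding Q by (simp add: matrix_mul_assoc c)
  also have "a_lam ** a_lam ** a_lam = - mscale (fls_X_inv * fls_X_inv) (a_lam :: real fls ^ 'm option option ^ 'm option option)"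
    unfolding a_lam_altdef mscale_simps mconst_mult mat_a_cube mconst_minus by (simp add: ac_simps)
  finally show ?thesis unfolding Q by (simp add: matrix_ring mscale_simps)
qed

lemma is_Q_seriesD:
  assumes "is_Q_series k Q"
  shows "m < -1 \<Longrightarrow> mcoeff m (Q x) = 0" "mcoeff (-1) (Q x) = mat_a"
    "m \<ge> 0 \<Longrightarrow> odd m \<Longrightarrow> \<exists>y \<eta>. mcoeff m (Q x) = odd_block y \<eta>"
    "m \<ge> 0 \<Longrightarrow> even m \<Longrightarrow> \<exists>z \<xi>. skew \<xi> \<and> mcoeff m (Q x) = even_block z \<xi>"
    "((\<lambda>x. mcoeff m (Q x)) has_vector_derivative
        mcomm (mcoeff (m + 1) (Q x)) mat_a + mcomm (mcoeff m (Q x)) (Psi (k x))) (at x)"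
    "Q x ** Q x ** Q x = - mscale (fls_X_inv * fls_X_inv) (Q x)"
  using assms unfolding is_Q_series_def mcoeff_lax by (blast intro: conjugate_cube)+

text \<open>If D commutes with a, the linearized cubic equation reads 3 a^2 D = -D, while a^2 is -1
  on the first two coordinates and 0 on the others. This kills y and \<xi>; commutation itself kills
  the mixed entries \<eta> and z.\<close>

lemma no_orbit_direction:
  fixes D :: "real ^ ('m::finite) option option ^ 'm option option"
  assumes comm: "mcomm D mat_a = 0" and cube: "mat_a ** mat_a ** D + mat_a ** D ** mat_a + D ** mat_a ** mat_a = - D"
    and shape: "(\<exists>y \<eta>. D = odd_block y \<eta>) \<or> (\<exists>z \<xi>. D = even_block z \<xi>)"
  shows "D = 0"
proof -
  have aD: "D ** mat_a = mat_a ** D" using comm by (simp add: mcomm_def)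
  have "mat_a ** D ** mat_a = mat_a ** mat_a ** D" "D ** mat_a ** mat_a = mat_a ** mat_a ** D"
    by (metis aD matrix_mul_assoc)+
  with cube have "mat_a ** mat_a ** D + mat_a ** mat_a ** D + mat_a ** mat_a ** D = - D" by simp
  then have 3: "3 * (mat_a ** (mat_a ** D)) $ p $ q = - (D $ p $ q)" for p q
    by (simp add: vec_eq_iff matrix_mul_assoc)
  note mult = matrix_matrix_mult_def sum_option
  from shape show ?thesis
  proof (elim disjE exE)
    fix y \<eta> assume D: "D = odd_block y \<eta>"
    have "\<eta> $ i = 0" for i
      using arg_cong[OF aD, of "\<lambda>M. M $ Some (Some i) $ Some None"] by (simp add: D mult)
    moreover have "y = 0" using 3[of "Some None" None] by (simp add: D mult)
    ultimately show ?thesis by (auto simp: D odd_block_def vec_eq_iff split: option.split)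
  next
    fix z \<xi> assume D: "D = even_block z \<xi>"
    have "z $ i = 0" for i
      using arg_cong[OF aD, of "\<lambda>M. M $ None $ Some (Some i)"] by (simp add: D mult)
    moreover have "\<xi> $ i $ l = 0" for i l
      using 3[of "Some (Some i)" "Some (Some l)"] by (simp add: D mult)
    ultimately show ?thesis by (auto simp: D even_block_def vec_eq_iff split: option.split)
  qed
qed

text \<open>The lowest coefficient in which two solutions differ commutes with \<open>a\<close> by the Lax equation and is
  tangent to the orbit of \<open>a\<close> by the cubic equation.\<close>

lemma is_Q_series_unique:
  fixes k :: "real \<Rightarrow> real ^ 'm"
  assumes Q: "is_Q_series k Q" and Q': "is_Q_series k Q'"
  shows "Q = Q'"
proof -
  note q = is_Q_seriesD[OF Q] and q' = is_Q_seriesD[OF Q']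
  have low: "mcoeff m (Q x) = mcoeff m (Q' x)" if "m < 0" for m x
  proof (cases "m < -1")
    case False
    then have "m = -1" using that by simp
    then show ?thesis by (simp add: q(2) q'(2))
  qed (simp add: q(1) q'(1))
  have "\<forall>x. mcoeff (int n) (Q x) = mcoeff (int n) (Q' x)" for n
  proof (induction n rule: less_induct)
    case (less n)
    have below: "mcoeff m (Q x) = mcoeff m (Q' x)" if "m < int n" for m x
      using low[of m x] less[of "nat m"] that by (cases "m < 0") auto
    show ?case
    proof
      fix x
      let ?D = "mcoeff (int n) (Q x) - mcoeff (int n) (Q' x)"
      \<comment> \<open>Agreement at index n - 1 for all x gives equal x-derivatives there, and the
        Lax equation at index n - 1 contains index n only through its bracket with a.\<close>
      have "(\<lambda>x. mcoeff (int n - 1) (Q x)) = (\<lambda>x. mcoeff (int n - 1) (Q' x))"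
        using below by auto
      then have "mcomm (mcoeff (int n) (Q x)) mat_a + mcomm (mcoeff (int n - 1) (Q x)) (Psi (k x)) =
          mcomm (mcoeff (int n) (Q' x)) mat_a + mcomm (mcoeff (int n - 1) (Q' x)) (Psi (k x))"
        using q(5)[of "int n - 1" x] q'(5)[of "int n - 1" x] by (simp add: vector_derivative_unique_at)
      then have comm: "mcomm ?D mat_a = 0"
        using below[of "int n - 1" x] by (simp add: mcomm_linear)
      define D where "D = Q x - Q' x"
      have D0: "mcoeff i D = 0" if "i < int n" for i using below[OF that] by (simp add: D_def mcoeff_linear)
      have Q0: "mcoeff i (Q x) = 0" "mcoeff i (Q' x) = 0" if "i < -1" for i using q(1) q'(1) that by auto
      \<comment> \<open>The difference of the cubes telescopes into terms containing D exactly once.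
        As both series start at index -1 and D at index n, the lowest index of these terms is n -
        2.\<close>
      have "Q x ** Q x ** D + Q x ** D ** Q' x + D ** Q' x ** Q' x = Q x ** Q x ** Q x - Q' x ** Q' x ** Q' x"
        by (simp add: D_def matrix_ring)
      also have "\<dots> = - mscale fls_X_inv (mscale fls_X_inv D)"
        unfolding q(6) q'(6) D_def by (simp add: mscale_simps)
      finally have "mcoeff (int n - 2) (Q x ** Q x ** D + Q x ** D ** Q' x + D ** Q' x ** Q' x) = - mcoeff (int n) D"
        by (simp add: mcoeff_linear mcoeff_mscale_lam)
      moreover have "mcoeff (-1 + -1 + int n) (Q x ** Q x ** D) = mat_a ** mat_a ** mcoeff (int n) D"
        using mcoeff_mult_lowest[of "-1" "Q x" "-1" "Q x", OF Q0(1) Q0(1)] D0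
        by (subst mcoeff_mult_lowest) (auto simp: q(2))
      moreover have "mcoeff (-1 + int n + -1) (Q x ** D ** Q' x) = mat_a ** mcoeff (int n) D ** mat_a"
        using mcoeff_mult_lowest[of "-1" "Q x" "int n" D, OF Q0(1) D0] Q0(2)
        by (subst mcoeff_mult_lowest) (auto simp: q(2) q'(2))
      moreover have "mcoeff (int n + -1 + -1) (D ** Q' x ** Q' x) = mcoeff (int n) D ** mat_a ** mat_a"
        using mcoeff_mult_lowest[of "int n" D "-1" "Q' x", OF D0 Q0(2)] Q0(2)
        by (subst mcoeff_mult_lowest) (auto simp: q'(2))
      ultimately have cube: "mat_a ** mat_a ** mcoeff (int n) D + mat_a ** mcoeff (int n) D ** mat_a + mcoeff (int n) D ** mat_a ** mat_a = - mcoeff (int n) D"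
        by (simp add: mcoeff_linear)
      have D: "mcoeff (int n) D = ?D" by (simp add: D_def mcoeff_linear)
      have shape: "(\<exists>y \<eta>. ?D = odd_block y \<eta>) \<or> (\<exists>z \<xi>. ?D = even_block z \<xi>)"
      proof (cases "even n")
        case True
        then obtain z \<xi> z' \<xi>' where "mcoeff (int n) (Q x) = even_block z \<xi>" "mcoeff (int n) (Q' x) = even_block z' \<xi>'"
          using q(4)[of "int n" x] q'(4)[of "int n" x] by auto
        then have "?D = even_block (z - z') (\<xi> - \<xi>')"
          by (auto simp: even_block_def vec_eq_iff split: option.split)
        then show ?thesis by blast
      next
        case False
        then obtain y \<eta> y' \<eta>' where "mcoeff (int n) (Q x) = odd_block y \<eta>" "mcoeff (int n) (Q' x) = odd_block y' \<eta>'"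
          using q(3)[of "int n" x] q'(3)[of "int n" x] by auto
        then have "?D = odd_block (y - y') (\<eta> - \<eta>')"
          by (auto simp: odd_block_def vec_eq_iff split: option.split)
        then show ?thesis by blast
      qed
      have "?D = 0" by (rule no_orbit_direction[OF comm cube[unfolded D] shape])
      then show "mcoeff (int n) (Q x) = mcoeff (int n) (Q' x)" by simp
    qed
  qed
  then have "mcoeff m (Q x) = mcoeff m (Q' x)" for m x
  proof (cases "m < 0")
    case False
    then have "m = int (nat m)" by simp
    then show ?thesis using \<open>\<And>n. \<forall>x. mcoeff (int n) (Q x) = mcoeff (int n) (Q' x)\<close>[of "nat m"] by simp
  qed (rule low)
  then show ?thesis
    by (intro ext) (simp add: vec_eq_iff mcoeff_def fls_eq_iff)
qed

section \<open>Existence: from R over power series to Q over Laurent series\<close>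

definition fls_mat :: "real fps ^ 'p ^ 'p \<Rightarrow> real fls ^ 'p ^ 'p" where
  "fls_mat A = (\<chi> p q. fps_to_fls (A $ p $ q))"

definition mat_nth :: "real fps ^ 'p ^ 'p \<Rightarrow> nat \<Rightarrow> real ^ 'p ^ 'p" where
  "mat_nth A n = (\<chi> p q. fps_nth (A $ p $ q) n)"

lemma fps_to_fls_sum: "fps_to_fls (\<Sum>i\<in>I. f i) = (\<Sum>i\<in>I. fps_to_fls (f i))"
  by (induction I rule: infinite_finite_induct) auto

lemma fps_to_fls_prod: "fps_to_fls (\<Prod>i\<in>I. f i :: real fps) = (\<Prod>i\<in>I. fps_to_fls (f i))"
  by (induction I rule: infinite_finite_induct) (auto simp: fls_times_fps_to_fls)

lemma fls_mat_mult: "fls_mat (A ** B) = fls_mat A ** fls_mat B"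
  by (simp add: fls_mat_def vec_eq_iff matrix_matrix_mult_def fps_to_fls_sum fls_times_fps_to_fls)

lemma fls_mat_fmat: "fls_mat (fmat A) = mconst A"
  by (simp add: fls_mat_def fmat_def mconst_def vec_eq_iff)

lemma mat_nth_0_mult: "mat_nth (A ** B) 0 = mat_nth A 0 ** mat_nth B 0"
  by (simp add: mat_nth_def vec_eq_iff matrix_matrix_mult_def fps_sum_nth)

lemma mat_nth_linear: "mat_nth (A + B) n = mat_nth A n + mat_nth B n" "mat_nth (A - B) n = mat_nth A n - mat_nth B n"
  by (simp_all add: mat_nth_def vec_eq_iff)

lemma mat_nth_fmat: "mat_nth (fmat A) 0 = A"
  by (simp add: mat_nth_def fmat_def vec_eq_iff)

lemma fmat_mult: "fmat A ** fmat B = fmat (A ** B)"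
  by (simp add: fmat_def vec_eq_iff matrix_matrix_mult_def fps_eq_iff fps_sum_nth if_distrib cong: if_cong)

text \<open>The constant coefficient of \<open>det A\<close> is the determinant of the constant
  term. Hence \<open>det A\<close> is nonzero, which is enough over the field of Laurent
  series.\<close>

lemma invertible_fls_mat:
  fixes A :: "real fps ^ 'p ^ 'p"
  assumes "invertible (mat_nth A 0)"
  shows "invertible (fls_mat A)"
proof -
  have "fps_nth (prod f I) 0 = (\<Prod>i\<in>I. fps_nth (f i) 0)" for f :: "'p \<Rightarrow> real fps" and I
    by (induction I rule: infinite_finite_induct) auto
  then have "fps_nth (det A) 0 = det (mat_nth A 0)"
    by (simp add: det_def fps_sum_nth mat_nth_def)
  then have "det A \<noteq> 0" using assms by (force simp: invertible_det_nz)
  moreover have "det (fls_mat A) = fps_to_fls (det A)"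
    by (simp add: det_def fps_to_fls_sum fls_times_fps_to_fls fps_to_fls_prod fls_mat_def)
  ultimately show ?thesis by (simp add: invertible_det_nz)
qed

text \<open>Because of the factor \<open>\<lambda>\<close>, the coefficient of \<open>\<lambda>\<^sup>-\<^sup>m\<close> in \<open>Q\<close> is the coefficient of index \<open>m + 1\<close> in \<open>R\<close>.\<close>

definition Q_mat :: "(real \<Rightarrow> real \<Rightarrow> real ^ 'm) \<Rightarrow> real \<Rightarrow> real \<Rightarrow> real fls ^ 'm option option ^ 'm option option" where
  "Q_mat \<kappa> t x = mscale fls_X_inv (fls_mat (R_mat \<kappa> t x))"

lemma mcoeff_Q_mat: "mcoeff m (Q_mat \<kappa> t x) = (if m < -1 then 0 else mat_nth (R_mat \<kappa> t x) (nat (m + 1)))"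
  unfolding Q_mat_def mcoeff_mscale_lam by (auto simp: mcoeff_def fls_mat_def mat_nth_def vec_eq_iff)

lemma mat_nth_R_mat_0: "mat_nth (R_mat \<kappa> t x) 0 = mat_a"
proof -
  have "mat_nth (R_mat \<kappa> t x) 0 $ p $ q = mat_a $ p $ q" for p q
    by (cases p; cases q; (cases "the p")?; (cases "the q")?) (simp_all add: mat_nth_def Y_ser_nth_0)
  then show ?thesis by (simp add: vec_eq_iff)
qed

text \<open>Twice the sum over the eigenvalues \<open>0, i, -i\<close> of the products of the spectral projections of \<open>R\<close>
  and of \<open>a\<close> intertwines \<open>R\<close> and \<open>a\<close>.\<close>

lemma Q_mat_conjugate:
  fixes \<kappa> :: "real \<Rightarrow> real \<Rightarrow> real ^ 'm"
  shows "\<exists>P :: real fls ^ 'm option option ^ 'm option option. invertible P \<and> Q_mat \<kappa> t x = P ** a_lam ** matrix_inv P"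
proof -
  define R a where "R = R_mat \<kappa> t x" and "a = (fmat mat_a :: real fps ^ 'm option option ^ 'm option option)"
  define S where "S = (mat 1 + R ** R) ** (mat 1 + a ** a)"
  define P where "P = S + S + (R ** R ** a ** a - R ** a)"
  have a: "a ** a ** a = - a"
    by (simp add: a_def fmat_mult mat_a_cube) (simp add: fmat_def vec_eq_iff)
  have R: "R ** R ** R = - R" by (simp add: R_def R_mat_cube)
  have a': "X ** a ** a ** a = - (X ** a)" for X :: "real fps ^ 'm option option ^ 'm option option"
    using arg_cong[OF a, of "\<lambda>Y. X ** Y"] by (simp add: matrix_ring)
  have R': "X ** R ** R ** R = - (X ** R)" for X :: "real fps ^ 'm option option ^ 'm option option"
    using arg_cong[OF R, of "\<lambda>Y. X ** Y"] by (simp add: matrix_ring)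
  have RS: "R ** S = 0" and Sa: "S ** a = 0"
    by (simp_all add: S_def matrix_ring a a' R R')
  \<comment> \<open>S drops out on both sides, and by the two cubic equations the rest is -(R a a +
    R R a) on both sides.\<close>
  have "R ** P = P ** a"
    by (simp only: P_def matrix_ring RS Sa a a' R R' add_0) simp?
  then have eq: "Q_mat \<kappa> t x ** fls_mat P = fls_mat P ** a_lam"
    by (simp add: Q_mat_def R_def a_lam_altdef mscale_simps a_def flip: fls_mat_mult fls_mat_fmat)
  have inv: "invertible (fls_mat P)"
  proof (rule invertible_fls_mat)
    let ?a = "mat_a :: real ^ 'm option option ^ 'm option option"
    have aa: "?a ** ?a ** ?a = - ?a" "X ** ?a ** ?a ** ?a = - (X ** ?a)" for X :: "real ^ 'm option option ^ 'm option option"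
      using mat_a_cube arg_cong[OF mat_a_cube, of "\<lambda>Y. X ** Y"] by (simp_all add: matrix_ring)
    have "mat_nth (mat 1 :: real fps ^ 'm option option ^ 'm option option) 0 = mat 1"
      by (simp add: mat_nth_def mat_def vec_eq_iff)
    note 1 = this
    \<comment> \<open>At \<epsilon> = 0 the matrix R becomes a. Since a^4 = -a^2, S becomes 1 + a^2
      and the last summand of P becomes -2 a^2, so P becomes 2.\<close>
    have "mat_nth P 0 = mat 1 + mat 1"
      unfolding P_def S_def mat_nth_linear mat_nth_0_mult 1 R_def a_def mat_nth_R_mat_0 mat_nth_fmat
      by (simp only: matrix_ring aa matrix_mul_lid matrix_mul_rid) (simp add: algebra_simps)
    also have "\<dots> = 2 *\<^sub>R mat 1" by (simp add: scaleR_2)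
    finally show "invertible (mat_nth P 0)"
      unfolding invertible_def
      by (intro exI[of _ "(1/2) *\<^sub>R mat 1"]) (simp add: matrix_scalar_ac)
  qed
  have "Q_mat \<kappa> t x = Q_mat \<kappa> t x ** (fls_mat P ** matrix_inv (fls_mat P))"
    using matrix_inv_inverse[OF inv] by simp
  also have "\<dots> = fls_mat P ** a_lam ** matrix_inv (fls_mat P)"
    by (simp only: matrix_mul_assoc eq)
  finally show ?thesis using inv by blast
qed

lemma skew_iff: "skew A \<longleftrightarrow> (\<forall>i j. A $ i $ j = - (A $ j $ i))"
  unfolding skew_def vec_eq_iff by (auto simp: transpose_def)

lemma mat_nth_R_mat_even:
  assumes "even n"
  shows "mat_nth (R_mat \<kappa> t x) n = odd_block (fps_nth (Y_ser \<kappa> t x) n) (\<chi> i. fps_nth (Y_ser \<kappa> t x * h_ser \<kappa> i t x) n)"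
proof -
  have "parity False (\<lambda>t x. Y_ser \<kappa> t x * z_ser \<kappa> i t x)" for i
    using parity_mult[OF parity_Y_ser parity_z_ser] by simp
  moreover have "parity False (\<lambda>t x. Y_ser \<kappa> t x * (z_ser \<kappa> i t x * h_ser \<kappa> l t x - h_ser \<kappa> i t x * z_ser \<kappa> l t x))" for i l
  proof -
    have "parity False (\<lambda>t x. z_ser \<kappa> i t x * h_ser \<kappa> l t x)" "parity False (\<lambda>t x. h_ser \<kappa> i t x * z_ser \<kappa> l t x)"
      using parity_mult[OF parity_z_ser parity_h_ser] parity_mult[OF parity_h_ser parity_z_ser] by simp_all
    from parity_mult[OF parity_Y_ser parity_diff[OF this]] show ?thesis by simp
  qed
  ultimately have "mat_nth (R_mat \<kappa> t x) n $ p $ q = odd_block (fps_nth (Y_ser \<kappa> t x) n) (\<chi> i. fps_nth (Y_ser \<kappa> t x * h_ser \<kappa> i t x) n) $ p $ q" for p q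
    using assms by (cases p; cases q; (cases "the p")?; (cases "the q")?) (simp_all add: mat_nth_def parity_def)
  then show ?thesis by (simp add: vec_eq_iff)
qed

lemma mat_nth_R_mat_odd:
  assumes "odd n"
  shows "mat_nth (R_mat \<kappa> t x) n = even_block (\<chi> i. fps_nth (Y_ser \<kappa> t x * z_ser \<kappa> i t x) n)
    (\<chi> i l. fps_nth (Y_ser \<kappa> t x * (z_ser \<kappa> i t x * h_ser \<kappa> l t x - h_ser \<kappa> i t x * z_ser \<kappa> l t x)) n)"
    (is "_ = even_block ?z ?\<xi>")
proof -
  have "parity True (\<lambda>t x. Y_ser \<kappa> t x * h_ser \<kappa> i t x)" for i
    using parity_mult[OF parity_Y_ser parity_h_ser] by simp
  then have "mat_nth (R_mat \<kappa> t x) n $ p $ q = even_block ?z ?\<xi> $ p $ q" for p q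
    using assms parity_Y_ser[of \<kappa>]
    by (cases p; cases q; (cases "the p")?; (cases "the q")?) (simp_all add: mat_nth_def parity_def)
  then show ?thesis by (simp add: vec_eq_iff)
qed

context curvature_family begin

lemma smooth_mat_nth_R_mat: "smooth_family L T (\<lambda>t x. mat_nth (R_mat \<kappa> t x) n)"
  using smooth_R_mat by (simp add: smooth_family_vec[OF T] mat_nth_def smooth_fps_family_def)

lemma mat_nth_R_mat_derivative:
  assumes t: "t \<in> T"
  shows "((\<lambda>x. mat_nth (R_mat \<kappa> t x) n) has_vector_derivative
    mcomm (mat_nth (R_mat \<kappa> t x) (Suc n)) mat_a + mcomm (mat_nth (R_mat \<kappa> t x) n) (Psi (\<kappa> t x))) (at x)"
proof -
  have "((\<lambda>x. mat_nth (R_mat \<kappa> t x) n) has_vector_derivative mat_nth (mat_dx (R_mat \<kappa>) t x) n) (at x)"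
    using has_mat_dx[OF t, of x]
    by (simp add: has_vector_derivative_vec has_mat_derivative_def has_fps_derivative_def mat_nth_def)
  also have "mat_nth (mat_dx (R_mat \<kappa>) t x) n = mat_nth (mscale fps_X (mat_dx (R_mat \<kappa>) t x)) (Suc n)"
    by (simp add: mat_nth_def mscale_def)
  also have "\<dots> = mcomm (mat_nth (R_mat \<kappa> t x) (Suc n)) mat_a + mcomm (mat_nth (R_mat \<kappa> t x) n) (Psi (\<kappa> t x))"
  proof -
    have 1: "mat_nth (A ** fmat B) n = mat_nth A n ** B" "mat_nth (fmat B ** A) n = B ** mat_nth A n"
      for A :: "real fps ^ 'm option option ^ 'm option option" and B n
      by (simp_all add: mat_nth_def fmat_def vec_eq_iff matrix_matrix_mult_def fps_sum_nth)
    have 2: "mat_nth (mscale fps_X A) (Suc n) = mat_nth A n" for A :: "real fps ^ 'm option option ^ 'm option option"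
      by (simp add: mat_nth_def mscale_def)
    show ?thesis
      unfolding R_mat_lax[OF t] V_mat_def mcomm_def
      by (simp add: matrix_ring mscale_simps mat_nth_linear 1 2)
  qed
  finally show ?thesis .
qed

lemma Q_mat_is_Q_series:
  assumes t: "t \<in> T"
  shows "is_Q_series (\<kappa> t) (Q_mat \<kappa> t)"
  unfolding is_Q_series_def mcoeff_lax
proof (intro conjI allI impI)
  show "mcoeff m (Q_mat \<kappa> t x) = 0" if "m < -1" for m x using that by (simp add: mcoeff_Q_mat)
  show "mcoeff (-1) (Q_mat \<kappa> t x) = mat_a" for x by (simp add: mcoeff_Q_mat mat_nth_R_mat_0)
  show "\<exists>y \<eta>. mcoeff m (Q_mat \<kappa> t x) = odd_block y \<eta>" if "m \<ge> 0" "odd m" for m x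
    using that mat_nth_R_mat_even[of "nat (m + 1)" \<kappa> t x] by (auto simp: mcoeff_Q_mat even_nat_iff)
  show "\<exists>z \<xi>. skew \<xi> \<and> mcoeff m (Q_mat \<kappa> t x) = even_block z \<xi>" if "m \<ge> 0" "even m" for m x
  proof -
    have "skew (\<chi> i l. fps_nth (Y_ser \<kappa> t x * (z_ser \<kappa> i t x * h_ser \<kappa> l t x - h_ser \<kappa> i t x * z_ser \<kappa> l t x)) n)" for n
      by (simp add: skew_iff algebra_simps)
    then show ?thesis
      using that mat_nth_R_mat_odd[of "nat (m + 1)" \<kappa> t x] by (auto simp: mcoeff_Q_mat even_nat_iff)
  qed
  show "((\<lambda>x. mcoeff m (Q_mat \<kappa> t x)) has_vector_derivative
        mcomm (mcoeff (m + 1) (Q_mat \<kappa> t x)) mat_a + mcomm (mcoeff m (Q_mat \<kappa> t x)) (Psi (\<kappa> t x))) (at x)" for m x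
  proof (cases "m < -1")
    case True
    \<comment> \<open>At m = -2 the Lax equation reads 0 = [a, a]; below that every term
      vanishes.\<close>
    then have "m + 1 = -1 \<or> m + 1 < -1" by auto
    then show ?thesis using True by (auto simp: mcoeff_Q_mat mat_nth_R_mat_0 mcomm_def matrix_matrix_mult_def vec_eq_iff)
  next
    case False
    then have "nat (m + 1 + 1) = Suc (nat (m + 1))" by linarith
    then show ?thesis using False mat_nth_R_mat_derivative[OF t] by (simp add: mcoeff_Q_mat)
  qed
  show "smooth (\<lambda>x. mcoeff m (Q_mat \<kappa> t x))" for m
  proof (cases "m < -1")
    case True
    have "smooth_loop L (\<lambda>x. 0 :: real ^ 'm option option ^ 'm option option)"
      unfolding smooth_loop_iff_family by (rule smooth_family_const) simp
    then show ?thesis using True by (simp add: mcoeff_Q_mat smooth_loop_def)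
  next
    case False
    then show ?thesis
      using smooth_family_slice[OF smooth_mat_nth_R_mat t] by (simp add: mcoeff_Q_mat smooth_loop_def)
  qed
  show "\<exists>P :: real fls ^ 'm option option ^ 'm option option. invertible P \<and> Q_mat \<kappa> t x = P ** a_lam ** matrix_inv P" for x by (rule Q_mat_conjugate)
qed

lemma Q_series_eq: "t \<in> T \<Longrightarrow> Q_series (\<kappa> t) = Q_mat \<kappa> t"
  unfolding Q_series_def
  by (rule the_equality, erule Q_mat_is_Q_series) (rule is_Q_series_unique, assumption, erule Q_mat_is_Q_series)

lemma y_coeff_eq: "t \<in> T \<Longrightarrow> y_coeff (int n - 1) (\<kappa> t) x = fps_nth (Y_ser \<kappa> t x) n"
  by (simp add: y_coeff_def Q_series_eq mcoeff_Q_mat mat_nth_def)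

lemma eta_coeff_eq: "t \<in> T \<Longrightarrow> eta_coeff (int n - 1) (\<kappa> t) x = (\<chi> i. fps_nth (Y_ser \<kappa> t x * h_ser \<kappa> i t x) n)"
  by (simp add: eta_coeff_def Q_series_eq mcoeff_Q_mat mat_nth_def)

end

subsection \<open>The gradient of \<open>F_functional\<close>\<close>

definition z_coeff :: "int \<Rightarrow> (real \<Rightarrow> real ^ 'm) \<Rightarrow> real \<Rightarrow> real ^ 'm" where
  "z_coeff m k x = (\<chi> i. mcoeff m (Q_series k x) $ Some (Some i) $ Some None)"

definition xi_coeff :: "int \<Rightarrow> (real \<Rightarrow> real ^ 'm) \<Rightarrow> real \<Rightarrow> real ^ 'm ^ 'm" where
  "xi_coeff m k x = (\<chi> i l. mcoeff m (Q_series k x) $ Some (Some i) $ Some (Some l))"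

lemma curvature_family_const: "smooth_loop L k \<Longrightarrow> curvature_family L UNIV (\<lambda>_. k)"
  by unfold_locales (simp_all flip: smooth_loop_iff_family)

lemma is_Q_series_Q_series:
  assumes "smooth_loop L k"
  shows "is_Q_series k (Q_series k)"
proof -
  interpret curvature_family L UNIV "\<lambda>_. k" using assms by (rule curvature_family_const)
  show ?thesis using Q_mat_is_Q_series[of 0] Q_series_eq[of 0] by simp
qed

lemma z_coeff_eq:
  assumes "curvature_family L T \<kappa>" "t \<in> T"
  shows "z_coeff (int n - 1) (\<kappa> t) x = (\<chi> i. fps_nth (Y_ser \<kappa> t x * z_ser \<kappa> i t x) n)"
  using curvature_family.Q_series_eq[OF assms] by (simp add: z_coeff_def mcoeff_Q_mat mat_nth_def)

lemma smooth_mcoeff_Q_series: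
  fixes k :: "real \<Rightarrow> real ^ 'm"
  assumes "smooth_loop L k"
  shows "smooth_loop L (\<lambda>x. mcoeff m (Q_series k x))"
proof -
  interpret curvature_family L UNIV "\<lambda>_. k" using assms by (rule curvature_family_const)
  have "smooth_loop L (\<lambda>x. mat_nth (R_mat (\<lambda>_. k) 0 x) n)" for n
    using smooth_family_slice[OF smooth_mat_nth_R_mat, of 0] by simp
  moreover have "smooth_loop L (\<lambda>x. 0 :: real ^ 'm option option ^ 'm option option)"
    by (simp add: smooth_loop_iff_family smooth_family_const)
  ultimately show ?thesis
    using Q_series_eq[of 0] by (cases "m < -1") (simp_all add: mcoeff_Q_mat)
qed

lemma smooth_loop_vec:
  fixes f :: "real \<Rightarrow> 'a::real_normed_vector ^ 'n"
  shows "smooth_loop L f \<longleftrightarrow> (\<forall>i. smooth_loop L (\<lambda>x. f x $ i))"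
  unfolding smooth_loop_iff_family by (rule smooth_family_vec) simp

lemma smooth_coeffs:
  assumes "smooth_loop L k"
  shows "smooth_loop L (y_coeff m k)" "smooth_loop L (eta_coeff m k)" "smooth_loop L (z_coeff m k)" "smooth_loop L (xi_coeff m k)"
  using smooth_mcoeff_Q_series[OF assms, of m]
  by (simp_all add: smooth_loop_vec y_coeff_def[abs_def] eta_coeff_def z_coeff_def xi_coeff_def)

context
  fixes L :: real and k :: "real \<Rightarrow> real ^ 'm"
  assumes k: "smooth_loop L k"
begin

lemma mcoeff_odd_block:
  assumes "odd m" "m \<ge> -1"
  shows "mcoeff m (Q_series k x) = odd_block (y_coeff m k x) (eta_coeff m k x)"
proof -
  have "\<exists>y \<eta>. mcoeff m (Q_series k x) = odd_block y \<eta>"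
  proof (cases "m = -1")
    case True
    have "mat_a = odd_block 1 (0 :: real ^ 'm)"
      by (auto simp: mat_a_def odd_block_def vec_eq_iff split: option.split)
    then show ?thesis using True is_Q_seriesD(2)[OF is_Q_series_Q_series[OF k]] by metis
  next
    case False
    then show ?thesis using assms is_Q_seriesD(3)[OF is_Q_series_Q_series[OF k]] by simp
  qed
  then show ?thesis by (auto simp: y_coeff_def eta_coeff_def)
qed

lemma mcoeff_even_block:
  assumes "even m" "m \<ge> 0"
  shows "mcoeff m (Q_series k x) = even_block (z_coeff m k x) (xi_coeff m k x)" "skew (xi_coeff m k x)"
proof -
  obtain z \<xi> where *: "skew \<xi>" "mcoeff m (Q_series k x) = even_block z \<xi>"
    using is_Q_seriesD(4)[OF is_Q_series_Q_series[OF k]] assms by blast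
  then have "z_coeff m k x = z" "xi_coeff m k x = \<xi>" by (simp_all add: z_coeff_def xi_coeff_def vec_eq_iff)
  with * show "mcoeff m (Q_series k x) = even_block (z_coeff m k x) (xi_coeff m k x)" "skew (xi_coeff m k x)"
    by simp_all
qed

text \<open>Entries of the Lax equation, at index m for y and \<eta> and at index m + 1 for \<xi>;
  in the latter, the bracket with a has no lower right block. The first two equations compute X_x
  for the Airy field, the third makes \<xi> an admissible antiderivative in the Poisson
  operator.\<close>

lemma coeff_derivatives:
  assumes m: "odd m" "m \<ge> -1"
  shows "(y_coeff m k has_vector_derivative k x \<bullet> eta_coeff m k x) (at x)"
    "(eta_coeff m k has_vector_derivative z_coeff (m + 1) k x - y_coeff m k x *\<^sub>R k x) (at x)"
    "(xi_coeff (m + 1) k has_vector_derivative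
       outer (k x) (z_coeff (m + 1) k x) - outer (z_coeff (m + 1) k x) (k x)) (at x)"
proof -
  have d: "((\<lambda>x. mcoeff m (Q_series k x) $ p $ q) has_vector_derivative
        (mcomm (mcoeff (m + 1) (Q_series k x)) mat_a + mcomm (mcoeff m (Q_series k x)) (Psi (k x))) $ p $ q) (at x)" for m p q x
    using is_Q_seriesD(5)[OF is_Q_series_Q_series[OF k], of m x] by (simp only: has_vector_derivative_vec)
  have o: "mcoeff m (Q_series k x) = odd_block (y_coeff m k x) (eta_coeff m k x)"
    and o2: "mcoeff (m + 1 + 1) (Q_series k x) = odd_block (y_coeff (m + 1 + 1) k x) (eta_coeff (m + 1 + 1) k x)"
    and e: "mcoeff (m + 1) (Q_series k x) = even_block (z_coeff (m + 1) k x) (xi_coeff (m + 1) k x)" for x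
    using mcoeff_odd_block[of m] mcoeff_odd_block[of "m + 1 + 1"] mcoeff_even_block(1)[of "m + 1"] m by auto
  note mult = mcomm_def matrix_matrix_mult_def sum_option Psi_def sum_negf
  show "(y_coeff m k has_vector_derivative k x \<bullet> eta_coeff m k x) (at x)"
    using d[of m "Some None" None x] unfolding o e by (simp add: mult inner_vec_def)
  show "(eta_coeff m k has_vector_derivative z_coeff (m + 1) k x - y_coeff m k x *\<^sub>R k x) (at x)"
    using d[of m "Some (Some _)" None x] unfolding o e by (simp add: mult has_vector_derivative_vec mult.commute)
  show "(xi_coeff (m + 1) k has_vector_derivative
       outer (k x) (z_coeff (m + 1) k x) - outer (z_coeff (m + 1) k x) (k x)) (at x)"
    using d[of "m + 1" "Some (Some _)" "Some (Some _)" x] unfolding o2 e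
    by (simp add: mult has_vector_derivative_vec outer_def algebra_simps)
qed

end

section \<open>The L2 pairing and uniqueness of gradients\<close>

lemma smooth_loop_l2_integrable:
  assumes "smooth_loop L f" "smooth_loop L g"
  shows "(\<lambda>x. f x \<bullet> g x :: real) integrable_on {0..L}"
proof -
  have "continuous_on {0..L} f" "continuous_on {0..L} g"
    using assms unfolding smooth_loop_iff_family by (auto dest: smooth_family_continuous_slice)
  then show ?thesis by (intro integrable_continuous_real continuous_on_inner)
qed

lemma smooth_loop_add: "smooth_loop L f \<Longrightarrow> smooth_loop L g \<Longrightarrow> smooth_loop L (\<lambda>x. f x + g x)"
  unfolding smooth_loop_iff_family by (rule smooth_family_add) simp_all

lemma smooth_loop_diff: "smooth_loop L f \<Longrightarrow> smooth_loop L g \<Longrightarrow> smooth_loop L (\<lambda>x. f x - g x)"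
  unfolding smooth_loop_iff_family by (rule smooth_family_diff) simp_all

lemma smooth_loop_mult: "smooth_loop L f \<Longrightarrow> smooth_loop L g \<Longrightarrow> smooth_loop L (\<lambda>x. f x * g x :: real)"
  unfolding smooth_loop_iff_family by (rule smooth_family_mult) simp_all

lemma smooth_loop_sum: "(\<And>i. i \<in> I \<Longrightarrow> smooth_loop L (f i)) \<Longrightarrow> smooth_loop L (\<lambda>x. \<Sum>i\<in>I. f i x)"
  unfolding smooth_loop_iff_family by (rule smooth_family_sum) simp_all

lemma smooth_loop_const: "smooth_loop L (\<lambda>x. c)"
  unfolding smooth_loop_iff_family by (rule smooth_family_const) simp

lemma smooth_loop_bounded_linear: "bounded_linear h \<Longrightarrow> smooth_loop L f \<Longrightarrow> smooth_loop L (\<lambda>x. h (f x))"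
  unfolding smooth_loop_iff_family by (rule smooth_family_bounded_linear) simp_all

lemma bounded_linear_matrix_vector: "bounded_linear ((*v) (M :: real ^ 'n ^ 'm))"
  using matrix_vector_mul_linear by (rule linear_conv_bounded_linear[THEN iffD1])

lemma smooth_family_time_mult:
  fixes g :: "real \<Rightarrow> real"
  assumes g: "smooth g" and f: "smooth_loop L f"
  shows "smooth_family L UNIV (\<lambda>t x. g t *\<^sub>R f x)"
proof -
  obtain G where G: "G 0 = g" "\<And>i x. (G i has_vector_derivative G (Suc i) x) (at x)"
    using g by (auto simp: smooth_def)
  obtain D where D: "D 0 = f" "\<And>i x. (D i has_vector_derivative D (Suc i) x) (at x)" "\<And>x. f (x + L) = f x"
    using f by (auto simp: smooth_loop_def smooth_def)
  have c: "continuous_on UNIV (G i)" "continuous_on UNIV (D i)" for i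
    using G(2) D(2) by (intro continuous_at_imp_continuous_on ballI has_vector_derivative_continuous; blast)+
  show ?thesis
  proof (rule smooth_familyI[where D="\<lambda>i j t x. G i t *\<^sub>R D j x"])
    have "continuous_on UNIV (\<lambda>p. G i (fst p) *\<^sub>R D j (snd p))" for i j
      by (intro continuous_on_scaleR continuous_on_compose2[OF c(1)] continuous_on_compose2[OF c(2)]
          continuous_on_fst continuous_on_snd continuous_on_id) simp_all
    then show "continuous_on (UNIV \<times> UNIV) (\<lambda>(t, x). G i t *\<^sub>R D j x)" for i j
      by (simp add: case_prod_unfold)
    show "((\<lambda>s. G i s *\<^sub>R D j x) has_vector_derivative G (Suc i) t *\<^sub>R D j x) (at t)" for i j t x
      by (rule bounded_linear.has_vector_derivative[OF bounded_linear_scaleR_left G(2)])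
    show "((\<lambda>x. G i t *\<^sub>R D j x) has_vector_derivative G i t *\<^sub>R D (Suc j) x) (at x)" for i j t x
      by (rule bounded_linear.has_vector_derivative[OF bounded_linear_scaleR_right D(2)])
  qed (simp_all add: G D)
qed

lemma smooth_ident: "smooth (\<lambda>t :: real. t)"
  unfolding smooth_def
proof (intro exI conjI allI)
  let ?D = "\<lambda>i t. if i = 0 then t else if i = 1 then 1 else 0 :: real"
  show "(?D i has_vector_derivative ?D (Suc i) x) (at x)" for i x
    by (cases "i = 0"; cases "i = 1") auto
qed simp

lemma l2_inner_diff:
  assumes "smooth_loop L v" "smooth_loop L w" "smooth_loop L u"
  shows "l2_inner L (\<lambda>x. v x - w x) u = l2_inner L v u - l2_inner L w u"
  unfolding l2_inner_def inner_diff_left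
  by (intro integral_diff smooth_loop_l2_integrable assms)

lemma l2_inner_self_zero:
  assumes L: "L > 0" and w: "smooth_loop L w" and 0: "l2_inner L w w = 0"
  shows "w = (\<lambda>x. 0)"
proof
  fix x
  have "continuous_on {0..L} w"
    using w unfolding smooth_loop_iff_family by (auto dest: smooth_family_continuous_slice)
  then have c: "continuous_on {0..L} (\<lambda>x. w x \<bullet> w x)" by (intro continuous_on_inner)
  then have "((\<lambda>x. w x \<bullet> w x) has_integral 0) {0..L}"
    using 0 smooth_loop_l2_integrable[OF w w] by (simp add: l2_inner_def has_integral_iff)
  then have z: "w y = 0" if "y \<in> {0..L}" for y
    using has_integral_0_cbox_imp_0[of 0 L "\<lambda>x. w x \<bullet> w x" y] c that L by simp
  have per: "w (y + L) = w y" for y using w by (simp add: smooth_loop_def)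
  have up: "w (y + real n * L) = w y" for y n
    using per by (induction n) (simp_all add: algebra_simps, metis add.assoc add.commute)
  \<comment> \<open>The number of whole periods by which x is shifted back into the interval from 0
    to L, where w is known to vanish.\<close>
  define n where "n = \<lfloor>x / L\<rfloor>"
  have n: "of_int n * L \<le> x" "x < of_int n * L + L"
    using floor_divide_lower[OF L, of x] floor_divide_upper[OF L, of x] by (simp_all add: n_def distrib_right)
  have "w x = w (x - of_int n * L)"
  proof (cases "n \<ge> 0")
    case True
    then show ?thesis using up[of "x - of_int n * L" "nat n"] by simp
  next
    case False
    then show ?thesis using up[of x "nat (- n)"] by simp
  qed
  also have "\<dots> = 0" using n by (intro z) auto
  finally show "w x = 0" .
qed

text \<open>Both candidates are tested on the straight line through k in the direction v - w, which
  gives v - w norm zero.\<close>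

lemma has_gradient_unique:
  assumes L: "L > 0" and k: "smooth_loop L k" and v: "has_gradient L F k v" and w: "has_gradient L F k w"
  shows "v = w"
proof -
  have sm: "smooth_loop L v" "smooth_loop L w" using v w by (auto simp: has_gradient_def)
  define d where "d = (\<lambda>x. v x - w x)"
  have d: "smooth_loop L d" unfolding d_def using sm by (rule smooth_loop_diff)
  define \<kappa> where "\<kappa> = (\<lambda>t x. k x + t *\<^sub>R d x)"
  have \<kappa>: "smooth_family L UNIV \<kappa>"
    unfolding \<kappa>_def
    by (intro smooth_family_add smooth_family_time_const smooth_family_time_mult smooth_ident k d open_UNIV)
  have vel: "velocity \<kappa> 0 = d"
    unfolding velocity_def \<kappa>_def
    by (intro ext vector_derivative_at) (auto intro!: derivative_eq_intros)
  have "((\<lambda>s. F (\<kappa> s)) has_real_derivative l2_inner L u d) (at 0)" if "has_gradient L F k u" for u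
    using that \<kappa> unfolding has_gradient_def vel[symmetric] by (force simp: \<kappa>_def)
  then have "l2_inner L v d = l2_inner L w d" using v w DERIV_unique by blast
  then have "l2_inner L d d = 0"
    unfolding d_def using l2_inner_diff[OF sm d] by (simp add: d_def)
  then have "d = (\<lambda>x. 0)" by (rule l2_inner_self_zero[OF L d])
  then show ?thesis unfolding d_def by (metis eq_iff_diff_eq_0 ext)
qed

lemma grad_eqI: "L > 0 \<Longrightarrow> smooth_loop L k \<Longrightarrow> has_gradient L F k w \<Longrightarrow> grad L F k = w"
  unfolding grad_def by (blast intro: the_equality has_gradient_unique)

lemma F_functional_gradient:
  assumes L: "L > 0" and j: "j \<ge> 1" and k: "smooth_loop L k"
  shows "has_gradient L (F_functional L j) k (z_coeff (2 * int j - 2) k)"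
  unfolding has_gradient_def
proof (intro conjI allI impI; (elim conjE)?)
  show "smooth_loop L (z_coeff (2 * int j - 2) k)" by (rule smooth_coeffs[OF k])
  fix T \<kappa> t
  assume T: "open T" and t: "t \<in> T" and \<kappa>: "smooth_family L T \<kappa>" and kt: "\<kappa> t = k"
  interpret curvature_family L T \<kappa> using T \<kappa> by unfold_locales
  \<comment> \<open>With n = 2j - 2, the integrand y at index 2j - 1 is the coefficient n + 2 of Y,
    and z at index 2j - 2 is the coefficient n + 1 of Y \<zeta>. The factor -(n + 1) from
    \<open>integral_Y_derivative\<close> cancels the prefactor -1/(2j-1) of the functional.\<close>
  define n where "n = 2 * j - 2"
  have n: "2 * int j - 1 = int (n + 2) - 1" "2 * int j - 2 = int (n + 1) - 1" "2 * real j - 1 = real (n + 1)"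
    using j by (auto simp: n_def)
  have F: "F_functional L j (\<kappa> s) = - (1 / real (n + 1)) * integral {0..L} (\<lambda>x. fps_nth (Y_ser \<kappa> s x) (n + 2))" if "s \<in> T" for s
  proof -
    have "y_coeff (int (n + 2) - 1) (\<kappa> s) = (\<lambda>x. fps_nth (Y_ser \<kappa> s x) (n + 2))"
      by (rule ext) (rule y_coeff_eq[OF that])
    then show ?thesis unfolding F_functional_def n by (simp only:)
  qed
  have "l2_inner L (z_coeff (2 * int j - 2) k) (velocity \<kappa> t) =
      integral {0..L} (\<lambda>x. \<Sum>i\<in>UNIV. fps_nth (Y_ser \<kappa> t x * z_ser \<kappa> i t x) (n + 1) * velocity \<kappa> t x $ i)" (is "_ = ?I")
    unfolding n kt[symmetric] l2_inner_def
    by (simp only: z_coeff_eq[OF curvature_family_axioms t]) (simp add: inner_vec_def)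
  moreover have "- (1 / real (n + 1)) * (- real (n + 1) * ?I) = ?I"
  proof -
    have "- (1 / c) * (- c * I) = I" if "c \<noteq> 0" for c I :: real using that by simp
    moreover have "real (n + 1) \<noteq> 0" by simp
    ultimately show ?thesis by blast
  qed
  moreover have "((\<lambda>s. - (1 / real (n + 1)) * integral {0..L} (\<lambda>x. fps_nth (Y_ser \<kappa> s x) (n + 2)))
      has_real_derivative - (1 / real (n + 1)) * (- real (n + 1) * ?I)) (at t)"
    by (rule DERIV_cmult[OF integral_Y_derivative[OF L t]])
  ultimately have "((\<lambda>s. - (1 / real (n + 1)) * integral {0..L} (\<lambda>x. fps_nth (Y_ser \<kappa> s x) (n + 2)))
      has_real_derivative l2_inner L (z_coeff (2 * int j - 2) k) (velocity \<kappa> t)) (at t)" by (simp only:)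
  then show "((\<lambda>s. F_functional L j (\<kappa> s)) has_real_derivative l2_inner L (z_coeff (2 * int j - 2) k) (velocity \<kappa> t)) (at t)"
    by (rule has_field_derivative_transform_within_open[OF _ T t]) (simp only: F)
qed

lemma coeffs_rotated:
  fixes M :: "real ^ 'm ^ 'm"
  assumes k: "smooth_loop L k" and M: "transpose M ** M = mat 1" and m: "m \<ge> -1"
  shows "y_coeff m (\<lambda>x. M *v k x) = y_coeff m k" "eta_coeff m (\<lambda>x. M *v k x) x = M *v eta_coeff m k x"
proof -
  interpret k: curvature_family L UNIV "\<lambda>_. k" using k by (rule curvature_family_const)
  interpret Mk: curvature_family L UNIV "\<lambda>_ x. M *v k x"
    by (rule curvature_family_const) (rule smooth_loop_bounded_linear[OF bounded_linear_matrix_vector k])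
  define n where "n = nat (m + 1)"
  have m': "m = int n - 1" using m by (simp add: n_def)
  show "y_coeff m (\<lambda>x. M *v k x) = y_coeff m k"
    using k.y_coeff_eq[of 0 n] Mk.y_coeff_eq[of 0 n] k.Y_ser_rotated[OF M, of 0] unfolding m' by (intro ext) simp
  have "fps_nth (Y_ser (\<lambda>_. k) 0 x * (\<Sum>l\<in>UNIV. fps_const (M $ i $ l) * h_ser (\<lambda>_. k) l 0 x)) n =
      (\<Sum>l\<in>UNIV. M $ i $ l * fps_nth (Y_ser (\<lambda>_. k) 0 x * h_ser (\<lambda>_. k) l 0 x) n)" for i
    by (simp only: sum_distrib_left mult.left_commute[of "Y_ser (\<lambda>_. k) 0 x"] fps_sum_nth fps_mult_left_const_nth)
  then show "eta_coeff m (\<lambda>x. M *v k x) x = M *v eta_coeff m k x"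
    using k.eta_coeff_eq[of 0 n] Mk.eta_coeff_eq[of 0 n] k.Y_ser_rotated[OF M, of 0 x] k.h_ser_rotated[OF M, of 0 _ x]
    by (simp add: m' vec_eq_iff matrix_vector_mult_def)
qed

lemma rotation_matrix_inv:
  fixes c :: "real ^ 'n ^ 'n"
  assumes "rotation_matrix c"
  shows "matrix_inv c = transpose c" "transpose c ** c = mat 1" "c ** transpose c = mat 1"
proof -
  show c: "transpose c ** c = mat 1" "c ** transpose c = mat 1"
    using assms by (simp_all add: rotation_matrix_def orthogonal_matrix_def)
  then have "matrix_inv c ** c = mat 1" using matrix_inv_inverse[of c] by (auto simp: invertible_def)
  then have "matrix_inv c ** (c ** transpose c) = transpose c" by (simp add: matrix_mul_assoc)
  then show "matrix_inv c = transpose c" by (simp add: c)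
qed

lemma F_functional_invariant:
  assumes "L > 0" "j \<ge> 1"
  shows "invariant_functional L (F_functional L j :: (real \<Rightarrow> real ^ 'm) \<Rightarrow> real)"
  unfolding invariant_functional_def
proof (intro allI impI conjI)
  fix k :: "real \<Rightarrow> real ^ 'm" assume k: "smooth_loop L k"
  show "\<exists>w. has_gradient L (F_functional L j) k w" using F_functional_gradient[OF assms k] by blast
  fix c :: "real ^ 'm ^ 'm" assume c: "rotation_matrix c"
  have "transpose (matrix_inv c) ** matrix_inv c = mat 1" by (simp add: rotation_matrix_inv[OF c])
  then show "F_functional L j (\<lambda>x. matrix_inv c *v k x) = F_functional L j k"
    unfolding F_functional_def using assms(2) by (simp add: coeffs_rotated(1)[OF k])
qed

text \<open>Q itself supplies the antiderivative: its lower right block at index 2j - 2 is skew,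
  periodic and has the required derivative. No separate argument for periodicity is needed.\<close>

lemma is_xi_coeff:
  assumes k: "smooth_loop L k" and j: "j \<ge> 1"
  shows "is_xi L k (z_coeff (2 * int j - 2) k) (xi_coeff (2 * int j - 2) k)"
proof -
  have "2 * int j - 2 = (2 * int j - 3) + 1" by simp
  then show ?thesis
    unfolding is_xi_def
    using j smooth_coeffs(4)[OF k] mcoeff_even_block(2)[OF k, of "2 * int j - 2"] coeff_derivatives(3)[OF k, of "2 * int j - 3"]
    by simp
qed

lemma prod_option: "(\<Prod>p\<in>UNIV. f p) = f None * (\<Prod>i\<in>UNIV. f (Some i))" for f :: "'a::finite option \<Rightarrow> 'b::comm_monoid_mult"
  unfolding UNIV_option_conv by (simp add: prod.reindex)

subsection \<open>Parallel frames\<close>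

definition unit_block :: "real ^ 'm ^ 'm \<Rightarrow> real ^ 'm option ^ 'm option" where
  "unit_block C = (\<chi> p q. case (p, q) of (None, None) \<Rightarrow> 1 | (Some i, Some j) \<Rightarrow> C $ i $ j | _ \<Rightarrow> 0)"

lemma unit_block_simps [simp]:
  "unit_block C $ None $ None = 1" "unit_block C $ None $ Some i = 0"
  "unit_block C $ Some i $ None = 0" "unit_block C $ Some i $ Some j = C $ i $ j"
  by (simp_all add: unit_block_def)

lemma transpose_unit_block: "transpose (unit_block C) = unit_block (transpose C)"
  unfolding vec_eq_iff
proof (intro allI)
  fix p q show "transpose (unit_block C) $ p $ q = unit_block (transpose C) $ p $ q"
    by (cases p; cases q) (simp_all add: transpose_def)
qed

text \<open>In the Leibniz formula only permutations fixing \<open>None\<close> contribute, and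
  these are \<open>map_option p\<close> for the permutations p of the remaining indices, with the
  same sign.\<close>

lemma det_unit_block:
  fixes C :: "real ^ 'm ^ 'm"
  shows "det (unit_block C) = det C"
proof -
  have bij: "bij_betw map_option {p. p permutes (UNIV :: 'm set)} {p. p permutes range Some}"
  proof -
    have 1: "(\<lambda>p x. if x \<in> range Some then Some (p (inv_into UNIV Some x)) else x) = (map_option :: ('m \<Rightarrow> 'm) \<Rightarrow> _)"
    proof (intro ext)
      fix p :: "'m \<Rightarrow> 'm" and x
      show "(if x \<in> range Some then Some (p (inv_into UNIV Some x)) else x) = map_option p x"
        by (cases x) simp_all
    qed
    have "bij_betw Some (UNIV :: 'm set) (range Some)" by (simp add: bij_betw_def)
    from bij_betw_permutations[OF this] show ?thesis unfolding 1 .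
  qed
  have sign: "sign (map_option p) = sign p" if "p permutes UNIV" for p :: "'m \<Rightarrow> 'm"
  proof -
    have "map_permutation UNIV Some p = map_option p"
    proof
      fix x show "map_permutation UNIV Some p x = map_option p x"
        by (cases x) (simp_all add: map_permutation_def restrict_id_def)
    qed
    then show ?thesis using sign_map_permutation[of Some UNIV p] that by simp
  qed
  let ?F = "\<lambda>p. of_int (sign p) * (\<Prod>x\<in>UNIV. unit_block C $ x $ p x)"
  have "det (unit_block C) = (\<Sum>p | p permutes UNIV. ?F p)" by (simp add: det_def)
  also have "\<dots> = (\<Sum>p | p permutes range Some. ?F p)"
  proof (rule sum.mono_neutral_right)
    show "{p. p permutes range Some} \<subseteq> {p. p permutes (UNIV :: 'm option set)}"
      using permutes_subset[of _ "range (Some :: 'm \<Rightarrow> _)" UNIV] by blast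
    show "\<forall>p\<in>{p. p permutes UNIV} - {p. p permutes range Some}. ?F p = 0"
    proof
      fix p assume p: "p \<in> {p. p permutes UNIV} - {p. p permutes range (Some :: 'm \<Rightarrow> _)}"
      have "p None \<noteq> None"
      proof
        assume "p None = None"
        have "p permutes range Some"
        proof (rule permutes_superset[of p UNIV])
          show "p x = x" if "x \<in> UNIV - range Some" for x
            using that \<open>p None = None\<close> by (cases x) simp_all
        qed (use p in simp)
        with p show False by simp
      qed
      then show "?F p = 0" by (auto simp: prod_option)
    qed
  qed (simp add: finite_permutations)
  also have "\<dots> = (\<Sum>p | p permutes (UNIV :: 'm set). ?F (map_option p))"
    by (rule sum.reindex_bij_betw[OF bij, symmetric])
  also have "\<dots> = det C"
    unfolding det_def by (intro sum.cong refl) (simp add: prod_option sign)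
  finally show ?thesis .
qed

lemma unit_block_mult: "unit_block A ** unit_block B = unit_block (A ** B)"
  unfolding vec_eq_iff
proof (intro allI)
  fix p q show "(unit_block A ** unit_block B) $ p $ q = unit_block (A ** B) $ p $ q"
    by (cases p; cases q) (simp_all add: matrix_matrix_mult_def sum_option)
qed

lemma curvature_matrix_simps [simp]:
  "curvature_matrix v $ None $ None = 0" "curvature_matrix v $ None $ Some i = - (v $ i)"
  "curvature_matrix v $ Some i $ None = v $ i" "curvature_matrix v $ Some i $ Some j = 0"
  by (simp_all add: curvature_matrix_def)

lemma transpose_curvature_matrix: "transpose (curvature_matrix v) = - curvature_matrix v"
  unfolding vec_eq_iff
proof (intro allI)
  fix p q show "transpose (curvature_matrix v) $ p $ q = (- curvature_matrix v) $ p $ q"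
    by (cases p; cases q) (simp_all add: transpose_def)
qed

lemma curvature_matrix_linear:
  "curvature_matrix (v + s *\<^sub>R w) = curvature_matrix v + s *\<^sub>R curvature_matrix w"
  by (auto simp: vec_eq_iff curvature_matrix_def split: option.split)

lemma has_vector_derivative_matrix_mult:
  fixes F G :: "real \<Rightarrow> real ^ 'p ^ 'p"
  assumes "(F has_vector_derivative F') (at x)" "(G has_vector_derivative G') (at x)"
  shows "((\<lambda>x. F x ** G x) has_vector_derivative F' ** G x + F x ** G') (at x)"
proof -
  have "((\<lambda>x. \<Sum>r\<in>UNIV. F x $ p $ r * G x $ r $ q) has_vector_derivative
      (\<Sum>r\<in>UNIV. F x $ p $ r * G' $ r $ q + F' $ p $ r * G x $ r $ q)) (at x)" for p q
    using assms unfolding has_vector_derivative_vec by (intro has_vector_derivative_sum has_vector_derivative_mult) auto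
  then show ?thesis
    unfolding has_vector_derivative_vec by (simp add: matrix_matrix_mult_def sum.distrib add.commute)
qed

lemma has_vector_derivative_matrix_vector_mult:
  fixes F :: "real \<Rightarrow> real ^ 'p ^ 'q"
  assumes "(F has_vector_derivative F') (at x)" "(v has_vector_derivative v') (at x)"
  shows "((\<lambda>x. F x *v v x) has_vector_derivative F' *v v x + F x *v v') (at x)"
proof -
  have "((\<lambda>x. \<Sum>r\<in>UNIV. F x $ p $ r * v x $ r) has_vector_derivative
      (\<Sum>r\<in>UNIV. F x $ p $ r * v' $ r + F' $ p $ r * v x $ r)) (at x)" for p
    using assms unfolding has_vector_derivative_vec by (intro has_vector_derivative_sum has_vector_derivative_mult) auto
  then show ?thesis
    unfolding has_vector_derivative_vec by (simp add: matrix_vector_mult_def sum.distrib add.commute)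
qed

lemma has_vector_derivative_transpose:
  "(F has_vector_derivative F') (at x) \<Longrightarrow> ((\<lambda>x. transpose (F x) :: real ^ 'p ^ 'q) has_vector_derivative transpose F') (at x)"
  by (simp add: has_vector_derivative_vec transpose_def)

lemma smooth_loop_matrix_mult:
  fixes F G :: "real \<Rightarrow> real ^ 'p ^ 'p"
  shows "smooth_loop L F \<Longrightarrow> smooth_loop L G \<Longrightarrow> smooth_loop L (\<lambda>x. F x ** G x)"
  by (simp add: smooth_loop_vec matrix_matrix_mult_def smooth_loop_sum smooth_loop_mult)

lemma smooth_loop_matrix_vector_mult:
  fixes F :: "real \<Rightarrow> real ^ 'p ^ 'q"
  shows "smooth_loop L F \<Longrightarrow> smooth_loop L v \<Longrightarrow> smooth_loop L (\<lambda>x. F x *v v x)"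
  by (simp add: smooth_loop_vec matrix_vector_mult_def smooth_loop_sum smooth_loop_mult)

lemma smooth_loop_transpose:
  "smooth_loop L F \<Longrightarrow> smooth_loop L (\<lambda>x. transpose (F x) :: real ^ 'p ^ 'q)"
  by (simp add: smooth_loop_vec transpose_def)

lemma smooth_loop_has_derivative:
  "smooth_loop L f \<Longrightarrow> (f has_vector_derivative vector_derivative f (at x)) (at x)"
  unfolding smooth_loop_iff_family using smooth_family_has_dx[of L UNIV "\<lambda>_. f" 0 x] by (simp add: dx_def)

lemma smooth_loop_derivative: "smooth_loop L f \<Longrightarrow> smooth_loop L (\<lambda>x. vector_derivative f (at x))"
  unfolding smooth_loop_iff_family using smooth_family_dx[of UNIV L "\<lambda>_. f"] by (simp add: dx_def[abs_def])

lemma parallel_frameD: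
  assumes "parallel_frame L \<gamma> g k"
  shows "smooth_loop L g" "smooth_loop L k" "transpose (g x) ** g x = mat 1" "g x ** transpose (g x) = mat 1" "det (g x) = 1"
    "column None (g x) = vector_derivative \<gamma> (at x)" "(g has_vector_derivative g x ** curvature_matrix (k x)) (at x)"
proof -
  show g: "smooth_loop L g" "smooth_loop L k" "column None (g x) = vector_derivative \<gamma> (at x)"
    using assms by (simp_all add: parallel_frame_def)
  have rot: "rotation_matrix (g x)" using assms by (simp add: parallel_frame_def)
  then show "transpose (g x) ** g x = mat 1" and ggT: "g x ** transpose (g x) = mat 1" and "det (g x) = 1"
    using rotation_matrix_inv(2,3) by (auto simp: rotation_matrix_def)
  have "matrix_inv (g x) ** vector_derivative g (at x) = curvature_matrix (k x)"
    using assms by (simp add: parallel_frame_def)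
  then have "curvature_matrix (k x) = transpose (g x) ** vector_derivative g (at x)"
    using rotation_matrix_inv(1)[OF rot] by simp
  then have "g x ** curvature_matrix (k x) = vector_derivative g (at x)" by (simp add: matrix_mul_assoc ggT)
  then show "(g has_vector_derivative g x ** curvature_matrix (k x)) (at x)"
    using smooth_loop_has_derivative[OF g(1), of x] by simp
qed

lemma has_vector_derivative_zero_constant:
  fixes f :: "real \<Rightarrow> 'a::real_normed_vector"
  assumes "\<And>x. (f has_vector_derivative 0) (at x)"
  shows "f x = f 0"
proof -
  have "\<exists>c. \<forall>x\<in>UNIV. f x = c"
    by (rule has_derivative_zero_constant) (use assms in \<open>auto simp: has_vector_derivative_def\<close>)
  then show ?thesis by auto
qed

text \<open>With K and K' the two curvature matrices, B = g^t g' satisfies B_x = B K' - K B. Both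
  frames begin with the tangent vector, so orthogonality makes B a block matrix with blocks 1 and C;
  the equation then reduces to C_x = 0 and C k' = k.\<close>

lemma parallel_frames_related:
  fixes k k' :: "real \<Rightarrow> real ^ 'm"
  assumes f: "parallel_frame L \<gamma> g k" and f': "parallel_frame L \<gamma> g' k'"
  obtains c where "rotation_matrix c" "\<And>x. g' x = g x ** unit_block c" "\<And>x. k' x = transpose c *v k x"
proof -
  note F = parallel_frameD[OF f] and F' = parallel_frameD[OF f']
  define B where "B x = transpose (g x) ** g' x" for x
  define C where "C x = (\<chi> i j. B x $ Some i $ Some j)" for x
  have BB: "transpose (B x) ** B x = mat 1" for x
  proof -
    have "transpose (B x) ** B x = transpose (g' x) ** (g x ** transpose (g x)) ** g' x"
      by (simp add: B_def matrix_transpose_mul matrix_mul_assoc)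
    then show ?thesis by (simp add: F F')
  qed
  have col: "B x $ p $ None = mat 1 $ p $ None" for x p
  proof -
    have "B x $ p $ None = (transpose (g x) ** g x) $ p $ None"
      using F(6)[of x] F'(6)[of x] by (simp add: B_def matrix_matrix_mult_def column_def vec_eq_iff)
    then show ?thesis by (simp add: F)
  qed
  have row: "B x $ None $ Some i = 0" for x i
    using arg_cong[OF BB[of x], of "\<lambda>M. M $ None $ Some i"]
    by (simp add: matrix_matrix_mult_def transpose_def sum_option col mat_def)
  have B: "B x = unit_block (C x)" for x
    unfolding vec_eq_iff
  proof (intro allI)
    fix p q show "B x $ p $ q = unit_block (C x) $ p $ q"
      by (cases p; cases q) (simp_all add: col row C_def mat_def)
  qed
  have dB: "(B has_vector_derivative B x ** curvature_matrix (k' x) - curvature_matrix (k x) ** B x) (at x)" for x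
  proof -
    have "(B has_vector_derivative transpose (g x ** curvature_matrix (k x)) ** g' x + transpose (g x) ** (g' x ** curvature_matrix (k' x))) (at x)"
      unfolding B_def[abs_def] by (intro has_vector_derivative_matrix_mult has_vector_derivative_transpose F F')
    then show ?thesis
      by (simp add: matrix_transpose_mul transpose_curvature_matrix matrix_ring B_def)
  qed
  have dBc: "((\<lambda>x. B x $ p $ q) has_vector_derivative (B x ** curvature_matrix (k' x) - curvature_matrix (k x) ** B x) $ p $ q) (at x)" for p q x
    using dB[of x] by (simp only: has_vector_derivative_vec)
  have "(C has_vector_derivative 0) (at x)" for x
    unfolding has_vector_derivative_vec
    using dBc[of "Some _" "Some _" x] by (simp add: C_def) (simp add: B matrix_matrix_mult_def sum_option)
  then have C: "C x = C 0" for x by (rule has_vector_derivative_zero_constant)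
  have Ck: "C x *v k' x = k x" for x
  proof -
    have "((\<lambda>x. 0 :: real) has_vector_derivative (B x ** curvature_matrix (k' x) - curvature_matrix (k x) ** B x) $ Some i $ None) (at x)" for i
      using dBc[of "Some i" None x] by (simp add: col mat_def)
    then have "(B x ** curvature_matrix (k' x) - curvature_matrix (k x) ** B x) $ Some i $ None = 0" for i
      using vector_derivative_unique_at has_vector_derivative_const by blast
    then show ?thesis
      by (simp add: B matrix_matrix_mult_def sum_option matrix_vector_mult_def vec_eq_iff)
  qed
  have "unit_block (transpose (C 0) ** C 0) = transpose (B 0) ** B 0"
    by (simp only: B unit_block_mult transpose_unit_block)
  also have "\<dots> = mat 1" by (rule BB)
  finally have U: "unit_block (transpose (C 0) ** C 0) = mat 1" .
  have "(transpose (C 0) ** C 0) $ i $ j = mat 1 $ i $ j" for i j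
    using arg_cong[OF U, of "\<lambda>M. M $ Some i $ Some j"] by (simp add: mat_def)
  then have CC: "transpose (C 0) ** C 0 = mat 1" unfolding vec_eq_iff by blast
  have "det (C 0) = det (B 0)" unfolding B by (rule det_unit_block[symmetric])
  also have "\<dots> = det (transpose (g 0)) * det (g' 0)" unfolding B_def by (rule det_mul)
  finally have "det (C 0) = det (transpose (g 0)) * det (g' 0)" .
  then have "rotation_matrix (C 0)" using CC by (simp add: rotation_matrix_def orthogonal_matrix det_transpose F F')
  moreover have "g' x = g x ** unit_block (C 0)" for x
    unfolding C[of x, symmetric] B[symmetric] B_def by (simp add: matrix_mul_assoc F)
  moreover have "k' x = transpose (C 0) *v k x" for x
    using arg_cong[OF Ck[of x], of "\<lambda>v. transpose (C 0) *v v"] C[of x] by (simp add: matrix_vector_mul_assoc CC)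
  ultimately show ?thesis by (rule that)
qed

subsection \<open>The differential of \<open>\<Gamma>\<close>\<close>

definition frame_vec :: "real \<Rightarrow> real ^ 'm \<Rightarrow> real ^ 'm option" where
  "frame_vec y \<eta> = (\<chi> p. case p of None \<Rightarrow> y | Some i \<Rightarrow> \<eta> $ i)"

lemma frame_vec_simps [simp]: "frame_vec y \<eta> $ None = y" "frame_vec y \<eta> $ Some i = \<eta> $ i"
  by (simp_all add: frame_vec_def)

definition frame_block :: "real ^ 'm \<Rightarrow> real ^ 'm ^ 'm \<Rightarrow> real ^ 'm option ^ 'm option" where
  "frame_block z \<theta> = (\<chi> p q. case (p, q) of (None, None) \<Rightarrow> 0 | (None, Some i) \<Rightarrow> - z $ i
     | (Some i, None) \<Rightarrow> z $ i | (Some i, Some j) \<Rightarrow> \<theta> $ i $ j)"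

lemma frame_block_simps [simp]:
  "frame_block z \<theta> $ None $ None = 0" "frame_block z \<theta> $ None $ Some i = - (z $ i)"
  "frame_block z \<theta> $ Some i $ None = z $ i" "frame_block z \<theta> $ Some i $ Some j = \<theta> $ i $ j"
  by (simp_all add: frame_block_def)

lemma has_vector_derivative_affine:
  fixes a b :: "'a::real_normed_vector"
  shows "((\<lambda>s. a + s *\<^sub>R b) has_vector_derivative b) (at s)"
  by (auto intro!: derivative_eq_intros)

lemma smooth_loop_minus: "smooth_loop L f \<Longrightarrow> smooth_loop L (\<lambda>x. - f x)"
  by (rule smooth_loop_bounded_linear[OF bounded_linear_minus[OF bounded_linear_ident]])

lemma has_vector_derivative_zero_iff:
  "(f has_vector_derivative D) (at x) \<Longrightarrow> (f has_vector_derivative 0) (at x) \<longleftrightarrow> D = 0"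
  by (auto dest: vector_derivative_unique_at)

lemma frame_tangent_iff:
  fixes k v :: "real \<Rightarrow> real ^ 'm"
  assumes \<gamma>: "smooth_loop L \<gamma>" and g: "smooth_loop L g"
  shows "frame_tangent L \<gamma> g k X W v \<longleftrightarrow>
    smooth_loop L X \<and> smooth_loop L W \<and> smooth_loop L v \<and>
    (\<forall>x. transpose (W x) ** g x + transpose (g x) ** W x = 0 \<and> column None (W x) = vector_derivative X (at x) \<and>
      vector_derivative W (at x) = W x ** curvature_matrix (k x) + g x ** curvature_matrix (v x))"
proof -
  have "((\<lambda>s. frame_residual (\<lambda>x. \<gamma> x + s *\<^sub>R X x) (\<lambda>x. g x + s *\<^sub>R W x) (\<lambda>x. k x + s *\<^sub>R v x) x)
      has_vector_derivative (transpose (W x) ** g x + transpose (g x) ** W x, column None (W x) - vector_derivative X (at x),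
        vector_derivative W (at x) - (W x ** curvature_matrix (k x) + g x ** curvature_matrix (v x)))) (at 0)"
    if X: "smooth_loop L X" and W: "smooth_loop L W" for x
  proof -
    have X': "vector_derivative (\<lambda>x. \<gamma> x + s *\<^sub>R X x) (at x) = vector_derivative \<gamma> (at x) + s *\<^sub>R vector_derivative X (at x)" for s
      by (intro vector_derivative_at has_vector_derivative_add smooth_loop_has_derivative[OF \<gamma>]
          bounded_linear.has_vector_derivative[OF bounded_linear_scaleR_right] smooth_loop_has_derivative[OF X])
    have W': "vector_derivative (\<lambda>x. g x + s *\<^sub>R W x) (at x) = vector_derivative g (at x) + s *\<^sub>R vector_derivative W (at x)" for s
      by (intro vector_derivative_at has_vector_derivative_add smooth_loop_has_derivative[OF g]
          bounded_linear.has_vector_derivative[OF bounded_linear_scaleR_right] smooth_loop_has_derivative[OF W])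
    have gW: "((\<lambda>s. g x + s *\<^sub>R W x) has_vector_derivative W x) (at 0)" by (rule has_vector_derivative_affine)
    have 1: "((\<lambda>s. transpose (g x + s *\<^sub>R W x) ** (g x + s *\<^sub>R W x) - mat 1) has_vector_derivative
        (transpose (W x) ** g x + transpose (g x) ** W x) - 0) (at 0)"
      using has_vector_derivative_diff[OF has_vector_derivative_matrix_mult[OF has_vector_derivative_transpose[OF gW] gW]
          has_vector_derivative_const] by simp
    have "((\<lambda>s. column None (g x) + s *\<^sub>R column None (W x) - (vector_derivative \<gamma> (at x) + s *\<^sub>R vector_derivative X (at x)))
        has_vector_derivative column None (W x) - vector_derivative X (at x)) (at 0)"
      by (intro has_vector_derivative_diff has_vector_derivative_affine)
    moreover have "column None (g x + s *\<^sub>R W x) = column None (g x) + s *\<^sub>R column None (W x)" for s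
      by (simp add: column_def vec_eq_iff)
    ultimately have 2: "((\<lambda>s. column None (g x + s *\<^sub>R W x) - (vector_derivative \<gamma> (at x) + s *\<^sub>R vector_derivative X (at x)))
        has_vector_derivative column None (W x) - vector_derivative X (at x)) (at 0)" by simp
    have "((\<lambda>s. curvature_matrix (k x) + s *\<^sub>R curvature_matrix (v x)) has_vector_derivative curvature_matrix (v x)) (at 0)"
      by (rule has_vector_derivative_affine)
    from has_vector_derivative_diff[OF has_vector_derivative_affine[of "vector_derivative g (at x)" "vector_derivative W (at x)" 0]
        has_vector_derivative_matrix_mult[OF gW this]]
    have 3: "((\<lambda>s. vector_derivative g (at x) + s *\<^sub>R vector_derivative W (at x) - (g x + s *\<^sub>R W x) ** curvature_matrix (k x + s *\<^sub>R v x))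
        has_vector_derivative vector_derivative W (at x) - (W x ** curvature_matrix (k x) + g x ** curvature_matrix (v x))) (at 0)"
      by (simp add: curvature_matrix_linear)
    show ?thesis
      unfolding frame_residual_def X' W'
      using has_vector_derivative_Pair[OF 1[unfolded diff_zero] has_vector_derivative_Pair[OF 2 3]] by simp
  qed
  note zero_iff = this[THEN has_vector_derivative_zero_iff]
  show ?thesis
    unfolding frame_tangent_def by (simp add: zero_iff cong: conj_cong) (auto simp: zero_prod_def)
qed


context
  fixes L :: real and k z :: "real \<Rightarrow> real ^ ('m::finite)" and \<gamma> X :: "real \<Rightarrow> real ^ ('m::finite) option"
    and g :: "real \<Rightarrow> real ^ ('m::finite) option ^ ('m::finite) option"
  assumes \<gamma>: "smooth_loop L \<gamma>" and frame: "parallel_frame L \<gamma> g k"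
    and X: "smooth_loop L X" and z: "smooth_loop L z" and X': "\<And>x. vector_derivative X (at x) = g x *v frame_vec 0 (z x)"
begin

text \<open>Write W = g A. Then A is skew with first column (0, z), so its only freedom is the lower
  right block \<theta>. With K(w) for \<open>curvature_matrix w\<close>, the linearized frame
  equation is A_x = A K(k) - K(k) A + K(v): its lower right block says that \<theta> is an
  antiderivative in the sense of \<open>is_xi\<close>, and its first column says v = z_x - \<theta>
  k.\<close>

lemma dGam_imp_xi:
  assumes "v \<in> dGam L \<gamma> g k X"
  shows "\<exists>\<theta>. is_xi L k z \<theta> \<and> v = (\<lambda>x. vector_derivative z (at x) - \<theta> x *v k x)"
proof -
  note F = parallel_frameD[OF frame]
  obtain W where W: "smooth_loop L W" and v: "smooth_loop L v"
    and skew: "\<And>x. transpose (W x) ** g x + transpose (g x) ** W x = 0"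
    and col: "\<And>x. column None (W x) = g x *v frame_vec 0 (z x)"
    and dW: "\<And>x. vector_derivative W (at x) = W x ** curvature_matrix (k x) + g x ** curvature_matrix (v x)"
    using assms unfolding dGam_def frame_tangent_iff[OF \<gamma> F(1)] X' by blast
  define A where "A x = transpose (g x) ** W x" for x
  define \<theta> where "\<theta> x = (\<chi> i j. A x $ Some i $ Some j)" for x
  have A: "smooth_loop L A" unfolding A_def[abs_def] by (intro smooth_loop_matrix_mult smooth_loop_transpose F W)
  have At: "transpose (A x) = - A x" for x
    using skew[of x] by (simp add: A_def matrix_transpose_mul eq_neg_iff_add_eq_0)
  have Ask: "A x $ p $ q = - (A x $ q $ p)" for x p q
    using arg_cong[OF At[of x], of "\<lambda>M. M $ q $ p"] by (simp add: transpose_def)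
  have Acol: "A x $ p $ None = frame_vec 0 (z x) $ p" for x p
  proof -
    have "A x $ p $ None = (transpose (g x) *v column None (W x)) $ p"
      by (simp add: A_def matrix_matrix_mult_def matrix_vector_mult_def column_def)
    also have "\<dots> = frame_vec 0 (z x) $ p" by (simp add: col matrix_vector_mul_assoc F)
    finally show ?thesis .
  qed
  have Ab: "A x = frame_block (z x) (\<theta> x)" for x
    unfolding vec_eq_iff
  proof (intro allI)
    fix p q show "A x $ p $ q = frame_block (z x) (\<theta> x) $ p $ q"
    proof (cases p)
      case None
      then show ?thesis using Ask[of x None q] Acol[of x] by (cases q) auto
    next
      case (Some i)
      then show ?thesis using Acol[of x] by (cases q) (auto simp: \<theta>_def)
    qed
  qed
  have dA: "(A has_vector_derivative A x ** curvature_matrix (k x) - curvature_matrix (k x) ** A x + curvature_matrix (v x)) (at x)" for x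
  proof -
    have "(A has_vector_derivative transpose (g x ** curvature_matrix (k x)) ** W x +
        transpose (g x) ** (W x ** curvature_matrix (k x) + g x ** curvature_matrix (v x))) (at x)"
      unfolding A_def[abs_def]
      using smooth_loop_has_derivative[OF W, of x] unfolding dW
      by (intro has_vector_derivative_matrix_mult has_vector_derivative_transpose F)
    moreover have "transpose (g x ** curvature_matrix (k x)) ** W x +
        transpose (g x) ** (W x ** curvature_matrix (k x) + g x ** curvature_matrix (v x)) =
        A x ** curvature_matrix (k x) - curvature_matrix (k x) ** A x + curvature_matrix (v x)"
      by (simp add: matrix_transpose_mul transpose_curvature_matrix matrix_ring A_def F)
    ultimately show ?thesis by simp
  qed
  then have dAc: "((\<lambda>x. frame_block (z x) (\<theta> x) $ p $ q) has_vector_derivative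
      (frame_block (z x) (\<theta> x) ** curvature_matrix (k x) - curvature_matrix (k x) ** frame_block (z x) (\<theta> x)
        + curvature_matrix (v x)) $ p $ q) (at x)" for p q x
    unfolding Ab[symmetric] by (simp only: has_vector_derivative_vec)
  have "is_xi L k z \<theta>"
    unfolding is_xi_def
  proof (intro conjI allI)
    show "smooth_loop L \<theta>" using A by (simp add: \<theta>_def smooth_loop_vec)
    show "skew (\<theta> x)" for x
      unfolding skew_iff \<theta>_def vec_lambda_beta by (intro allI Ask)
    show "(\<theta> has_vector_derivative outer (k x) (z x) - outer (z x) (k x)) (at x)" for x
      using dAc[of "Some _" "Some _" x]
      by (simp add: has_vector_derivative_vec matrix_matrix_mult_def sum_option outer_def algebra_simps)
  qed
  moreover have "v = (\<lambda>x. vector_derivative z (at x) - \<theta> x *v k x)"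
  proof
    fix x
    have "(z has_vector_derivative \<theta> x *v k x + v x) (at x)"
      using dAc[of "Some _" None x]
      by (simp add: has_vector_derivative_vec matrix_matrix_mult_def sum_option matrix_vector_mult_def)
    then show "v x = vector_derivative z (at x) - \<theta> x *v k x" by (simp add: vector_derivative_at)
  qed
  ultimately show ?thesis by blast
qed

lemma xi_imp_dGam:
  assumes \<theta>: "is_xi L k z \<theta>"
  shows "(\<lambda>x. vector_derivative z (at x) - \<theta> x *v k x) \<in> dGam L \<gamma> g k X"
proof -
  note F = parallel_frameD[OF frame]
  define v where "v = (\<lambda>x. vector_derivative z (at x) - \<theta> x *v k x)"
  \<comment> \<open>The form of A forced in the converse direction is used as the ansatz.\<close>
  define A where "A x = frame_block (z x) (\<theta> x)" for x
  define W where "W x = g x ** A x" for x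
  have th: "smooth_loop L \<theta>" "\<And>x i j. \<theta> x $ i $ j = - (\<theta> x $ j $ i)"
    "\<And>x. (\<theta> has_vector_derivative outer (k x) (z x) - outer (z x) (k x)) (at x)"
    using \<theta> unfolding is_xi_def skew_iff by blast+
  have "smooth_loop L (\<lambda>x. A x $ p $ q)" for p q
    using th(1) z by (cases p; cases q) (simp_all add: A_def smooth_loop_const smooth_loop_vec smooth_loop_minus)
  then have A: "smooth_loop L A" by (simp add: smooth_loop_vec)
  have v: "smooth_loop L v"
    unfolding v_def by (intro smooth_loop_diff smooth_loop_derivative smooth_loop_matrix_vector_mult z th(1) F(2))
  have W: "smooth_loop L W" unfolding W_def[abs_def] by (intro smooth_loop_matrix_mult F(1) A)
  have At: "transpose (A x) = - A x" for x
    unfolding vec_eq_iff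
  proof (intro allI)
    fix p q show "transpose (A x) $ p $ q = (- A x) $ p $ q"
      by (cases p; cases q) (simp_all add: transpose_def A_def, rule th(2))
  qed
  have zc: "((\<lambda>x. z x $ i) has_vector_derivative vector_derivative z (at x) $ i) (at x)" for i x
    using smooth_loop_has_derivative[OF z, of x] by (simp only: has_vector_derivative_vec)
  have thc: "((\<lambda>x. \<theta> x $ i $ j) has_vector_derivative k x $ i * z x $ j - z x $ i * k x $ j) (at x)" for i j x
    using th(3)[of x] by (simp add: has_vector_derivative_vec outer_def)
  have dA: "(A has_vector_derivative A x ** curvature_matrix (k x) - curvature_matrix (k x) ** A x + curvature_matrix (v x)) (at x)" (is "(A has_vector_derivative ?D) _") for x
  proof -
    let ?D = "A x ** curvature_matrix (k x) - curvature_matrix (k x) ** A x + curvature_matrix (v x)"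
    have "((\<lambda>x. A x $ p $ q) has_vector_derivative ?D $ p $ q) (at x)" for p q
    proof -
      consider "p = None" "q = None" | i where "p = None" "q = Some i" | i where "p = Some i" "q = None"
        | i j where "p = Some i" "q = Some j" by (metis option.exhaust)
      then show ?thesis
      proof cases
        case 1
        then show ?thesis
          by (simp add: A_def matrix_matrix_mult_def sum_option sum_negf mult.commute)
      next
        case (2 i)
        have "(\<Sum>l\<in>UNIV. k x $ l * \<theta> x $ l $ i) = - (\<Sum>l\<in>UNIV. \<theta> x $ i $ l * k x $ l)"
          unfolding sum_negf[symmetric] by (intro sum.cong refl) (subst th(2), simp)
        then have "?D $ p $ q = - (vector_derivative z (at x) $ i)"
          by (simp add: 2 A_def v_def matrix_matrix_mult_def sum_option sum_negf matrix_vector_mult_def)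
        then show ?thesis using has_vector_derivative_minus[OF zc[of i x]] by (simp add: 2 A_def)
      next
        case (3 i)
        have "?D $ p $ q = vector_derivative z (at x) $ i"
          by (simp add: 3 A_def v_def matrix_matrix_mult_def sum_option matrix_vector_mult_def)
        then show ?thesis using zc[of i x] by (simp add: 3 A_def)
      next
        case (4 i j)
        have "?D $ p $ q = k x $ i * z x $ j - z x $ i * k x $ j"
          by (simp add: 4 A_def matrix_matrix_mult_def sum_option)
        then show ?thesis using thc[of i j x] by (simp add: 4 A_def)
      qed
    qed
    then show ?thesis by (simp only: has_vector_derivative_vec simp_thms)
  qed
  have "frame_tangent L \<gamma> g k X W v"
    unfolding frame_tangent_iff[OF \<gamma> F(1)] X'
  proof (intro conjI allI X W v)
    fix x
    have "transpose (W x) ** g x = transpose (A x) ** (transpose (g x) ** g x)"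
      by (simp add: W_def matrix_transpose_mul matrix_mul_assoc)
    moreover have "transpose (g x) ** W x = A x" by (simp add: W_def matrix_mul_assoc F)
    ultimately show "transpose (W x) ** g x + transpose (g x) ** W x = 0" by (simp add: F At)
    have "column None (A x) = frame_vec 0 (z x)"
      unfolding vec_eq_iff by (auto simp: column_def A_def frame_vec_def frame_block_def split: option.split)
    moreover have "column None (W x) = g x *v column None (A x)"
      by (simp add: W_def column_def vec_eq_iff matrix_matrix_mult_def matrix_vector_mult_def)
    ultimately show "column None (W x) = g x *v frame_vec 0 (z x)" by simp
    show "vector_derivative W (at x) = W x ** curvature_matrix (k x) + g x ** curvature_matrix (v x)"
    proof (rule vector_derivative_at)
      have "(W has_vector_derivative g x ** curvature_matrix (k x) ** A x +
          g x ** (A x ** curvature_matrix (k x) - curvature_matrix (k x) ** A x + curvature_matrix (v x))) (at x)"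
        unfolding W_def[abs_def] by (intro has_vector_derivative_matrix_mult F dA)
      then show "(W has_vector_derivative W x ** curvature_matrix (k x) + g x ** curvature_matrix (v x)) (at x)"
        by (simp add: W_def matrix_ring)
    qed
  qed
  then show ?thesis unfolding dGam_def v_def by blast
qed

lemma dGam_eq: "dGam L \<gamma> g k X = {\<lambda>x. vector_derivative z (at x) - \<theta> x *v k x | \<theta>. is_xi L k z \<theta>}"
  using dGam_imp_xi xi_imp_dGam by blast

end

section \<open>The constant of integration in \<xi>\<close>

lemma transpose_add: "transpose (A + B :: 'a::ab_group_add ^ 'n ^ 'm) = transpose A + transpose B"
  and transpose_diff: "transpose (A - B :: 'a::ab_group_add ^ 'n ^ 'm) = transpose A - transpose B"
  and transpose_minus: "transpose (- A :: 'a::ab_group_add ^ 'n ^ 'm) = - transpose A"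
  by (simp_all add: transpose_def vec_eq_iff)

lemma skew_minus: "skew (- A) \<longleftrightarrow> skew A"
  unfolding skew_def transpose_minus by (rule neg_equal_iff_equal)

lemma is_xi_diff:
  assumes "is_xi L k z \<theta>" "is_xi L k z \<theta>'"
  shows "\<exists>\<Theta>. skew \<Theta> \<and> (\<forall>x. \<theta>' x = \<theta> x + \<Theta>)"
proof -
  have "((\<lambda>x. \<theta>' x - \<theta> x) has_vector_derivative 0) (at x)" for x
  proof -
    have "(\<theta>' has_vector_derivative outer (k x) (z x) - outer (z x) (k x)) (at x)"
      "(\<theta> has_vector_derivative outer (k x) (z x) - outer (z x) (k x)) (at x)"
      using assms by (simp_all add: is_xi_def)
    from has_vector_derivative_diff[OF this] show ?thesis by simp
  qed
  then have "\<theta>' x - \<theta> x = \<theta>' 0 - \<theta> 0" for x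
    by (rule has_vector_derivative_zero_constant[of "\<lambda>x. \<theta>' x - \<theta> x"])
  then have "\<theta>' x = \<theta> x + (\<theta>' 0 - \<theta> 0)" for x by (simp add: algebra_simps)
  moreover have "skew (\<theta>' 0 - \<theta> 0)"
    using assms by (simp add: is_xi_def skew_def transpose_diff algebra_simps)
  ultimately show ?thesis by blast
qed

lemma is_xi_add_const:
  assumes "is_xi L k z \<theta>" "skew \<Theta>"
  shows "is_xi L k z (\<lambda>x. \<theta> x + \<Theta>)"
  unfolding is_xi_def
proof (intro conjI allI)
  show "smooth_loop L (\<lambda>x. \<theta> x + \<Theta>)"
    using assms by (intro smooth_loop_add smooth_loop_const) (simp add: is_xi_def)
  show "skew (\<theta> x + \<Theta>)" for x
    using assms by (simp add: is_xi_def skew_def transpose_add algebra_simps)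
  show "((\<lambda>x. \<theta> x + \<Theta>) has_vector_derivative outer (k x) (z x) - outer (z x) (k x)) (at x)" for x
  proof -
    have "(\<theta> has_vector_derivative outer (k x) (z x) - outer (z x) (k x)) (at x)"
      using assms(1) by (simp add: is_xi_def)
    from has_vector_derivative_add[OF this has_vector_derivative_const] show ?thesis by simp
  qed
qed

text \<open>Two antiderivatives differ by a constant skew \<Theta>, which changes z_x - \<theta> k
  by -\<Theta> k. The ambiguity of \<xi> is therefore exactly the tangent space of the rotation
  orbit.\<close>

lemma tangent_class_Xi:
  assumes "is_xi L k z \<theta>0"
  shows "tangent_class k (Xi L k z) = {\<lambda>x. vector_derivative z (at x) - \<theta> x *v k x | \<theta>. is_xi L k z \<theta>}"
proof -
  define \<theta>1 where "\<theta>1 = (SOME \<xi>. is_xi L k z \<xi>)"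
  have 1: "is_xi L k z \<theta>1" unfolding \<theta>1_def using assms by (rule someI[where P="is_xi L k z"])
  have Xi: "Xi L k z = (\<lambda>x. vector_derivative z (at x) - \<theta>1 x *v k x)" by (simp add: Xi_def \<theta>1_def fun_eq_iff)
  have eq: "(\<lambda>x. Xi L k z x + \<Theta> *v k x) = (\<lambda>x. vector_derivative z (at x) - (\<theta>1 x + (- \<Theta>)) *v k x)" for \<Theta>
    by (simp add: Xi matrix_vector_mult_add_rdistrib matrix_vector_mult_diff_rdistrib algebra_simps)
  show ?thesis
  proof (intro set_eqI iffI)
    fix f assume "f \<in> tangent_class k (Xi L k z)"
    then obtain \<Theta> where "skew \<Theta>" "f = (\<lambda>x. Xi L k z x + \<Theta> *v k x)" by (auto simp: tangent_class_def)
    then show "f \<in> {\<lambda>x. vector_derivative z (at x) - \<theta> x *v k x | \<theta>. is_xi L k z \<theta>}"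
      using is_xi_add_const[OF 1, of "- \<Theta>"] unfolding eq skew_minus mem_Collect_eq
      by (intro exI[of _ "\<lambda>x. \<theta>1 x + - \<Theta>"]) blast
  next
    fix f assume "f \<in> {\<lambda>x. vector_derivative z (at x) - \<theta> x *v k x | \<theta>. is_xi L k z \<theta>}"
    then obtain \<theta> where \<theta>: "is_xi L k z \<theta>" "f = (\<lambda>x. vector_derivative z (at x) - \<theta> x *v k x)" by blast
    obtain \<Theta> where T: "skew \<Theta>" "\<And>x. \<theta> x = \<theta>1 x + \<Theta>" using is_xi_diff[OF 1 \<theta>(1)] by blast
    have "f = (\<lambda>x. Xi L k z x + (- \<Theta>) *v k x)" unfolding eq by (simp add: \<theta>(2) T(2))
    moreover have "skew (- \<Theta>)" using T(1) by (simp only: skew_minus)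
    ultimately show "f \<in> tangent_class k (Xi L k z)" unfolding tangent_class_def by blast
  qed
qed

declare transpose_matrix_vector [simp del]

subsection \<open>The Poisson bracket on rotation invariant functionals\<close>

definition mat_unit :: "'n \<Rightarrow> 'n \<Rightarrow> real ^ 'n ^ 'n" where
  "mat_unit i l = (\<chi> p q. if p = i \<and> q = l then 1 else 0)"

lemma mat_unit_mult: "mat_unit i l ** mat_unit p q = (if l = p then mat_unit i q else 0)"
proof -
  have "(mat_unit i l ** mat_unit p q) $ a $ b = (\<Sum>r\<in>UNIV. if r = l then (if a = i \<and> l = p \<and> b = q then 1 else 0) else 0)" for a b
    unfolding matrix_matrix_mult_def mat_unit_def vec_lambda_beta by (intro sum.cong refl) auto
  then show ?thesis by (simp add: vec_eq_iff mat_unit_def)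
qed

lemma transpose_mat_unit: "transpose (mat_unit i l) = mat_unit l i"
  by (auto simp: transpose_def mat_unit_def vec_eq_iff)

text \<open>For i \<noteq> l, the exponential of s times
  \<open>mat_unit i l - mat_unit l i\<close>.\<close>

definition plane_rotation :: "'n \<Rightarrow> 'n \<Rightarrow> real \<Rightarrow> real ^ 'n ^ 'n" where
  "plane_rotation i l s = mat 1 + (cos s - 1) *\<^sub>R (mat_unit i i + mat_unit l l) + sin s *\<^sub>R (mat_unit i l - mat_unit l i)"

lemma plane_rotation_add:
  assumes "i \<noteq> l"
  shows "plane_rotation i l s ** plane_rotation i l t = plane_rotation i l (s + t)"
proof -
  define P J where "P = mat_unit i i + mat_unit l l" and "J = mat_unit i l - mat_unit l i"
  have PJ: "P ** P = P" "P ** J = J" "J ** P = J" "J ** J = - P"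
    using assms by (simp_all add: P_def J_def matrix_ring mat_unit_mult)
  have sc: "(a *\<^sub>R A) ** B = a *\<^sub>R (A ** B)" "A ** (a *\<^sub>R B) = a *\<^sub>R (A ** B)" for a and A B :: "real ^ 'a ^ 'a"
    by (simp_all add: scalar_matrix_assoc matrix_scalar_ac)
  have "(mat 1 + a *\<^sub>R P + b *\<^sub>R J) ** (mat 1 + c *\<^sub>R P + d *\<^sub>R J) =
      mat 1 + (a + c + a * c - b * d) *\<^sub>R P + (b + d + a * d + b * c) *\<^sub>R J" for a b c d
    by (simp add: matrix_ring sc PJ algebra_simps)
  from this[of "cos s - 1" "sin s" "cos t - 1" "sin t"] show ?thesis
    unfolding plane_rotation_def P_def[symmetric] J_def[symmetric] by (simp add: cos_add sin_add algebra_simps)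
qed

lemma transpose_plane_rotation: "transpose (plane_rotation i l s) = plane_rotation i l (- s)"
proof -
  have "transpose (a *\<^sub>R A) = a *\<^sub>R transpose A" for a and A :: "real ^ 'a ^ 'a"
    by (simp add: transpose_def vec_eq_iff)
  then show ?thesis
    by (simp add: plane_rotation_def transpose_add transpose_diff transpose_mat_unit transpose_mat)
       (simp add: scaleR_diff_right)
qed

lemma plane_rotation_0: "plane_rotation i l 0 = mat 1"
  by (simp add: plane_rotation_def)

text \<open>The determinant is 1 because the rotation is the square of the one by half the angle,
  whose determinant is 1 or -1.\<close>

lemma rotation_plane_rotation:
  assumes "i \<noteq> l"
  shows "rotation_matrix (plane_rotation i l s)"
proof -
  have o: "orthogonal_matrix (plane_rotation i l s)" for s
    by (simp add: orthogonal_matrix transpose_plane_rotation plane_rotation_add[OF assms] plane_rotation_0)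
  have "det (plane_rotation i l s) = det (plane_rotation i l (s / 2)) * det (plane_rotation i l (s / 2))"
    unfolding det_mul[symmetric] plane_rotation_add[OF assms] by simp
  also have "\<dots> = 1" using det_orthogonal_matrix[OF o, of "s / 2"] by auto
  finally show ?thesis using o by (simp add: rotation_matrix_def)
qed

text \<open>Each derivative is a phase shift by pi/2, so one formula serves all orders; the cosine
  is the same sequence started one step later.\<close>

lemma smooth_sin: "smooth (sin :: real \<Rightarrow> real)" and smooth_cos: "smooth (cos :: real \<Rightarrow> real)"
proof -
  have s: "((\<lambda>x. sin (x + real i * (pi / 2))) has_vector_derivative sin (x + real (Suc i) * (pi / 2))) (at x)" for i x
  proof -
    have "((\<lambda>x. sin (x + real i * (pi / 2))) has_real_derivative cos (x + real i * (pi / 2))) (at x)"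
      by (auto intro!: derivative_eq_intros)
    moreover have "x + real (Suc i) * (pi / 2) = (x + real i * (pi / 2)) + pi / 2" by (simp add: algebra_simps)
    moreover have "sin ((x + real i * (pi / 2)) + pi / 2) = cos (x + real i * (pi / 2))"
      by (simp only: sin_add[of "x + real i * (pi / 2)"] sin_pi_half cos_pi_half mult_zero_right mult_1_right add_0)
    ultimately show ?thesis by (simp only: has_real_derivative_iff_has_vector_derivative)
  qed
  show "smooth (sin :: real \<Rightarrow> real)"
    unfolding smooth_def using s by (intro exI[of _ "\<lambda>i x. sin (x + real i * (pi / 2))"]) simp
  have c: "sin (x + real (Suc 0) * (pi / 2)) = cos x" for x by (simp add: sin_add)
  show "smooth (cos :: real \<Rightarrow> real)"
    unfolding smooth_def using s[of "Suc _"] c by (intro exI[of _ "\<lambda>i x. sin (x + real (Suc i) * (pi / 2))"]) (auto simp del: of_nat_Suc)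
qed

lemma l2_inner_commute: "l2_inner L v w = l2_inner L w v"
  by (simp add: l2_inner_def inner_commute)

lemma invariant_functional_gradient:
  assumes "L > 0" "invariant_functional L G" "smooth_loop L k"
  shows "has_gradient L G k (grad L G k)"
  using assms grad_eqI unfolding invariant_functional_def by metis

lemma smooth_loop_grad:
  "L > 0 \<Longrightarrow> invariant_functional L G \<Longrightarrow> smooth_loop L k \<Longrightarrow> smooth_loop L (grad L G k)"
  using invariant_functional_gradient unfolding has_gradient_def by blast

lemma matrix_vector_smooth_loop: "smooth_loop L k \<Longrightarrow> smooth_loop L (\<lambda>x. (M :: real ^ 'n ^ 'm) *v k x)"
  by (rule smooth_loop_bounded_linear[OF bounded_linear_matrix_vector])

text \<open>G is constant along the rotated copies of k, and this curve has velocity J k at 0, with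
  J = \<open>mat_unit i l - mat_unit l i\<close>. It is not a straight line, so the gradient
  property along general smooth families is used.\<close>

lemma gradient_orthogonal_plane_rotation:
  assumes L: "L > 0" and G: "invariant_functional L G" and k: "smooth_loop L k" and il: "i \<noteq> l"
  shows "l2_inner L (grad L G k) (\<lambda>x. (mat_unit i l - mat_unit l i) *v k x) = 0"
proof -
  define P J where "P = mat_unit i i + mat_unit l l" and "J = mat_unit i l - mat_unit l i"
  define \<kappa> where "\<kappa> s x = plane_rotation i l s *v k x" for s x
  have \<kappa>_eq: "\<kappa> = (\<lambda>s x. (k x - P *v k x) + (cos s *\<^sub>R (P *v k x) + sin s *\<^sub>R (J *v k x)))"
    by (simp add: fun_eq_iff \<kappa>_def plane_rotation_def P_def J_def matrix_vector_mult_add_rdistrib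
        matrix_vector_mult_diff_rdistrib scaleR_matrix_vector_assoc[symmetric] algebra_simps)
  have "smooth_family L UNIV \<kappa>"
    unfolding \<kappa>_eq
    by (intro smooth_family_add open_UNIV smooth_family_time_const smooth_family_time_mult smooth_sin smooth_cos
        smooth_loop_diff matrix_vector_smooth_loop k)
  moreover have "\<kappa> 0 = k" by (simp add: fun_eq_iff \<kappa>_def plane_rotation_0)
  moreover have "velocity \<kappa> 0 = (\<lambda>x. J *v k x)"
    unfolding velocity_def
  proof (intro ext vector_derivative_at)
    fix x
    have "((\<lambda>s. (k x - P *v k x) + (cos s *\<^sub>R (P *v k x) + sin s *\<^sub>R (J *v k x))) has_vector_derivative
        0 + ((- sin 0) *\<^sub>R (P *v k x) + cos 0 *\<^sub>R (J *v k x))) (at 0)"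
      by (intro has_vector_derivative_add has_vector_derivative_const
          bounded_linear.has_vector_derivative[OF bounded_linear_scaleR_left])
         (auto simp flip: has_real_derivative_iff_has_vector_derivative intro!: derivative_eq_intros)
    then show "((\<lambda>s. \<kappa> s x) has_vector_derivative J *v k x) (at 0)" by (simp add: \<kappa>_eq)
  qed
  ultimately have "((\<lambda>s. G (\<kappa> s)) has_real_derivative l2_inner L (grad L G k) (\<lambda>x. J *v k x)) (at 0)"
    using invariant_functional_gradient[OF L G k] unfolding has_gradient_def by (metis UNIV_I open_UNIV)
  moreover have "G (\<kappa> s) = G k" for s
  proof -
    \<comment> \<open>Invariance is formulated with the inverse of a rotation, hence the angle
      \<open>- s\<close>.\<close>
    have "\<kappa> s = (\<lambda>x. matrix_inv (plane_rotation i l (- s)) *v k x)"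
      by (simp add: \<kappa>_def fun_eq_iff rotation_matrix_inv(1)[OF rotation_plane_rotation[OF il]] transpose_plane_rotation)
    then show ?thesis using G k rotation_plane_rotation[OF il] by (simp add: invariant_functional_def)
  qed
  ultimately have "((\<lambda>s. G k) has_real_derivative l2_inner L (grad L G k) (\<lambda>x. J *v k x)) (at 0)" by simp
  then show ?thesis unfolding J_def using DERIV_unique DERIV_const by blast
qed

text \<open>The plane rotations generate all directions of the orbit.\<close>

lemma gradient_orthogonal_orbit:
  fixes k :: "real \<Rightarrow> real ^ 'n"
  assumes L: "L > 0" and G: "invariant_functional L G" and k: "smooth_loop L k" and \<Theta>: "skew \<Theta>"
  shows "l2_inner L (grad L G k) (\<lambda>x. \<Theta> *v k x) = 0"
proof -
  define J where "J = (\<lambda>p :: 'n \<times> 'n. mat_unit (fst p) (snd p) - mat_unit (snd p) (fst p))"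
  have w: "smooth_loop L (grad L G k)"
    by (rule smooth_loop_grad[OF L G k])
  \<comment> \<open>Each pair of distinct indices occurs in both orders with the same contribution,
    since \<Theta> and J both change sign; this explains the factor 1/2. For equal indices J
    vanishes.\<close>
  have "(\<Sum>p\<in>UNIV. (\<Theta> $ fst p $ snd p / 2) *\<^sub>R J p) $ a $ b = \<Theta> $ a $ b" for a b
  proof -
    have "((\<Theta> $ i $ l / 2) *\<^sub>R J (i, l)) $ a $ b =
        (if (i, l) = (a, b) then \<Theta> $ a $ b / 2 else 0) - (if (i, l) = (b, a) then \<Theta> $ b $ a / 2 else 0)" for i l
      by (cases "i = a"; cases "l = b"; cases "i = b"; cases "l = a"; simp add: J_def mat_unit_def)
    then have "((\<Theta> $ fst p $ snd p / 2) *\<^sub>R J p) $ a $ b =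
        (if p = (a, b) then \<Theta> $ a $ b / 2 else 0) - (if p = (b, a) then \<Theta> $ b $ a / 2 else 0)" for p
      by (cases p) (simp only: fst_conv snd_conv)
    then have "(\<Sum>p\<in>UNIV. (\<Theta> $ fst p $ snd p / 2) *\<^sub>R J p) $ a $ b =
        (\<Sum>p\<in>UNIV. (if p = (a, b) then \<Theta> $ a $ b / 2 else 0) - (if p = (b, a) then \<Theta> $ b $ a / 2 else 0))"
      by (simp only: sum_component)
    also have "\<dots> = (\<Sum>p\<in>UNIV. (if p = (a, b) then \<Theta> $ a $ b / 2 else 0)) - (\<Sum>p\<in>UNIV. (if p = (b, a) then \<Theta> $ b $ a / 2 else 0))"
      by (rule sum_subtractf)
    also have "\<dots> = \<Theta> $ a $ b / 2 - \<Theta> $ b $ a / 2" by simp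
    also have "\<Theta> $ b $ a = - (\<Theta> $ a $ b)" using \<Theta> unfolding skew_iff by blast
    finally show ?thesis by simp
  qed
  then have \<Theta>_eq: "(\<Sum>p\<in>UNIV. (\<Theta> $ fst p $ snd p / 2) *\<^sub>R J p) = \<Theta>" unfolding vec_eq_iff by blast
  have \<Theta>_mult: "\<Theta> *v v = (\<Sum>p\<in>UNIV. (\<Theta> $ fst p $ snd p / 2) *\<^sub>R (J p *v v))" for v
  proof -
    have lin: "linear (\<lambda>A :: real ^ 'n ^ 'n. A *v v)"
      by (rule linearI) (simp_all add: matrix_vector_mult_add_rdistrib scaleR_matrix_vector_assoc)
    show ?thesis
      using arg_cong[OF \<Theta>_eq, of "\<lambda>A. A *v v"] by (simp only: linear_sum[OF lin] linear_scale[OF lin])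
  qed
  have "l2_inner L (grad L G k) (\<lambda>x. \<Theta> *v k x) =
      integral {0..L} (\<lambda>x. \<Sum>p\<in>UNIV. (\<Theta> $ fst p $ snd p / 2) * (grad L G k x \<bullet> (J p *v k x)))"
    unfolding l2_inner_def by (subst \<Theta>_mult) (simp only: inner_sum_right inner_scaleR_right)
  also have "\<dots> = (\<Sum>p\<in>UNIV. (\<Theta> $ fst p $ snd p / 2) * l2_inner L (grad L G k) (\<lambda>x. J p *v k x))"
    unfolding l2_inner_def
    by (subst integral_sum)
      (simp_all add: integrable_on_mult_right smooth_loop_l2_integrable[OF w] matrix_vector_smooth_loop[OF k])
  also have "\<dots> = 0"
  proof (intro sum.neutral ballI)
    fix p :: "'n \<times> 'n"
    show "(\<Theta> $ fst p $ snd p / 2) * l2_inner L (grad L G k) (\<lambda>x. J p *v k x) = 0"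
    proof (cases "fst p = snd p")
      case True
      then show ?thesis by (simp add: J_def l2_inner_def)
    next
      case False
      then show ?thesis using gradient_orthogonal_plane_rotation[OF L G k] by (simp add: J_def)
    qed
  qed
  finally show ?thesis .
qed

lemma inner_matrix_transpose: "(transpose A *v x) \<bullet> y = x \<bullet> (A *v y)" for A :: "real ^ 'n ^ 'm"
  by (simp add: transpose_matrix_vector dot_lmul_matrix)

text \<open>A family through c^t k is carried by c to a family through k without changing the values
  of G, and c preserves the inner product.\<close>

lemma grad_rotated:
  assumes L: "L > 0" and G: "invariant_functional L G" and k: "smooth_loop L k" and c: "rotation_matrix c"
  shows "grad L G (\<lambda>x. transpose c *v k x) = (\<lambda>x. transpose c *v grad L G k x)"
proof (rule grad_eqI[OF L])
  note w = invariant_functional_gradient[OF L G k]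
  show "smooth_loop L (\<lambda>x. transpose c *v k x)" by (rule matrix_vector_smooth_loop[OF k])
  show "has_gradient L G (\<lambda>x. transpose c *v k x) (\<lambda>x. transpose c *v grad L G k x)"
    unfolding has_gradient_def
  proof (intro conjI allI impI; (elim conjE)?)
    show "smooth_loop L (\<lambda>x. transpose c *v grad L G k x)"
      by (rule matrix_vector_smooth_loop[OF smooth_loop_grad[OF L G k]])
    fix T \<kappa> t assume T: "open T" "t \<in> T" and \<kappa>: "smooth_family L T \<kappa>" and eq: "\<kappa> t = (\<lambda>x. transpose c *v k x)"
    have c\<kappa>: "smooth_family L T (\<lambda>s x. c *v \<kappa> s x)"
      by (rule smooth_family_bounded_linear[OF T(1) bounded_linear_matrix_vector \<kappa>])
    have "(\<lambda>x. c *v \<kappa> t x) = k" by (simp add: eq matrix_vector_mul_assoc rotation_matrix_inv[OF c])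
    then have "((\<lambda>s. G (\<lambda>x. c *v \<kappa> s x)) has_real_derivative l2_inner L (grad L G k) (velocity (\<lambda>s x. c *v \<kappa> s x) t)) (at t)"
      using w T c\<kappa> unfolding has_gradient_def by blast
    moreover have "velocity (\<lambda>s x. c *v \<kappa> s x) t = (\<lambda>x. c *v velocity \<kappa> t x)"
      unfolding velocity_def[of "\<lambda>s x. c *v \<kappa> s x"]
      by (intro ext vector_derivative_at bounded_linear.has_vector_derivative[OF bounded_linear_matrix_vector]
          smooth_family_has_velocity[OF \<kappa> T(2)])
    ultimately have "((\<lambda>s. G (\<lambda>x. c *v \<kappa> s x)) has_real_derivative l2_inner L (\<lambda>x. transpose c *v grad L G k x) (velocity \<kappa> t)) (at t)"
      by (simp add: l2_inner_def inner_matrix_transpose)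
    then show "((\<lambda>s. G (\<kappa> s)) has_real_derivative l2_inner L (\<lambda>x. transpose c *v grad L G k x) (velocity \<kappa> t)) (at t)"
    proof (rule has_field_derivative_transform_within_open[OF _ T])
      fix s assume s: "s \<in> T"
      have "G (\<lambda>x. matrix_inv c *v (c *v \<kappa> s x)) = G (\<lambda>x. c *v \<kappa> s x)"
        using G c smooth_family_slice[OF c\<kappa> s] by (simp add: invariant_functional_def)
      then show "G (\<lambda>x. c *v \<kappa> s x) = G (\<kappa> s)"
        by (simp add: matrix_vector_mul_assoc rotation_matrix_inv[OF c])
    qed
  qed
qed

lemma is_xi_rotated:
  fixes N :: "real ^ 'm ^ 'm"
  assumes xi: "is_xi L k z \<theta>"
  shows "is_xi L (\<lambda>x. N *v k x) (\<lambda>x. N *v z x) (\<lambda>x. N ** \<theta> x ** transpose N)"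
  unfolding is_xi_def
proof (intro conjI allI)
  have th: "smooth_loop L \<theta>" "\<And>x. transpose (\<theta> x) = - \<theta> x"
    "\<And>x. (\<theta> has_vector_derivative outer (k x) (z x) - outer (z x) (k x)) (at x)"
    using xi by (simp_all add: is_xi_def skew_def)
  show "smooth_loop L (\<lambda>x. N ** \<theta> x ** transpose N)"
    by (intro smooth_loop_matrix_mult smooth_loop_const th)
  show "skew (N ** \<theta> x ** transpose N)" for x
    by (simp add: skew_def matrix_transpose_mul th(2) matrix_ring)
  have outer: "N ** outer v w ** transpose N = outer (N *v v) (N *v w)" for v w
    by (simp add: vec_eq_iff matrix_matrix_mult_def matrix_vector_mult_def outer_def transpose_def sum_distrib_right
        sum_distrib_left mult_ac)
  show "((\<lambda>x. N ** \<theta> x ** transpose N) has_vector_derivative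
      outer (N *v k x) (N *v z x) - outer (N *v z x) (N *v k x)) (at x)" for x
  proof -
    have "((\<lambda>x. N ** \<theta> x ** transpose N) has_vector_derivative
        (0 ** \<theta> x + N ** (outer (k x) (z x) - outer (z x) (k x))) ** transpose N + (N ** \<theta> x) ** 0) (at x)"
      by (intro has_vector_derivative_matrix_mult has_vector_derivative_const th(3))
    then show ?thesis by (simp add: matrix_ring outer)
  qed
qed

lemma l2_inner_Xi_well_defined:
  assumes L: "L > 0" and G: "invariant_functional L G" and k: "smooth_loop L k" and z: "smooth_loop L z"
    and xi: "is_xi L k z \<theta>" "is_xi L k z \<theta>'"
  shows "l2_inner L (\<lambda>x. vector_derivative z (at x) - \<theta> x *v k x) (grad L G k) =
    l2_inner L (\<lambda>x. vector_derivative z (at x) - \<theta>' x *v k x) (grad L G k)"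
proof -
  obtain \<Theta> where \<Theta>: "skew \<Theta>" "\<And>x. \<theta>' x = \<theta> x + \<Theta>" using is_xi_diff[OF xi] by blast
  have w: "smooth_loop L (grad L G k)"
    by (rule smooth_loop_grad[OF L G k])
  have "smooth_loop L \<theta>" using xi(1) by (simp add: is_xi_def)
  then have v: "smooth_loop L (\<lambda>x. vector_derivative z (at x) - \<theta> x *v k x)"
    by (intro smooth_loop_diff smooth_loop_derivative smooth_loop_matrix_vector_mult z k)
  have "(\<lambda>x. vector_derivative z (at x) - \<theta>' x *v k x) = (\<lambda>x. (vector_derivative z (at x) - \<theta> x *v k x) - \<Theta> *v k x)"
    by (simp add: \<Theta>(2) matrix_vector_mult_add_rdistrib algebra_simps)
  then show ?thesis
    using l2_inner_diff[OF v matrix_vector_smooth_loop[OF k] w, of \<Theta>] gradient_orthogonal_orbit[OF L G k \<Theta>(1)]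
    by (simp add: l2_inner_commute[of L "\<lambda>x. \<Theta> *v k x"])
qed

text \<open>Settles two choices inside \<open>poisson_hat\<close>: the orbit representative at which
  the bracket is evaluated and the \<xi> picked there. Conjugation by c brings that \<xi> back to k,
  where \<open>l2_inner_Xi_well_defined\<close> compares it with \<theta>. The later
  \<open>hat_eq\<close> does not cover this case, as it requires a functional with
  gradients.\<close>

lemma poisson_rotated:
  assumes L: "L > 0" and H: "invariant_functional L H" and G: "invariant_functional L G" and k: "smooth_loop L k"
    and c: "rotation_matrix c" and xi: "is_xi L k (grad L H k) \<theta>"
  shows "poisson L H G (\<lambda>x. transpose c *v k x) =
    l2_inner L (\<lambda>x. vector_derivative (grad L H k) (at x) - \<theta> x *v k x) (grad L G k)"
proof -
  let ?k = "\<lambda>x. transpose c *v k x" and ?z = "\<lambda>x. transpose c *v grad L H k x"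
  note cc = rotation_matrix_inv[OF c]
  have z: "smooth_loop L (grad L H k)"
    by (rule smooth_loop_grad[OF L H k])
  define \<theta>' where "\<theta>' = (SOME \<xi>. is_xi L ?k ?z \<xi>)"
  have "is_xi L ?k ?z \<theta>'"
    unfolding \<theta>'_def using is_xi_rotated[OF xi] by (rule someI[where P="is_xi L ?k ?z"])
  from is_xi_rotated[OF this, of c] have xi': "is_xi L k (grad L H k) (\<lambda>x. c ** \<theta>' x ** transpose c)"
    by (simp add: matrix_vector_mul_assoc cc)
  have "vector_derivative ?z (at x) = transpose c *v vector_derivative (grad L H k) (at x)" for x
    by (intro vector_derivative_at bounded_linear.has_vector_derivative[OF bounded_linear_matrix_vector]
        smooth_loop_has_derivative[OF z])
  moreover have "\<theta>' x *v (transpose c *v k x) = transpose c *v ((c ** \<theta>' x ** transpose c) *v k x)" for x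
    by (simp add: matrix_vector_mul_assoc matrix_mul_assoc cc)
  ultimately have "Xi L ?k ?z = (\<lambda>x. transpose c *v (vector_derivative (grad L H k) (at x) - (c ** \<theta>' x ** transpose c) *v k x))"
    by (simp add: Xi_def fun_eq_iff \<theta>'_def matrix_vector_mult_diff_distrib)
  then have "poisson L H G ?k = l2_inner L (\<lambda>x. vector_derivative (grad L H k) (at x) - (c ** \<theta>' x ** transpose c) *v k x) (grad L G k)"
    unfolding poisson_def grad_rotated[OF L H k c] grad_rotated[OF L G k c]
    by (simp add: l2_inner_def inner_matrix_transpose matrix_vector_mul_assoc cc)
  also have "\<dots> = l2_inner L (\<lambda>x. vector_derivative (grad L H k) (at x) - \<theta> x *v k x) (grad L G k)"
    by (rule l2_inner_Xi_well_defined[OF L G k z xi' xi])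
  finally show ?thesis .
qed

text \<open>One choice is made in \<open>Gam\<close> and another in \<open>hat\<close>; each changes
  k by a rotation, and so does their composition.\<close>

lemma Gam_representative:
  fixes k :: "real \<Rightarrow> real ^ 'm"
  assumes f: "parallel_frame L \<gamma> g k"
  obtains c where "rotation_matrix c" "(SOME k. k \<in> Gam L \<gamma>) = (\<lambda>x. transpose c *v k x)"
proof -
  define k0 where "k0 = (SOME k. \<exists>g. parallel_frame L \<gamma> g k)"
  have "\<exists>g. parallel_frame L \<gamma> g k0" unfolding k0_def using f by (intro someI[of "\<lambda>k. \<exists>g. parallel_frame L \<gamma> g k"]) blast
  then obtain g0 where g0: "parallel_frame L \<gamma> g0 k0" by blast
  obtain c0 where c0: "rotation_matrix c0" "\<And>x. k0 x = transpose c0 *v k x"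
    by (rule parallel_frames_related[OF f g0]) (rule that)
  have "rotation_matrix (mat 1 :: real ^ 'm ^ 'm)" by (simp add: rotation_matrix_def orthogonal_matrix_id)
  then have "(\<lambda>x. matrix_inv (mat 1) *v k0 x) \<in> Gam L \<gamma>"
    unfolding Gam_def so_orbit_def k0_def[symmetric] by blast
  then have "(SOME k. k \<in> Gam L \<gamma>) \<in> Gam L \<gamma>" by (rule someI[where P="\<lambda>k. k \<in> Gam L \<gamma>"])
  then obtain c1 where c1: "rotation_matrix c1" "(SOME k. k \<in> Gam L \<gamma>) = (\<lambda>x. matrix_inv c1 *v k0 x)"
    unfolding Gam_def so_orbit_def k0_def[symmetric] by blast
  have "rotation_matrix (c0 ** c1)"
    using c0(1) c1(1) by (simp add: rotation_matrix_def orthogonal_matrix_mul det_mul)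
  moreover have "(SOME k. k \<in> Gam L \<gamma>) = (\<lambda>x. transpose (c0 ** c1) *v k x)"
    by (simp add: c1(2) c0(2) rotation_matrix_inv[OF c1(1)] matrix_transpose_mul matrix_vector_mul_assoc)
  ultimately show ?thesis by (rule that)
qed

lemma hat_eq:
  assumes "parallel_frame L \<gamma> g k" "invariant_functional L G"
  shows "hat L G \<gamma> = G k"
proof -
  obtain c where c: "rotation_matrix c" "(SOME k. k \<in> Gam L \<gamma>) = (\<lambda>x. transpose c *v k x)"
    by (rule Gam_representative[OF assms(1)]) (rule that)
  then show ?thesis
    using assms(2) parallel_frameD(2)[OF assms(1)]
    by (simp add: hat_def invariant_functional_def flip: rotation_matrix_inv(1)[OF c(1)])
qed

subsection \<open>Airy curve flows\<close>

lemma airy_field_altdef: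
  "airy_field j g k = (\<lambda>x. g x *v frame_vec (y_coeff (2 * int j - 3) k x) (eta_coeff (2 * int j - 3) k x))"
  by (simp add: fun_eq_iff airy_field_def vec_eq_iff matrix_vector_mult_def sum_option column_def mult.commute)

text \<open>The normal part of the frame is multiplied by c and \<eta> by its inverse, while y is
  unchanged; this is the equivariance in \<open>coeffs_rotated\<close>.\<close>

lemma airy_field_frame_independent:
  fixes k k' :: "real \<Rightarrow> real ^ 'm"
  assumes f: "parallel_frame L \<gamma> g k" and f': "parallel_frame L \<gamma> g' k'" and j: "j \<ge> 1"
  shows "airy_field j g' k' = airy_field j g k"
proof -
  obtain c where c: "rotation_matrix c" "\<And>x. g' x = g x ** unit_block c" "\<And>x. k' x = transpose c *v k x"
    by (rule parallel_frames_related[OF f f']) (rule that)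
  note cc = rotation_matrix_inv[OF c(1)]
  have k': "k' = (\<lambda>x. transpose c *v k x)" using c(3) by auto
  have M: "transpose (transpose c) ** transpose c = mat 1" by (simp add: cc)
  have block: "unit_block c *v frame_vec y \<eta> = frame_vec y (c *v \<eta>)" for y \<eta>
    unfolding vec_eq_iff
  proof
    fix p show "(unit_block c *v frame_vec y \<eta>) $ p = frame_vec y (c *v \<eta>) $ p"
      by (cases p) (simp_all add: matrix_vector_mult_def sum_option)
  qed
  show ?thesis
    unfolding airy_field_altdef k' c(2)
    using j by (simp add: coeffs_rotated[OF parallel_frameD(2)[OF f] M] block cc matrix_vector_mul_assoc
        flip: matrix_vector_mul_assoc[of "g _" "unit_block c"])
qed

text \<open>The tangential part y_x - k.\<eta> vanishes, which is the infinitesimal preservation of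
  arc length, and the normal part \<eta>_x + y k is z.\<close>

lemma airy_field_smooth_derivative:
  assumes f: "parallel_frame L \<gamma> g k" and j: "j \<ge> 1"
  shows "smooth_loop L (airy_field j g k)"
    "vector_derivative (airy_field j g k) (at x) = g x *v frame_vec 0 (z_coeff (2 * int j - 2) k x)"
proof -
  note F = parallel_frameD[OF f]
  let ?m = "2 * int j - 3"
  let ?v = "\<lambda>x. frame_vec (y_coeff ?m k x) (eta_coeff ?m k x)"
  have m: "odd ?m" "?m \<ge> -1" "?m + 1 = 2 * int j - 2" using j by auto
  note d = coeff_derivatives(1,2)[OF F(2) m(1,2), unfolded m(3)]
  have "smooth_loop L (\<lambda>x. ?v x $ p)" for p
    using smooth_coeffs(1,2)[OF F(2), of ?m] by (cases p) (simp_all add: smooth_loop_vec)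
  then have v: "smooth_loop L ?v" by (simp add: smooth_loop_vec)
  show "smooth_loop L (airy_field j g k)"
    unfolding airy_field_altdef by (intro smooth_loop_matrix_vector_mult F v)
  have "((\<lambda>x. ?v x $ p) has_vector_derivative
      frame_vec (k x \<bullet> eta_coeff ?m k x) (z_coeff (2 * int j - 2) k x - y_coeff ?m k x *\<^sub>R k x) $ p) (at x)" for p
    using d[of x] by (cases p) (simp_all add: has_vector_derivative_vec)
  then have "(?v has_vector_derivative
      frame_vec (k x \<bullet> eta_coeff ?m k x) (z_coeff (2 * int j - 2) k x - y_coeff ?m k x *\<^sub>R k x)) (at x)" (is "(_ has_vector_derivative ?v') _")
    by (simp only: has_vector_derivative_vec simp_thms)
  then have "((\<lambda>x. g x *v ?v x) has_vector_derivative (g x ** curvature_matrix (k x)) *v ?v x + g x *v ?v') (at x)"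
    by (intro has_vector_derivative_matrix_vector_mult F)
  moreover have "curvature_matrix (k x) *v ?v x + ?v' = frame_vec 0 (z_coeff (2 * int j - 2) k x)"
    unfolding vec_eq_iff
  proof
    fix p show "(curvature_matrix (k x) *v ?v x + ?v') $ p = frame_vec 0 (z_coeff (2 * int j - 2) k x) $ p"
      by (cases p) (simp_all add: matrix_vector_mult_def sum_option sum_negf inner_vec_def mult.commute)
  qed
  then have "(g x ** curvature_matrix (k x)) *v ?v x + g x *v ?v' = g x *v frame_vec 0 (z_coeff (2 * int j - 2) k x)"
    by (simp flip: matrix_vector_mul_assoc matrix_vector_right_distrib)
  ultimately show "vector_derivative (airy_field j g k) (at x) = g x *v frame_vec 0 (z_coeff (2 * int j - 2) k x)"
    unfolding airy_field_altdef by (intro vector_derivative_at) simp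
qed

lemma airy_field_hamiltonian:
  fixes k0 :: "real \<Rightarrow> real ^ 'm"
  assumes L: "L > 0" and j: "j \<ge> 1" and \<gamma>: "smooth_loop L \<gamma>" and f0: "parallel_frame L \<gamma> g0 k0"
  shows "hamiltonian_at L (F_functional L j) \<gamma> (airy_field j g0 k0)"
  unfolding hamiltonian_at_def
proof (intro allI impI)
  fix g and k :: "real \<Rightarrow> real ^ 'm" assume f: "parallel_frame L \<gamma> g k"
  note k = parallel_frameD(2)[OF f]
  define z where "z = z_coeff (2 * int j - 2) k"
  have gr: "grad L (F_functional L j) k = z"
    unfolding z_def by (rule grad_eqI[OF L k F_functional_gradient[OF L j k]])
  have z: "smooth_loop L z" unfolding z_def by (rule smooth_coeffs(3)[OF k])
  note inv = F_functional_invariant[OF L j, where 'm='m]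
  obtain \<theta> where xi: "is_xi L k z \<theta>" using is_xi_coeff[OF k j] unfolding z_def by blast
  have X: "airy_field j g0 k0 = airy_field j g k" by (rule airy_field_frame_independent[OF f f0 j])
  have dG: "dGam L \<gamma> g k (airy_field j g0 k0) = {\<lambda>x. vector_derivative z (at x) - \<theta> x *v k x | \<theta>. is_xi L k z \<theta>}"
    unfolding X by (rule dGam_eq[OF \<gamma> f airy_field_smooth_derivative(1)[OF f j] z])
      (simp add: airy_field_smooth_derivative(2)[OF f j] z_def)
  have "l2_inner L (grad L G k) v = poisson_hat L (F_functional L j) G \<gamma>"
    if G: "invariant_functional L G" and v: "v \<in> dGam L \<gamma> g k (airy_field j g0 k0)" for G v
  proof -
    obtain \<theta>' where t: "is_xi L k z \<theta>'" "v = (\<lambda>x. vector_derivative z (at x) - \<theta>' x *v k x)" using v unfolding dG by blast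
    obtain c where c: "rotation_matrix c" "(SOME k. k \<in> Gam L \<gamma>) = (\<lambda>x. transpose c *v k x)"
      by (rule Gam_representative[OF f]) (rule that)
    have "poisson_hat L (F_functional L j) G \<gamma> = l2_inner L v (grad L G k)"
      using poisson_rotated[OF L inv G k c(1), of \<theta>'] t by (simp add: poisson_hat_def hat_def c(2) gr)
    then show ?thesis by (simp only: l2_inner_commute[of L v])
  qed
  then show "(\<exists>\<xi>. is_xi L k (grad L (F_functional L j) k) \<xi>) \<and>
        dGam L \<gamma> g k (airy_field j g0 k0) = tangent_class k (Xi L k (grad L (F_functional L j) k)) \<and>
        (\<forall>G. invariant_functional L G \<longrightarrow>
           (\<forall>v \<in> dGam L \<gamma> g k (airy_field j g0 k0). l2_inner L (grad L G k) v = poisson_hat L (F_functional L j) G \<gamma>))"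
    using xi unfolding gr tangent_class_Xi[OF xi] dG by blast
qed

text \<open>The frame equations hold at all times in the open set T, so they may be differentiated
  in t; the mixed derivatives of the curve and of the frame are exchanged by
  \<open>velocity_dx\<close>.\<close>

lemma velocity_frame_tangent:
  fixes k :: "real \<Rightarrow> real \<Rightarrow> real ^ 'm"
  assumes T: "open T" and t: "t \<in> T" and \<gamma>: "smooth_family L T \<gamma>" and f: "parallel_frame_family L T \<gamma> g k"
  shows "velocity k t \<in> dGam L (\<gamma> t) (g t) (k t) (velocity \<gamma> t)"
proof -
  have g: "smooth_family L T g" and k: "smooth_family L T k" and fr: "\<And>s. s \<in> T \<Longrightarrow> parallel_frame L (\<gamma> s) (g s) (k s)"
    using f by (auto simp: parallel_frame_family_def)
  note dg = smooth_family_has_velocity[OF g t] and dk = smooth_family_has_velocity[OF k t]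
  have sm: "smooth_loop L (\<gamma> t)" "smooth_loop L (g t)" "smooth_loop L (velocity \<gamma> t)" "smooth_loop L (velocity g t)" "smooth_loop L (velocity k t)"
    using smooth_family_slice[OF \<gamma> t] smooth_family_slice[OF g t] smooth_family_slice[OF smooth_family_velocity[OF T \<gamma>] t]
      smooth_family_slice[OF smooth_family_velocity[OF T g] t] smooth_family_slice[OF smooth_family_velocity[OF T k] t] .
  have "frame_tangent L (\<gamma> t) (g t) (k t) (velocity \<gamma> t) (velocity g t) (velocity k t)"
    unfolding frame_tangent_iff[OF sm(1,2)]
  proof (intro conjI allI sm)
    fix x
    have "((\<lambda>s. transpose (g s x) ** g s x) has_vector_derivative transpose (velocity g t x) ** g t x + transpose (g t x) ** velocity g t x) (at t)"
      by (intro has_vector_derivative_matrix_mult has_vector_derivative_transpose dg)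
    then have "((\<lambda>s. mat 1) has_vector_derivative transpose (velocity g t x) ** g t x + transpose (g t x) ** velocity g t x) (at t)"
      by (rule has_vector_derivative_transform_within_open[OF _ T t]) (simp add: parallel_frameD(3)[OF fr])
    then show "transpose (velocity g t x) ** g t x + transpose (g t x) ** velocity g t x = 0"
      using vector_derivative_unique_at has_vector_derivative_const by blast
    have "((\<lambda>s. column None (g s x)) has_vector_derivative column None (velocity g t x)) (at t)"
      using dg[of x] by (simp add: has_vector_derivative_vec column_def)
    then have "((\<lambda>s. dx \<gamma> s x) has_vector_derivative column None (velocity g t x)) (at t)"
      by (rule has_vector_derivative_transform_within_open[OF _ T t]) (simp add: parallel_frameD(6)[OF fr] dx_def)
    then have "column None (velocity g t x) = velocity (dx \<gamma>) t x"
      unfolding velocity_def[of "dx \<gamma>"] by (rule vector_derivative_at[symmetric])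
    then show "column None (velocity g t x) = vector_derivative (velocity \<gamma> t) (at x)"
      unfolding velocity_dx[OF T \<gamma> t] by (simp add: dx_def)
    have "((\<lambda>s. curvature_matrix (k s x)) has_vector_derivative curvature_matrix (velocity k t x)) (at t)"
      unfolding has_vector_derivative_vec
    proof (intro allI)
      fix p q
      show "((\<lambda>s. curvature_matrix (k s x) $ p $ q) has_vector_derivative curvature_matrix (velocity k t x) $ p $ q) (at t)"
        using dk[of x] by (cases p; cases q) (simp_all add: has_vector_derivative_vec has_vector_derivative_minus)
    qed
    from has_vector_derivative_matrix_mult[OF dg this]
    have "((\<lambda>s. dx g s x) has_vector_derivative velocity g t x ** curvature_matrix (k t x) + g t x ** curvature_matrix (velocity k t x)) (at t)"
      by (rule has_vector_derivative_transform_within_open[OF _ T t])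
        (simp add: dx_def vector_derivative_at[OF parallel_frameD(7)[OF fr]])
    then have "velocity (dx g) t x = velocity g t x ** curvature_matrix (k t x) + g t x ** curvature_matrix (velocity k t x)"
      unfolding velocity_def[of "dx g"] by (rule vector_derivative_at)
    then show "vector_derivative (velocity g t) (at x) = velocity g t x ** curvature_matrix (k t x) + g t x ** curvature_matrix (velocity k t x)"
      unfolding velocity_dx[OF T g t] by (simp add: dx_def)
  qed
  then show ?thesis unfolding dGam_def by blast
qed

lemma airy_flow_hamiltonian:
  fixes \<gamma> :: "real \<Rightarrow> real \<Rightarrow> real ^ ('m::finite) option"
  assumes L: "L > 0" and j: "j \<ge> 1" and T: "open T" and flow: "airy_curve_flow L j T \<gamma>"
  shows "hamiltonian_flow L (F_functional L j) T \<gamma>"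
proof -
  obtain g k where \<gamma>: "smooth_family L T \<gamma>" "\<And>t. t \<in> T \<Longrightarrow> \<gamma> t \<in> curves L"
    and fam: "parallel_frame_family L T \<gamma> g k"
    and vel: "\<And>t x. t \<in> T \<Longrightarrow> velocity \<gamma> t x = airy_field j (g t) (k t) x"
    using flow unfolding airy_curve_flow_def by blast
  have fr: "parallel_frame L (\<gamma> t) (g t) (k t)" if "t \<in> T" for t using fam that by (simp add: parallel_frame_family_def)
  have k: "smooth_family L T k" using fam by (simp add: parallel_frame_family_def)
  have ham: "hamiltonian_at L (F_functional L j) (\<gamma> t) (velocity \<gamma> t)" if t: "t \<in> T" for t
  proof -
    have "velocity \<gamma> t = airy_field j (g t) (k t)" using vel[OF t] by auto
    then show ?thesis using airy_field_hamiltonian[OF L j smooth_family_slice[OF \<gamma>(1) t] fr[OF t]] by simp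
  qed
  have tangent: "velocity k' t \<in> tangent_class (k' t) (Xi L (k' t) (grad L (F_functional L j) (k' t)))"
    if "t \<in> T" "parallel_frame_family L T \<gamma> g' k'" for g' k' t
    using velocity_frame_tangent[OF T that(1) \<gamma>(1) that(2)] ham[OF that(1)] that
    unfolding hamiltonian_at_def parallel_frame_family_def by blast
  have "((\<lambda>s. hat L G (\<gamma> s)) has_real_derivative poisson_hat L (F_functional L j) G (\<gamma> t)) (at t)"
    if t: "t \<in> T" and G: "invariant_functional L G" for t G
  proof -
    have "l2_inner L (grad L G (k t)) (velocity k t) = poisson_hat L (F_functional L j) G (\<gamma> t)"
      using velocity_frame_tangent[OF T t \<gamma>(1) fam] ham[OF t] fr[OF t] G unfolding hamiltonian_at_def by blast
    moreover have "((\<lambda>s. G (k s)) has_real_derivative l2_inner L (grad L G (k t)) (velocity k t)) (at t)"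
      using invariant_functional_gradient[OF L G smooth_family_slice[OF k t]] T t k unfolding has_gradient_def by blast
    ultimately have "((\<lambda>s. G (k s)) has_real_derivative poisson_hat L (F_functional L j) G (\<gamma> t)) (at t)" by simp
    \<comment> \<open>The principal curvatures of any smooth family of frames compute the
      observable, since \<open>hat_eq\<close> is independent of the frame at each time.\<close>
    then show ?thesis
      by (rule has_field_derivative_transform_within_open[OF _ T t]) (simp add: hat_eq[OF fr G])
  qed
  then show ?thesis unfolding hamiltonian_flow_def using \<gamma> ham tangent by blast
qed

theorem proposition4p11:
  fixes L :: real and j :: nat
  assumes "L > 0" and "j \<ge> 1"
  shows "invariant_functional L (F_functional L j :: (real \<Rightarrow> real ^ 'm) \<Rightarrow> real) \<and>
    (\<exists>X :: (real \<Rightarrow> real ^ 'm option) \<Rightarrow> (real \<Rightarrow> real ^ 'm option).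
       hamiltonian_field L (F_functional L j) X \<and>
       (\<forall>\<gamma> \<in> curves L. \<forall>g k. parallel_frame L \<gamma> g k \<longrightarrow> X \<gamma> = airy_field j g k)) \<and>
    (\<forall>T (\<gamma> :: real \<Rightarrow> real \<Rightarrow> real ^ 'm option).
       open T \<and> airy_curve_flow L j T \<gamma> \<longrightarrow> hamiltonian_flow L (F_functional L j) T \<gamma>)"
proof (intro conjI allI impI; (elim conjE)?)
  show "invariant_functional L (F_functional L j :: (real \<Rightarrow> real ^ 'm) \<Rightarrow> real)"
    by (rule F_functional_invariant[OF assms])
  \<comment> \<open>A frame is chosen separately for each curve;
    \<open>airy_field_frame_independent\<close> makes the resulting field independent of that
    choice.\<close>
  define X :: "(real \<Rightarrow> real ^ 'm option) \<Rightarrow> (real \<Rightarrow> real ^ 'm option)"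
    where "X = (\<lambda>\<gamma>. SOME f. \<exists>g k. parallel_frame L \<gamma> g k \<and> f = airy_field j g k)"
  have X: "X \<gamma> = airy_field j g k" if f: "parallel_frame L \<gamma> g k" for \<gamma> g k
  proof -
    have "\<exists>g k. parallel_frame L \<gamma> g k \<and> X \<gamma> = airy_field j g k"
      unfolding X_def using f by (intro someI[where P="\<lambda>f. \<exists>g k. parallel_frame L \<gamma> g k \<and> f = airy_field j g k"]) blast
    then show ?thesis using airy_field_frame_independent[OF f _ assms(2)] by metis
  qed
  have "hamiltonian_at L (F_functional L j) \<gamma> (X \<gamma>)" if \<gamma>: "\<gamma> \<in> curves L" for \<gamma>
  proof -
    obtain g k where f: "parallel_frame L \<gamma> g k" and "smooth_loop L \<gamma>" using \<gamma> by (auto simp: curves_def)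
    then show ?thesis using airy_field_hamiltonian[OF assms] by (simp add: X[OF f])
  qed
  then show "\<exists>X :: (real \<Rightarrow> real ^ 'm option) \<Rightarrow> (real \<Rightarrow> real ^ 'm option).
       hamiltonian_field L (F_functional L j) X \<and>
       (\<forall>\<gamma> \<in> curves L. \<forall>g k. parallel_frame L \<gamma> g k \<longrightarrow> X \<gamma> = airy_field j g k)"
    using X unfolding hamiltonian_field_def by blast
  show "hamiltonian_flow L (F_functional L j) T \<gamma>" if "open T" "airy_curve_flow L j T \<gamma>"
    for T and \<gamma> :: "real \<Rightarrow> real \<Rightarrow> real ^ 'm option"
    by (rule airy_flow_hamiltonian[OF assms that])
qed

end
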